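(* Let $J$ be an $m\times m$ signature matrix, $n\in\mathbb N_0$, $(A_j)_{j=0}^n$ a $J$-Potapov sequence, and (if $n\ge1$) $V_n\in\mathcal Y_{n,J}$, $W_n\in\mathcal Z_{n,J}$; let $\pi_{n,J},\rho_{n,J},\sigma_{n,J},\tau_{n,J}$ be the associated polynomials. Let $S\in\mathcal S_{m\times m}(\mathbb D)$. Then neither $w\mapsto\det(wJ\tilde\sigma_{n,J}^{[n]}(w)\sqrt{L_{n+1,J}}^+S(w)\sqrt{R_{n+1,J}}+\rho_{n,J}(w))$ nor $w\mapsto\det(w\sqrt{L_{n+1,J}}S(w)\sqrt{R_{n+1,J}}^+\tilde\pi_{n,J}^{[n]}(w)J+\tau_{n,J}(w))$ vanishes identically in $\mathbb D$, the meromorphic function $$f:=\big(wJ\tilde\tau_{n,J}^{[n]}\sqrt{L_{n+1,J}}^+S\sqrt{R_{n+1,J}}+\pi_{n,J}\big)\big(wJ\tilde\sigma_{n,J}^{[n]}\sqrt{L_{n+1,J}}^+S\sqrt{R_{n+1,J}}+\rho_{n,J}\big)^{-1}$$ (variable $w\in\mathbb D$) belongs to $\mathcal P_{J,0}[\mathbb D,(A_j)_{j=0}^n]$, and, as meromorphic functions in $\mathbb D$, $$f=\big(w\sqrt{L_{n+1,J}}S\sqrt{R_{n+1,J}}^+\tilde\pi_{n,J}^{[n]}J+\tau_{n,J}\big)^{-1}\big(w\sqrt{L_{n+1,J}}S\sqrt{R_{n+1,J}}^+\tilde\rho_{n,J}^{[n]}J+\sigma_{n,J}\big).$$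
   Context: $m\in\mathbb N$, $\mathbb D=\{z\in\mathbb C:|z|<1\}$. An $m\times m$ signature matrix is $J\in\mathbb C^{m\times m}$ with $J^*=J$, $J^2=I_m$. A matrix $A$ is $J$-contractive if $J-A^*JA$ is nonnegative Hermitian. For $f$ meromorphic in $\mathbb D$, $\mathbb H_f$ is the set of points where $f$ is holomorphic. $\mathcal P_{J,0}(\mathbb D)$: $\mathbb C^{m\times m}$-valued $f$ meromorphic in $\mathbb D$ with $0\in\mathbb H_f$ and $f(w)$ $J$-contractive for $w\in\mathbb H_f$. $\mathcal S_{m\times m}(\mathbb D)$: holomorphic $S:\mathbb D\to\mathbb C^{m\times m}$ with $\|S(w)\|\le1$. $\mathcal P_{J,0}[\mathbb D,(A_j)_{j=0}^n]$: those $f\in\mathcal P_{J,0}(\mathbb D)$ with $f^{(j)}(0)/j!=A_j$, $j=0,\dots,n$. For $k\in\mathbb N_0$, $S_k$ is the block lower triangular Toeplitz matrix with $(i,l)$ block $A_{i-l}$ ($i\ge l$), $0$ otherwise ($0\le i,l\le k$); $J_{[k]}:=\mathrm{diag}(J,\dots,J)$ ($k+1$ blocks). $(A_j)_{j=0}^n$ is a $J$-Potapov sequence if $J_{[n]}-S_n^*J_{[n]}S_n\ge0$. $P_{k,J}:=J_{[k]}-S_kJ_{[k]}S_k^*$, $Q_{k,J}:=J_{[k]}-S_k^*J_{[k]}S_k$, $y_k:=(A_1^*,\dots,A_k^* )^*$, $z_k:=(A_k,\dots,A_1)$. $X^+$: Moore–Penrose inverse; $\sqrt X$: nonnegative square root;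 $\sqrt X^+:=(\sqrt X)^+$. $L_{1,J}:=J-A_0JA_0^*$, $R_{1,J}:=J-A_0^*JA_0$; for $n\ge1$, $L_{n+1,J}:=J-A_0JA_0^*-z_nQ_{n-1,J}^+z_n^*$, $R_{n+1,J}:=J-A_0^*JA_0-y_n^*P_{n-1,J}^+y_n$. $e_{k,m}(w):=(I_m,wI_m,\dots,w^kI_m)$, $\varepsilon_{k,m}(w):=$ block column $(w^kI_m;\dots;wI_m;I_m)$. For $b(w)=\sum_{k=0}^nw^kB_k$, $\tilde b^{[n]}(w):=\sum_{k=0}^nw^{n-k}B_k^*$. For $n\ge1$: $\mathcal Y_{n,J}:=\{V\in\mathbb C^{nm\times m}:Q_{n-1,J}V=S_{n-1}^*J_{[n-1]}y_n\}$, $\mathcal Z_{n,J}:=\{W\in\mathbb C^{m\times nm}:WP_{n-1,J}=z_nJ_{[n-1]}S_{n-1}^*\}$. Associated polynomials: $\pi_{n,J}(w)=A_0+we_{n-1,m}(w)(y_n+S_{n-1}V_n)$, $\rho_{n,J}(w)=I_m+we_{n-1,m}(w)V_n$, $\sigma_{n,J}(w)=(W_nS_{n-1}+z_n)w\varepsilon_{n-1,m}(w)+A_0$, $\tau_{n,J}(w)=W_nw\varepsilon_{n-1,m}(w)+I_m$; for $n=0$: $\pi_{0,J}=\sigma_{0,J}=A_0$, $\rho_{0,J}=\tau_{0,J}=I_m$. Reciprocals are taken with formal degree $n$. *)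

theory Defs
  imports "HOL-Analysis.Analysis" "Jordan_Normal_Form.Determinant"
begin

definition adj :: "complex mat \<Rightarrow> complex mat" where
  "adj A = mat (dim_col A) (dim_row A) (\<lambda>(i,j). cnj (A $$ (j,i)))"

definition qform :: "complex mat \<Rightarrow> complex vec \<Rightarrow> complex" where
  "qform A v = (\<Sum>i<dim_vec v. cnj (v $ i) * (A *\<^sub>v v) $ i)"

definition psd :: "complex mat \<Rightarrow> bool" where
  "psd A \<longleftrightarrow> A \<in> carrier_mat (dim_row A) (dim_row A) \<and> adj A = A \<and>
     (\<forall>v \<in> carrier_vec (dim_row A). 0 \<le> Re (qform A v))"

text \<open>inverse of a square matrix (meaningful when the determinant is nonzero)\<close>
definition minv :: "complex mat \<Rightarrow> complex mat" where
  "minv A = (SOME B. B \<in> carrier_mat (dim_row A) (dim_row A) \<and>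
                 A * B = 1\<^sub>m (dim_row A) \<and> B * A = 1\<^sub>m (dim_row A))"

definition pinv :: "complex mat \<Rightarrow> complex mat" where
  "pinv X = (THE Y. Y \<in> carrier_mat (dim_col X) (dim_row X) \<and> X * Y * X = X \<and> Y * X * Y = Y
              \<and> adj (X * Y) = X * Y \<and> adj (Y * X) = Y * X)"

definition msqrt :: "complex mat \<Rightarrow> complex mat" where
  "msqrt X = (THE B. psd B \<and> B * B = X)"

definition vnorm2 :: "complex vec \<Rightarrow> real" where
  "vnorm2 v = (\<Sum>i<dim_vec v. (cmod (v $ i))\<^sup>2)"

definition contraction :: "nat \<Rightarrow> complex mat \<Rightarrow> bool" where
  "contraction m A \<longleftrightarrow> A \<in> carrier_mat m m \<and>
     (\<forall>v \<in> carrier_vec m. vnorm2 (A *\<^sub>v v) \<le> vnorm2 v)"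

definition signature :: "nat \<Rightarrow> complex mat \<Rightarrow> bool" where
  "signature m J \<longleftrightarrow> J \<in> carrier_mat m m \<and> adj J = J \<and> J * J = 1\<^sub>m m"

definition J_contractive :: "complex mat \<Rightarrow> complex mat \<Rightarrow> bool" where
  "J_contractive J A \<longleftrightarrow> psd (J - adj A * J * A)"

definition blockmat :: "nat \<Rightarrow> nat \<Rightarrow> nat \<Rightarrow> (nat \<Rightarrow> nat \<Rightarrow> complex mat) \<Rightarrow> complex mat" where
  "blockmat m r c f = mat (r * m) (c * m) (\<lambda>(i,j). f (i div m) (j div m) $$ (i mod m, j mod m))"

definition Smat :: "nat \<Rightarrow> (nat \<Rightarrow> complex mat) \<Rightarrow> nat \<Rightarrow> complex mat" where
  "Smat m A k = blockmat m (k+1) (k+1) (\<lambda>i l. if l \<le> i then A (i - l) else 0\<^sub>m m m)"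

definition Jblk :: "nat \<Rightarrow> complex mat \<Rightarrow> nat \<Rightarrow> complex mat" where
  "Jblk m J k = blockmat m (k+1) (k+1) (\<lambda>i l. if i = l then J else 0\<^sub>m m m)"

definition Pmat :: "nat \<Rightarrow> complex mat \<Rightarrow> (nat \<Rightarrow> complex mat) \<Rightarrow> nat \<Rightarrow> complex mat" where
  "Pmat m J A k = Jblk m J k - Smat m A k * Jblk m J k * adj (Smat m A k)"

definition Qmat :: "nat \<Rightarrow> complex mat \<Rightarrow> (nat \<Rightarrow> complex mat) \<Rightarrow> nat \<Rightarrow> complex mat" where
  "Qmat m J A k = Jblk m J k - adj (Smat m A k) * Jblk m J k * Smat m A k"

definition yvec :: "nat \<Rightarrow> (nat \<Rightarrow> complex mat) \<Rightarrow> nat \<Rightarrow> complex mat" where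
  "yvec m A k = blockmat m k 1 (\<lambda>i l. A (i + 1))"

definition zvec :: "nat \<Rightarrow> (nat \<Rightarrow> complex mat) \<Rightarrow> nat \<Rightarrow> complex mat" where
  "zvec m A k = blockmat m 1 k (\<lambda>i l. A (k - l))"

definition J_Potapov :: "nat \<Rightarrow> complex mat \<Rightarrow> (nat \<Rightarrow> complex mat) \<Rightarrow> nat \<Rightarrow> bool" where
  "J_Potapov m J A n \<longleftrightarrow> (\<forall>j\<le>n. A j \<in> carrier_mat m m) \<and>
     psd (Jblk m J n - adj (Smat m A n) * Jblk m J n * Smat m A n)"

definition Lmat :: "nat \<Rightarrow> complex mat \<Rightarrow> (nat \<Rightarrow> complex mat) \<Rightarrow> nat \<Rightarrow> complex mat" where
  "Lmat m J A n = (if n = 0 then J - A 0 * J * adj (A 0)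
     else J - A 0 * J * adj (A 0) - zvec m A n * pinv (Qmat m J A (n - 1)) * adj (zvec m A n))"

definition Rmat :: "nat \<Rightarrow> complex mat \<Rightarrow> (nat \<Rightarrow> complex mat) \<Rightarrow> nat \<Rightarrow> complex mat" where
  "Rmat m J A n = (if n = 0 then J - adj (A 0) * J * A 0
     else J - adj (A 0) * J * A 0 - adj (yvec m A n) * pinv (Pmat m J A (n - 1)) * yvec m A n)"

definition Yset :: "nat \<Rightarrow> complex mat \<Rightarrow> (nat \<Rightarrow> complex mat) \<Rightarrow> nat \<Rightarrow> complex mat set" where
  "Yset m J A n = {V. V \<in> carrier_mat (n * m) m \<and>
     Qmat m J A (n - 1) * V = adj (Smat m A (n - 1)) * Jblk m J (n - 1) * yvec m A n}"

definition Zset :: "nat \<Rightarrow> complex mat \<Rightarrow> (nat \<Rightarrow> complex mat) \<Rightarrow> nat \<Rightarrow> complex mat set" where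
  "Zset m J A n = {W. W \<in> carrier_mat m (n * m) \<and>
     W * Pmat m J A (n - 1) = zvec m A n * Jblk m J (n - 1) * adj (Smat m A (n - 1))}"

definition evec :: "nat \<Rightarrow> nat \<Rightarrow> complex \<Rightarrow> complex mat" where
  "evec k m w = blockmat m 1 (k+1) (\<lambda>i j. w ^ j \<cdot>\<^sub>m 1\<^sub>m m)"

definition epsvec :: "nat \<Rightarrow> nat \<Rightarrow> complex \<Rightarrow> complex mat" where
  "epsvec k m w = blockmat m (k+1) 1 (\<lambda>i j. w ^ (k - i) \<cdot>\<^sub>m 1\<^sub>m m)"

definition piJ :: "nat \<Rightarrow> (nat \<Rightarrow> complex mat) \<Rightarrow> complex mat \<Rightarrow> nat \<Rightarrow> complex \<Rightarrow> complex mat" where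
  "piJ m A V n w = (if n = 0 then A 0
     else A 0 + w \<cdot>\<^sub>m (evec (n - 1) m w * (yvec m A n + Smat m A (n - 1) * V)))"

definition rhoJ :: "nat \<Rightarrow> complex mat \<Rightarrow> nat \<Rightarrow> complex \<Rightarrow> complex mat" where
  "rhoJ m V n w = (if n = 0 then 1\<^sub>m m else 1\<^sub>m m + w \<cdot>\<^sub>m (evec (n - 1) m w * V))"

definition sigmaJ :: "nat \<Rightarrow> (nat \<Rightarrow> complex mat) \<Rightarrow> complex mat \<Rightarrow> nat \<Rightarrow> complex \<Rightarrow> complex mat" where
  "sigmaJ m A W n w = (if n = 0 then A 0
     else (W * Smat m A (n - 1) + zvec m A n) * (w \<cdot>\<^sub>m epsvec (n - 1) m w) + A 0)"

definition tauJ :: "nat \<Rightarrow> complex mat \<Rightarrow> nat \<Rightarrow> complex \<Rightarrow> complex mat" where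
  "tauJ m W n w = (if n = 0 then 1\<^sub>m m else W * (w \<cdot>\<^sub>m epsvec (n - 1) m w) + 1\<^sub>m m)"

definition tcoef :: "nat \<Rightarrow> (complex \<Rightarrow> complex mat) \<Rightarrow> nat \<Rightarrow> complex mat" where
  "tcoef m b k = mat m m (\<lambda>(i,j). (deriv ^^ k) (\<lambda>z. b z $$ (i,j)) 0 / of_nat (fact k))"

text \<open>reciprocal polynomial of formal degree n: for b(w) = sum_k w^k B_k,
  recip(w) = sum_k w^(n-k) B_k^*, the B_k being the Taylor coefficients of b at 0\<close>
definition recip :: "nat \<Rightarrow> nat \<Rightarrow> (complex \<Rightarrow> complex mat) \<Rightarrow> complex \<Rightarrow> complex mat" where
  "recip m n b w = mat m m (\<lambda>(i,j). \<Sum>k\<le>n. w ^ (n - k) * cnj (tcoef m b k $$ (j,i)))"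

definition mat_holo_on :: "nat \<Rightarrow> (complex \<Rightarrow> complex mat) \<Rightarrow> complex set \<Rightarrow> bool" where
  "mat_holo_on m F U \<longleftrightarrow> (\<forall>z\<in>U. F z \<in> carrier_mat m m) \<and>
     (\<forall>i<m. \<forall>j<m. (\<lambda>z. F z $$ (i,j)) holomorphic_on U)"

text \<open>F is holomorphic at w (after removing a removable singularity): F agrees on a punctured
  disc around w with a function holomorphic on the full disc\<close>
definition holo_pt :: "nat \<Rightarrow> (complex \<Rightarrow> complex mat) \<Rightarrow> complex \<Rightarrow> bool" where
  "holo_pt m F w \<longleftrightarrow> (\<exists>g r. 0 < r \<and> mat_holo_on m g (ball w r) \<and> (\<forall>z \<in> ball w r - {w}. F z = g z))"

definition mval :: "nat \<Rightarrow> (complex \<Rightarrow> complex mat) \<Rightarrow> complex \<Rightarrow> complex mat" where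
  "mval m F w = (THE M. \<exists>g r. 0 < r \<and> mat_holo_on m g (ball w r) \<and>
       (\<forall>z \<in> ball w r - {w}. F z = g z) \<and> g w = M)"

definition mero_on :: "nat \<Rightarrow> (complex \<Rightarrow> complex mat) \<Rightarrow> complex set \<Rightarrow> bool" where
  "mero_on m F U \<longleftrightarrow> (\<forall>w\<in>U. \<exists>k::nat. holo_pt m (\<lambda>z. (z - w) ^ k \<cdot>\<^sub>m F z) w)"

definition Hset :: "nat \<Rightarrow> (complex \<Rightarrow> complex mat) \<Rightarrow> complex set" where
  "Hset m F = {w \<in> ball 0 1. holo_pt m F w}"

definition P_J0 :: "nat \<Rightarrow> complex mat \<Rightarrow> (complex \<Rightarrow> complex mat) \<Rightarrow> bool" where
  "P_J0 m J F \<longleftrightarrow> mero_on m F (ball 0 1) \<and> 0 \<in> Hset m F \<and>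
     (\<forall>w \<in> Hset m F. J_contractive J (mval m F w))"

definition P_J0_interp :: "nat \<Rightarrow> complex mat \<Rightarrow> (nat \<Rightarrow> complex mat) \<Rightarrow> nat \<Rightarrow> (complex \<Rightarrow> complex mat) \<Rightarrow> bool" where
  "P_J0_interp m J A n F \<longleftrightarrow> P_J0 m J F \<and> (\<forall>j\<le>n. tcoef m (mval m F) j = A j)"

definition Schur_class :: "nat \<Rightarrow> (complex \<Rightarrow> complex mat) \<Rightarrow> bool" where
  "Schur_class m S \<longleftrightarrow> mat_holo_on m S (ball 0 1) \<and> (\<forall>w \<in> ball 0 1. contraction m (S w))"

end

theory Submission
  imports Defs "HOL-Complex_Analysis.Complex_Analysis" "Jordan_Normal_Form.Schur_Decomposition"
    "Jordan_Normal_Form.Spectral_Radius"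
begin

text \<open>
  Put $d = (n+1)m$ and let $N$ be the block shift, $E_w = (I, wI, \ldots, w^nI)$,
  $M_w = (I - wN^*)^{-1}$, so that $E_w$ is the first block row of $M_w$. Stacking coefficients,
  $\rho = E_w U$ and $\pi = E_w S_n U$ with $U = (I; V_n)$, while the reciprocals of $\tau$ and
  $\sigma$ are $E_w X$ and $E_w S_n^* X$ with $X = (W_n, I)^*$. The equations defining $V_n$ and
  $W_n$ say that $Q_n U$ is concentrated in the first block, with entry $R_{n+1}$, and that $P_n X$
  is concentrated in the last block, with entry $L_{n+1}$. Since $S_n$ commutes with $N$, the kernel
  $E_v^*JE_w - S_n E_v^*JE_w S_n^*$ telescopes to $M_v^*(P_n - N P_n N^*)M_w$. For $v = w$ and
  $f = gh^{-1}$ this writes $h^*Jh - g^*Jg$ as $R - |w|^2 Z^*LZ$ plus $1-|w|^2$ times a nonnegative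
  Hermitian matrix, with $Z = \sqrt{L}^+S\sqrt{R}$; hence $f$ is $J$-contractive. For
  $\overline{v}w = 1$ it gives the identities behind the equality of the two quotients. The
  interpolation property holds because multiplication by $S_n$ is truncated polynomial
  multiplication.
\<close>

subsection \<open>Matrix algebra\<close>

text \<open>The hypothesis supplies \<open>Q_n >= 0\<close>, but the kernel identity produces
  \<open>P_n\<close>. Since J is indefinite, the passage between them goes through the
  Potapov-Ginzburg transform, which reduces it to the fact that the adjoint of a contraction is a
  contraction. \<open>Q_{n-1}\<close>, \<open>P_{n-1}\<close>, L and R may be singular. The choice
  of V and W is felt only through the equations for \<open>Q_n U\<close> and \<open>P_n X\<close>,
  and the square roots only through sqrt(R)^+ R = sqrt(R), L sqrt(L)^+ = sqrt(L) and the
  contractivity of the projection sqrt(L) sqrt(L)^+. Indefiniteness also lets a denominator vanish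
  inside the disc. Both denominators equal I at 0, so the quotients are meromorphic, and
  contractivity at a removable singularity is reached as a limit. N is nilpotent, so
  \<open>M_w\<close> is a polynomial in w. It exists at the reflected point v = 1 / conj w outside
  the disc, where the reciprocal of b is w^n times the adjoint of b(v). The parameter S leaves the
  first n Taylor coefficients alone: \<open>E_w\<close> sends the last block to w^n, and the
  explicit factor w in f raises this to order n + 1.\<close>

lemma mult_assoc_dim:
  "dim_col A = dim_row B \<Longrightarrow> dim_col B = dim_row C \<Longrightarrow> (A * B) * C = A * (B * C)"
  for A B C :: "complex mat"
  by (rule assoc_mult_mat[of A "dim_row A" "dim_col A" B "dim_col B" C "dim_col C"]) auto

lemma add_mult_dim:
  "dim_row A = dim_row B \<Longrightarrow> dim_col A = dim_col B \<Longrightarrow> dim_col B = dim_row C \<Longrightarrow> (A + B) * C = A * C + B * C"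
  for A B C :: "complex mat"
  by (rule add_mult_distrib_mat[of A "dim_row A" "dim_col A" B C "dim_col C"]) auto

lemma mult_add_dim:
  "dim_row B = dim_row C \<Longrightarrow> dim_col B = dim_col C \<Longrightarrow> dim_col A = dim_row B \<Longrightarrow> A * (B + C) = A * B + A * C"
  for A B C :: "complex mat"
  by (rule mult_add_distrib_mat[of A "dim_row A" "dim_col A" B "dim_col B"]) auto

lemma minus_mult_dim:
  "dim_row A = dim_row B \<Longrightarrow> dim_col A = dim_col B \<Longrightarrow> dim_col B = dim_row C \<Longrightarrow> (A - B) * C = A * C - B * C"
  for A B C :: "complex mat"
  by (rule minus_mult_distrib_mat[of A "dim_row A" "dim_col A" B C "dim_col C"]) auto

lemma mult_minus_dim:
  "dim_row B = dim_row C \<Longrightarrow> dim_col B = dim_col C \<Longrightarrow> dim_col A = dim_row B \<Longrightarrow> A * (B - C) = A * B - A * C"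
  for A B C :: "complex mat"
  by (rule mult_minus_distrib_mat[of A "dim_row A" "dim_col A" B "dim_col B"]) auto

lemma smult_mult_dim: "dim_col A = dim_row B \<Longrightarrow> (k \<cdot>\<^sub>m A) * B = k \<cdot>\<^sub>m (A * B)"
  for A B :: "complex mat"
  by (rule mult_smult_assoc_mat[of A "dim_row A" "dim_col A" B "dim_col B"]) auto

lemma mult_smult_dim: "dim_col A = dim_row B \<Longrightarrow> A * (k \<cdot>\<^sub>m B) = k \<cdot>\<^sub>m (A * B)"
  for A B :: "complex mat"
  by (rule mult_smult_distrib[of A "dim_row A" "dim_col A" B "dim_col B"]) auto

lemma adj_dim [simp]: "dim_row (adj A) = dim_col A" "dim_col (adj A) = dim_row A"
  by (auto simp: adj_def)

lemma adj_index [simp]: "i < dim_col A \<Longrightarrow> j < dim_row A \<Longrightarrow> adj A $$ (i,j) = cnj (A $$ (j,i))"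
  by (auto simp: adj_def)

lemma adj_carrier [simp]: "adj A \<in> carrier_mat k n \<longleftrightarrow> A \<in> carrier_mat n k"
  by (metis adj_dim carrier_matD carrier_matI)

lemma adj_adj [simp]: "adj (adj A) = A"
  by (rule eq_matI) auto

lemma adj_add: "dim_row A = dim_row B \<Longrightarrow> dim_col A = dim_col B \<Longrightarrow> adj (A + B) = adj A + adj B"
  by (rule eq_matI) auto

lemma adj_minus: "dim_row A = dim_row B \<Longrightarrow> dim_col A = dim_col B \<Longrightarrow> adj (A - B) = adj A - adj B"
  by (rule eq_matI) auto

lemma adj_smult: "adj (k \<cdot>\<^sub>m A) = cnj k \<cdot>\<^sub>m adj A"
  by (rule eq_matI) auto

lemma adj_one [simp]: "adj (1\<^sub>m n) = 1\<^sub>m n"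
  by (rule eq_matI) auto

lemma adj_zero [simp]: "adj (0\<^sub>m n k) = 0\<^sub>m k n"
  by (rule eq_matI) auto

lemma mult_index_sum:
  "i < dim_row A \<Longrightarrow> j < dim_col B \<Longrightarrow> (A * B) $$ (i,j) = (\<Sum>k<dim_row B. A $$ (i,k) * B $$ (k,j))"
  if "dim_col A = dim_row B" for A B :: "complex mat"
  using that by (simp add: scalar_prod_def lessThan_atLeast0)

lemma adj_mult: "dim_col A = dim_row B \<Longrightarrow> adj (A * B) = adj B * adj A"
  by (rule eq_matI) (auto simp: mult_index_sum mult.commute simp del: index_mult_mat(1))

lemma one_mult_dim: "dim_row A = n \<Longrightarrow> 1\<^sub>m n * A = A" "dim_col A = n \<Longrightarrow> A * 1\<^sub>m n = A"
  for A :: "complex mat"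
  by (auto intro: left_mult_one_mat[of A n "dim_col A"] right_mult_one_mat[of A "dim_row A" n])

lemma zero_mult_dim: "dim_row A = n \<Longrightarrow> 0\<^sub>m k n * A = 0\<^sub>m k (dim_col A)"
    "dim_col A = n \<Longrightarrow> A * 0\<^sub>m n k = 0\<^sub>m (dim_row A) k"
  for A :: "complex mat"
  by (auto intro: left_mult_zero_mat[of A n "dim_col A"] right_mult_zero_mat[of A "dim_row A" n])

text \<open>Dimension equations instead of carrier premises let the simplifier discharge the side
  conditions, so products can be normalised as in a ring.\<close>

lemmas mat_alg = mult_assoc_dim add_mult_dim mult_add_dim minus_mult_dim mult_minus_dim
  smult_mult_dim mult_smult_dim adj_add adj_minus adj_smult adj_mult one_mult_dim zero_mult_dim

subsection \<open>Nonnegative Hermitian matrices\<close>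

definition ip :: "complex vec \<Rightarrow> complex vec \<Rightarrow> complex" where
  "ip u v = (\<Sum>i<dim_vec u. cnj (u $ i) * v $ i)"

lemma qform_ip: "dim_row A = dim_vec v \<Longrightarrow> qform A v = ip v (A *\<^sub>v v)"
  by (simp add: qform_def ip_def)

lemma mult_mat_vec_sum: "dim_col A = dim_vec v \<Longrightarrow> i < dim_row A \<Longrightarrow> (A *\<^sub>v v) $ i = (\<Sum>j<dim_vec v. A $$ (i,j) * v $ j)"
  for A :: "complex mat"
  by (simp add: scalar_prod_def lessThan_atLeast0)

lemma ip_adj: "dim_col A = dim_vec u \<Longrightarrow> dim_row A = dim_vec v \<Longrightarrow> ip (A *\<^sub>v u) v = ip u (adj A *\<^sub>v v)"
proof -
  assume d: "dim_col A = dim_vec u" "dim_row A = dim_vec v"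
  have "ip (A *\<^sub>v u) v = (\<Sum>i<dim_vec v. \<Sum>j<dim_vec u. cnj (A $$ (i,j)) * cnj (u $ j) * v $ i)"
    using d by (simp add: ip_def mult_mat_vec_sum sum_distrib_right del: index_mult_mat_vec)
  also have "\<dots> = (\<Sum>j<dim_vec u. \<Sum>i<dim_vec v. cnj (A $$ (i,j)) * cnj (u $ j) * v $ i)"
    by (rule sum.swap)
  also have "\<dots> = ip u (adj A *\<^sub>v v)"
    using d by (simp add: ip_def mult_mat_vec_sum sum_distrib_left mult_ac del: index_mult_mat_vec)
  finally show ?thesis .
qed

lemma ip_cnj: "dim_vec u = dim_vec v \<Longrightarrow> cnj (ip u v) = ip v u"
  by (simp add: ip_def mult.commute)

lemma ip_self: "ip v v = of_real (vnorm2 v)"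
  by (simp add: ip_def vnorm2_def mult.commute complex_norm_square[symmetric])

lemma vnorm2_nonneg [simp]: "0 \<le> vnorm2 v"
  by (simp add: vnorm2_def sum_nonneg)

lemma vnorm2_eq_0: "vnorm2 v = 0 \<longleftrightarrow> v = 0\<^sub>v (dim_vec v)"
proof
  assume "vnorm2 v = 0"
  then have "\<forall>i\<in>{..<dim_vec v}. (cmod (v $ i))\<^sup>2 = 0"
    unfolding vnorm2_def by (subst (asm) sum_nonneg_eq_0_iff) auto
  then show "v = 0\<^sub>v (dim_vec v)" by (intro eq_vecI) auto
next
  assume "v = 0\<^sub>v (dim_vec v)"
  then have "\<And>i. i < dim_vec v \<Longrightarrow> v $ i = 0" by (metis index_zero_vec(1))
  then show "vnorm2 v = 0" by (simp add: vnorm2_def)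
qed

lemma ip_add: "dim_vec u = dim_vec v \<Longrightarrow> dim_vec v = dim_vec w \<Longrightarrow> ip u (v + w) = ip u v + ip u w"
  "dim_vec u = dim_vec v \<Longrightarrow> dim_vec v = dim_vec w \<Longrightarrow> ip (u + v) w = ip u w + ip v w"
  "dim_vec u = dim_vec v \<Longrightarrow> dim_vec v = dim_vec w \<Longrightarrow> ip u (v - w) = ip u v - ip u w"
  "dim_vec u = dim_vec v \<Longrightarrow> dim_vec v = dim_vec w \<Longrightarrow> ip (u - v) w = ip u w - ip v w"
  by (simp_all add: ip_def algebra_simps sum.distrib sum_subtractf)

lemma mult_vec_dim:
  "dim_col A = dim_row B \<Longrightarrow> dim_col B = dim_vec v \<Longrightarrow> (A * B) *\<^sub>v v = A *\<^sub>v (B *\<^sub>v v)"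
  "dim_row A = dim_row C \<Longrightarrow> dim_col A = dim_col C \<Longrightarrow> dim_col C = dim_vec v \<Longrightarrow> (A + C) *\<^sub>v v = A *\<^sub>v v + C *\<^sub>v v"
  "dim_row A = dim_row C \<Longrightarrow> dim_col A = dim_col C \<Longrightarrow> dim_col C = dim_vec v \<Longrightarrow> (A - C) *\<^sub>v v = A *\<^sub>v v - C *\<^sub>v v"
  "dim_col A = dim_vec v \<Longrightarrow> (k \<cdot>\<^sub>m A) *\<^sub>v v = k \<cdot>\<^sub>v (A *\<^sub>v v)"
  "dim_vec v = n \<Longrightarrow> 1\<^sub>m n *\<^sub>v v = v"
  for A B C :: "complex mat"
      apply (rule assoc_mult_mat_vec[of A "dim_row A" "dim_col A" B "dim_col B"]; auto)
     apply (rule add_mult_distrib_mat_vec[of A "dim_row A" "dim_col A"]; auto)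
    apply (rule minus_mult_distrib_mat_vec[of A "dim_row A" "dim_col A"]; auto)
   apply (rule eq_vecI; auto simp: scalar_prod_def sum_distrib_left mult_ac)
  apply (rule one_mult_mat_vec[of v n]; auto)
  done

lemma psdI: "A \<in> carrier_mat n n \<Longrightarrow> adj A = A \<Longrightarrow> (\<And>v. v \<in> carrier_vec n \<Longrightarrow> 0 \<le> Re (ip v (A *\<^sub>v v))) \<Longrightarrow> psd A"
  by (auto simp: psd_def qform_ip)

lemma psdD:
  assumes "psd A"
  shows "dim_col A = dim_row A" "adj A = A" "dim_vec v = dim_row A \<Longrightarrow> 0 \<le> Re (ip v (A *\<^sub>v v))"
proof -
  show d: "dim_col A = dim_row A" and "adj A = A"
    using assms unfolding psd_def by auto
  assume v: "dim_vec v = dim_row A"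
  then have "v \<in> carrier_vec (dim_row A)" by (metis carrier_vec_dim_vec)
  then have "0 \<le> Re (qform A v)" using assms by (simp add: psd_def)
  then show "0 \<le> Re (ip v (A *\<^sub>v v))" using v by (simp add: qform_ip)
qed

lemma psd_congruence: "psd P \<Longrightarrow> dim_row G = dim_row P \<Longrightarrow> psd (adj G * (P * G))"
  apply (rule psdI[of _ "dim_col G"])
    apply (rule carrier_matI; simp)
   apply (simp add: mat_alg psdD)
  apply (simp add: psdD mult_vec_dim ip_adj[of G, symmetric])
  done

lemma psd_gram: "psd (adj G * G)"
  apply (rule psdI[of _ "dim_col G"])
    apply (rule carrier_matI; simp)
   apply (simp add: mat_alg)
  apply (simp add: mult_vec_dim ip_adj[of G, symmetric] ip_self)
  done

lemma psd_add: "psd A \<Longrightarrow> psd B \<Longrightarrow> dim_row A = dim_row B \<Longrightarrow> psd (A + B)"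
  apply (rule psdI[of _ "dim_row A"])
    apply (rule carrier_matI; simp add: psdD)
   apply (simp add: mat_alg psdD)
  apply (simp add: psdD mult_vec_dim ip_add)
  done

lemma psd_smult:
  assumes "psd A" "0 \<le> r" shows "psd (complex_of_real r \<cdot>\<^sub>m A)"
proof (rule psdI[of _ "dim_row A"])
  fix v :: "complex vec" assume v: "v \<in> carrier_vec (dim_row A)"
  have "ip v ((complex_of_real r \<cdot>\<^sub>m A) *\<^sub>v v) = of_real r * ip v (A *\<^sub>v v)"
    using v psdD(1)[OF assms(1)]
    by (simp add: mult_vec_dim ip_def sum_distrib_left mult_ac)
  then show "0 \<le> Re (ip v ((complex_of_real r \<cdot>\<^sub>m A) *\<^sub>v v))"
    using psdD(3)[OF assms(1), of v] v assms(2) by simp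
qed (use assms psdD[OF assms(1)] in \<open>auto simp: adj_smult\<close>)

text \<open>With u the image of v under the adjoint and t = A u, expanding 0 \<le> |v - t|^2 gives
  2|u|^2 \<le> |v|^2 + |t|^2, because the inner product of t and v is |u|^2. Contractivity of A
  bounds |t| by |u|.\<close>

lemma adj_contraction:
  assumes "contraction m A" shows "contraction m (adj A)"
proof -
  have A: "A \<in> carrier_mat m m" and c: "\<And>v. v \<in> carrier_vec m \<Longrightarrow> vnorm2 (A *\<^sub>v v) \<le> vnorm2 v"
    using assms by (auto simp: contraction_def)
  have "vnorm2 (adj A *\<^sub>v v) \<le> vnorm2 v" if v: "v \<in> carrier_vec m" for v
  proof -
    define u where "u = adj A *\<^sub>v v"
    have u: "u \<in> carrier_vec m" using A by (intro carrier_vecI) (auto simp: u_def)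
    define t where "t = A *\<^sub>v u"
    have t: "t \<in> carrier_vec m" using A u by (intro carrier_vecI) (auto simp: t_def)
    have d: "dim_vec u = m" "dim_vec v = m" "dim_vec t = m" using u v t by auto
    have "0 \<le> Re (ip (v - t) (v - t))" by (simp add: ip_self)
    also have "ip (v - t) (v - t) = ip v v - ip v t - (ip t v - ip t t)"
      using d by (simp add: ip_add)
    also have "ip t v = ip u u"
      using A d by (simp add: t_def ip_adj u_def[symmetric])
    also have "ip v t = cnj (ip t v)" using d by (simp add: ip_cnj)
    also have "ip t v = ip u u"
      using A d by (simp add: t_def ip_adj u_def[symmetric])
    finally have "2 * vnorm2 u \<le> vnorm2 v + vnorm2 t" by (simp add: ip_self)
    with c[OF u] show ?thesis by (simp add: t_def u_def)
  qed
  then show ?thesis using A by (auto simp: contraction_def)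
qed

subsection \<open>Square roots and pseudoinverses\<close>

definition unitary :: "nat \<Rightarrow> complex mat \<Rightarrow> bool" where
  "unitary n U \<longleftrightarrow> U \<in> carrier_mat n n \<and> adj U * U = 1\<^sub>m n \<and> U * adj U = 1\<^sub>m n"

lemma ip_cscalar_prod: "dim_vec u = dim_vec v \<Longrightarrow> u \<bullet>c v = ip v u"
  by (simp add: scalar_prod_def ip_def lessThan_atLeast0 mult.commute)

text \<open>Gram-Schmidt applied to a basis starting with v keeps v as its first vector. Its output
  is only orthogonal, so the columns are normalised afterwards; this is where the scalar
  \<open>c\<close> comes from.\<close>

lemma unit_vector_completion:
  assumes v: "v \<in> carrier_vec n" and v0: "v \<noteq> 0\<^sub>v n"
  obtains U c where "unitary n U" "col U 0 = c \<cdot>\<^sub>v v" "c \<noteq> 0"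
proof -
  interpret cof_vec_space n "TYPE(complex)" .
  have n: "0 < n" using v v0 by (cases n) auto
  define b where "b = basis_completion v"
  define ws where "ws = gram_schmidt n b"
  note bc = basis_completion[OF v v0, folded b_def]
  obtain vs where bv: "b = v # vs" using bc(6,7) n by (cases b) auto
  note gs = gram_schmidt_result[OF bc(2,4,5) ws_def]
  have hd: "ws ! 0 = v" and len: "length ws = n"
  proof -
    show len: "length ws = n" using gs(4) bc(6) by simp
    have "hd ws = v" using gram_schmidt_hd[OF v, of vs] by (simp add: ws_def bv)
    moreover have "ws \<noteq> []" using len n by auto
    ultimately show "ws ! 0 = v" by (simp add: hd_conv_nth)
  qed
  have wc: "ws ! i \<in> carrier_vec n" if "i < n" for i
    using gs(3) len that by (auto simp: subset_iff)
  define s where "s i = complex_of_real (1 / sqrt (vnorm2 (ws ! i)))" for i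
  define U where "U = mat n n (\<lambda>(i,j). s j * ws ! j $ i)"
  have U: "U \<in> carrier_mat n n" by (simp add: U_def)
  have pos: "vnorm2 (ws ! i) > 0" if "i < n" for i
  proof -
    have "ip (ws ! i) (ws ! i) \<noteq> 0"
      using corthogonalD[OF gs(2), of i i] that len by (simp add: ip_cscalar_prod)
    then show ?thesis using vnorm2_nonneg[of "ws ! i"] by (simp add: ip_self less_le)
  qed
  have "adj U * U = 1\<^sub>m n"
  proof (rule eq_matI)
    fix i j assume ij: "i < dim_row (1\<^sub>m n :: complex mat)" "j < dim_col (1\<^sub>m n :: complex mat)"
    then have ij: "i < n" "j < n" by auto
    have d: "dim_vec (ws ! i) = n" "dim_vec (ws ! j) = n" using wc ij by auto
    have "(adj U * U) $$ (i,j) = (\<Sum>k<n. cnj (s i * ws ! i $ k) * (s j * ws ! j $ k))"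
      using ij by (subst mult_index_sum) (auto simp: U_def)
    also have "\<dots> = cnj (s i) * s j * ip (ws ! i) (ws ! j)"
      using d by (simp add: ip_def sum_distrib_left mult_ac)
    also have "\<dots> = 1\<^sub>m n $$ (i,j)"
    proof (cases "i = j")
      case True
      have "complex_of_real (sqrt (vnorm2 (ws ! j))) * complex_of_real (sqrt (vnorm2 (ws ! j))) = complex_of_real (vnorm2 (ws ! j))"
        by (metis of_real_mult real_sqrt_mult_self vnorm2_nonneg abs_of_nonneg)
      then show ?thesis using True ij pos[OF ij(2)] by (simp add: ip_self s_def field_simps)
    next
      case False
      have "ip (ws ! i) (ws ! j) = 0"
        using corthogonalD[OF gs(2), of j i] ij len False d by (simp add: ip_cscalar_prod)
      then show ?thesis using False ij by simp
    qed
    finally show "(adj U * U) $$ (i,j) = 1\<^sub>m n $$ (i,j)" .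
  qed (auto simp: U_def)
  moreover from mat_mult_left_right_inverse[OF _ U this] U
  have "U * adj U = 1\<^sub>m n" by simp
  ultimately have "unitary n U" using U by (simp add: unitary_def)
  moreover have "col U 0 = s 0 \<cdot>\<^sub>v v"
    using n v hd by (intro eq_vecI) (auto simp: U_def)
  moreover have "s 0 \<noteq> 0" using pos[OF n] by (simp add: s_def)
  ultimately show thesis by (rule that)
qed

lemma diag_block_mult:
  fixes A B A' B' :: "complex mat"
  assumes "A \<in> carrier_mat a b" "B \<in> carrier_mat b c" "A' \<in> carrier_mat a' b'" "B' \<in> carrier_mat b' c'"
  shows "four_block_mat A (0\<^sub>m a b') (0\<^sub>m a' b) A' * four_block_mat B (0\<^sub>m b c') (0\<^sub>m b' c) B'
    = four_block_mat (A * B) (0\<^sub>m a c') (0\<^sub>m a' c) (A' * B')"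
  using assms by (subst mult_four_block_mat[of _ a b _ b' _ a' _ _ c _ c']) (auto simp: zero_mult_dim)

text \<open>Deflation: in a unitary basis whose first vector is an eigenvector, the first column
  vanishes below the corner. Hermitian symmetry clears the first row too, and the remaining block is
  Hermitian of size n. The diagonal entries are shown to be real only in the next version.\<close>

lemma hermitian_spectral:
  assumes "A \<in> carrier_mat n n" "adj A = A"
  shows "\<exists>U D. unitary n U \<and> D \<in> carrier_mat n n \<and> diagonal_mat D \<and> A = U * D * adj U"
  using assms
proof (induction n arbitrary: A)
  case 0
  then show ?case
    by (intro exI[of _ "1\<^sub>m 0"] exI[of _ "A"]) (auto simp: unitary_def diagonal_mat_def one_mult_dim)
next
  case (Suc n A)
  note A = Suc.prems(1)
  obtain e where "e \<in> spectrum A" using spectrum_non_empty[OF A] by auto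
  then obtain v where v: "v \<in> carrier_vec (Suc n)" "v \<noteq> 0\<^sub>v (Suc n)" "A *\<^sub>v v = e \<cdot>\<^sub>v v"
    using A by (auto simp: spectrum_def eigenvalue_def eigenvector_def)
  obtain U c where U: "unitary (Suc n) U" and c: "col U 0 = c \<cdot>\<^sub>v v" "c \<noteq> 0"
    using unit_vector_completion[OF v(1,2)] .
  have Ud [simp]: "dim_row U = Suc n" "dim_col U = Suc n" and UU: "adj U * U = 1\<^sub>m (Suc n)" "U * adj U = 1\<^sub>m (Suc n)"
    using U by (auto simp: unitary_def)
  have Ad [simp]: "dim_row A = Suc n" "dim_col A = Suc n" using A by auto
  define B where "B = adj U * A * U"
  have Bd [simp]: "dim_row B = Suc n" "dim_col B = Suc n" by (auto simp: B_def)
  have Badj: "adj B = B" using Suc.prems(2) by (simp add: B_def mat_alg)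
  have col0: "B $$ (i, 0) = (if i = 0 then e else 0)" if i: "i < Suc n" for i
  proof -
    have "B $$ (i,0) = col B 0 $ i" using i by simp
    also have "col B 0 = adj U *\<^sub>v (A *\<^sub>v col U 0)"
      unfolding B_def by (simp add: mat_alg col_mult2[of _ _ "Suc n" _ "Suc n"] carrier_matI del: col_mult2)
        (subst col_mult2[of _ "Suc n" "Suc n" _ "Suc n"]; (subst col_mult2[of _ "Suc n" "Suc n" _ "Suc n"])?; auto intro: carrier_matI)
    also have "A *\<^sub>v col U 0 = e \<cdot>\<^sub>v col U 0"
      using v c A by (simp add: mult_mat_vec[of _ "Suc n" "Suc n"] smult_smult_assoc mult.commute)
    also have "adj U *\<^sub>v (e \<cdot>\<^sub>v col U 0) = e \<cdot>\<^sub>v (adj U *\<^sub>v col U 0)"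
      by (rule mult_mat_vec[of _ "Suc n" "Suc n"]) (auto intro: carrier_matI carrier_vecI)
    also have "adj U *\<^sub>v col U 0 = col (adj U * U) 0"
      by (subst col_mult2[of _ "Suc n" "Suc n" _ "Suc n"]) (auto intro: carrier_matI)
    finally show ?thesis using i by (simp add: UU)
  qed
  have row0: "B $$ (0, j) = (if j = 0 then cnj e else 0)" if j: "j < Suc n" for j
  proof -
    have "B $$ (0,j) = cnj (B $$ (j,0))" using adj_index[of 0 B j] j by (simp add: Badj)
    then show ?thesis using col0[OF j] by simp
  qed
  define B' where "B' = mat n n (\<lambda>(i,j). B $$ (Suc i, Suc j))"
  have B': "B' \<in> carrier_mat n n" "adj B' = B'"
  proof -
    show "adj B' = B'"
    proof (rule eq_matI)
      fix i j assume "i < dim_row B'" "j < dim_col B'"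
      then show "adj B' $$ (i,j) = B' $$ (i,j)"
        using adj_index[of "Suc i" B "Suc j"] by (simp add: Badj B'_def)
    qed (auto simp: B'_def)
  qed (simp add: B'_def)
  have Bblock: "B = four_block_mat (mat 1 1 (\<lambda>_. e)) (0\<^sub>m 1 n) (0\<^sub>m n 1) B'"
    using col0 row0 col0[of 0] row0[of 0] by (intro eq_matI) (auto simp: B'_def)
  obtain V D where V: "unitary n V" and D: "D \<in> carrier_mat n n" "diagonal_mat D" "B' = V * D * adj V"
    using Suc.IH[OF B'] by auto
  have V': "V \<in> carrier_mat n n" "adj V \<in> carrier_mat n n" "adj V * V = 1\<^sub>m n" "V * adj V = 1\<^sub>m n"
    using V by (auto simp: unitary_def)
  define W where "W = four_block_mat (1\<^sub>m 1) (0\<^sub>m 1 n) (0\<^sub>m n 1) V"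
  define E where "E = four_block_mat (mat 1 1 (\<lambda>_. e)) (0\<^sub>m 1 n) (0\<^sub>m n 1) D"
  have Wa: "adj W = four_block_mat (1\<^sub>m 1) (0\<^sub>m 1 n) (0\<^sub>m n 1) (adj V)"
    using V' by (intro eq_matI) (auto simp: W_def)
  have Wd [simp]: "dim_row W = Suc n" "dim_col W = Suc n" and Ed [simp]: "dim_row E = Suc n" "dim_col E = Suc n"
    using V' D by (auto simp: W_def E_def)
  have one: "four_block_mat (1\<^sub>m 1) (0\<^sub>m 1 n) (0\<^sub>m n 1) (1\<^sub>m n) = 1\<^sub>m (Suc n)"
    by (intro eq_matI) auto
  have WW: "adj W * W = 1\<^sub>m (Suc n)" "W * adj W = 1\<^sub>m (Suc n)"
    unfolding Wa unfolding W_def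
    by (subst mult_four_block_mat[of _ 1 1 _ n _ n _ _ 1 _ n]; use V' in \<open>simp add: one_mult_dim zero_mult_dim one\<close>)+
  have B_eq: "B = W * E * adj W"
    unfolding Wa unfolding W_def E_def Bblock
    using V' D(1) by (simp add: diag_block_mult[of _ 1 1 _ 1 _ n n _ n] D(3) one_mult_dim del: One_nat_def)
  have "A = U * B * adj U"
  proof -
    have "U * B * adj U = (U * adj U) * A * (U * adj U)" by (simp add: B_def mat_alg)
    then show ?thesis by (simp add: UU one_mult_dim)
  qed
  also have "\<dots> = (U * W) * E * adj (U * W)" by (simp add: B_eq mat_alg)
  finally have "A = (U * W) * E * adj (U * W)" .
  moreover have "unitary (Suc n) (U * W)"
  proof -
    have 1: "adj U * (U * X) = X" "W * (adj W * X) = X" if "dim_row X = Suc n" for X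
      using that by (simp_all add: mult_assoc_dim[symmetric] UU WW one_mult_dim)
    show ?thesis using U by (auto simp: unitary_def mat_alg 1 UU WW intro: carrier_matI)
  qed
  moreover have "diagonal_mat E"
    using D by (auto simp: E_def diagonal_mat_def)
  moreover have "E \<in> carrier_mat (Suc n) (Suc n)" by (auto intro: carrier_matI)
  ultimately show ?case by blast
qed

definition real_diag :: "nat \<Rightarrow> (nat \<Rightarrow> real) \<Rightarrow> complex mat" where
  "real_diag n d = mat n n (\<lambda>(i,j). if i = j then of_real (d i) else 0)"

lemma real_diag_simps [simp]: "dim_row (real_diag n d) = n" "dim_col (real_diag n d) = n" "adj (real_diag n d) = real_diag n d"
  by (auto simp: real_diag_def intro!: eq_matI)

lemma real_diag_mult: "real_diag n d * real_diag n e = real_diag n (\<lambda>i. d i * e i)"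
proof (rule eq_matI)
  fix i j assume "i < dim_row (real_diag n (\<lambda>i. d i * e i))" "j < dim_col (real_diag n (\<lambda>i. d i * e i))"
  then have ij: "i < n" "j < n" by auto
  have "(real_diag n d * real_diag n e) $$ (i,j) = (\<Sum>k<n. real_diag n d $$ (i,k) * real_diag n e $$ (k,j))"
    using ij by (simp add: mult_index_sum del: index_mult_mat(1))
  also have "\<dots> = (\<Sum>k<n. if k = i then real_diag n d $$ (i,i) * real_diag n e $$ (i,j) else 0)"
    using ij by (intro sum.cong) (auto simp: real_diag_def)
  also have "\<dots> = real_diag n (\<lambda>i. d i * e i) $$ (i,j)" using ij by (simp add: real_diag_def)
  finally show "(real_diag n d * real_diag n e) $$ (i,j) = real_diag n (\<lambda>i. d i * e i) $$ (i,j)" .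
qed auto

text \<open>The diagonal matrix is unitarily similar to A, hence itself Hermitian, hence real. The
  eigenvector equations are recorded because signs of eigenvalues and uniqueness of square roots are
  tested on the columns of U.\<close>

lemma hermitian_spectral_real:
  assumes A: "A \<in> carrier_mat n n" "adj A = A"
  obtains U d where "unitary n U" "A = U * (real_diag n d * adj U)"
    "\<And>i. i < n \<Longrightarrow> A *\<^sub>v col U i = complex_of_real (d i) \<cdot>\<^sub>v col U i"
proof -
  obtain U D where U: "unitary n U" and D: "D \<in> carrier_mat n n" "diagonal_mat D" and AU: "A = U * D * adj U"
    using hermitian_spectral[OF A] by blast
  have dims [simp]: "dim_row U = n" "dim_col U = n" "dim_row D = n" "dim_col D = n" "dim_row A = n" "dim_col A = n"
    and UU: "adj U * U = 1\<^sub>m n"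
    using U D A by (auto simp: unitary_def)
  have UUX: "adj U * (U * X) = X" if "dim_row X = n" for X
    using that by (simp add: mult_assoc_dim[symmetric] UU one_mult_dim)
  have DA: "D = adj U * (A * U)" by (simp add: AU mat_alg UUX UU)
  have "adj D = D" by (simp add: DA mat_alg A(2))
  then have "cnj (D $$ (i,i)) = D $$ (i,i)" if "i < n" for i
    using adj_index[of i D i] that by simp
  then have "D = real_diag n (\<lambda>i. Re (D $$ (i,i)))"
    using D by (intro eq_matI) (auto simp: real_diag_def diagonal_mat_def complex_eq_iff)
  then obtain d where d: "D = real_diag n d" by metis
  have "A *\<^sub>v col U i = complex_of_real (d i) \<cdot>\<^sub>v col U i" if i: "i < n" for i
  proof -
    have "A *\<^sub>v col U i = col (A * U) i"
      using i by (subst col_mult2[of _ n n _ n]) (auto intro: carrier_matI)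
    also have "A * U = U * D" by (simp add: AU mat_alg UU)
    also have "col (U * D) i = complex_of_real (d i) \<cdot>\<^sub>v col U i"
      using i by (intro eq_vecI)
        (auto simp: mult_index_sum d real_diag_def if_distrib if_distribR sum.delta mult.commute cong: if_cong simp del: index_mult_mat(1))
    finally show ?thesis .
  qed
  moreover have "A = U * (real_diag n d * adj U)" by (simp add: AU d mat_alg)
  ultimately show thesis using U that by blast
qed

lemma eigenvalue_psd_nonneg:
  assumes "psd A" "dim_row A = n" "u \<in> carrier_vec n" "u \<noteq> 0\<^sub>v n" "A *\<^sub>v u = complex_of_real c \<cdot>\<^sub>v u"
  shows "0 \<le> c"
proof -
  have "ip u (A *\<^sub>v u) = of_real c * ip u u"
    using assms by (simp add: ip_def sum_distrib_left mult_ac)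
  then have "0 \<le> c * vnorm2 u" using psdD(3)[OF assms(1), of u] assms by (simp add: ip_self)
  moreover have "vnorm2 u > 0" using assms vnorm2_nonneg[of u] by (auto simp: less_le vnorm2_eq_0)
  ultimately show ?thesis by (simp add: zero_le_mult_iff)
qed

lemma unitary_col_nonzero: "unitary n U \<Longrightarrow> i < n \<Longrightarrow> col U i \<noteq> 0\<^sub>v n"
proof
  assume U: "unitary n U" and i: "i < n" and 0: "col U i = 0\<^sub>v n"
  have "col (adj U * U) i = adj U *\<^sub>v col U i"
    using U i by (intro col_mult2[of _ n n _ n]) (auto simp: unitary_def)
  also have "\<dots> = 0\<^sub>v n" using U by (auto simp: 0 unitary_def)
  finally have "col (1\<^sub>m n) i $ i = (0 :: complex)" using U i by (simp add: unitary_def)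
  then show False using i by simp
qed

text \<open>An eigenvector \<open>u\<close> of \<open>B\<close> for \<open>b\<close> gives \<open>C y = - b y\<close> with \<open>y = C u - b u\<close>, which
  forces \<open>y = 0\<close>; so \<open>C\<close> agrees with \<open>B\<close> on an eigenbasis of \<open>B\<close>.\<close>

lemma psd_sqrt_unique:
  assumes B: "psd B" and C: "psd C" and d: "dim_row B = n" "dim_row C = n" and eq: "B * B = C * C"
  shows "B = C"
proof -
  have d' [simp]: "dim_row B = n" "dim_col B = n" "dim_row C = n" "dim_col C = n"
    using d psdD(1)[OF B] psdD(1)[OF C] by auto
  obtain U b where U: "unitary n U" and BU: "B = U * (real_diag n b * adj U)"
    and ev: "\<And>i. i < n \<Longrightarrow> B *\<^sub>v col U i = complex_of_real (b i) \<cdot>\<^sub>v col U i"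
    using hermitian_spectral_real[OF carrier_matI[OF d'(1,2)] psdD(2)[OF B]] by metis
  have Ud [simp]: "dim_row U = n" "dim_col U = n" and UU: "U * adj U = 1\<^sub>m n"
    using U by (auto simp: unitary_def)
  have "B *\<^sub>v col U i = C *\<^sub>v col U i" if i: "i < n" for i
  proof -
    define u where "u = col U i"
    have u: "u \<in> carrier_vec n" "dim_vec u = n" by (auto simp: u_def carrier_vecI)
    have b0: "0 \<le> b i"
      using eigenvalue_psd_nonneg[OF B d(1) u(1) _ ev[OF i, folded u_def]] unitary_col_nonzero[OF U i]
      by (simp add: u_def)
    define y where "y = C *\<^sub>v u - complex_of_real (b i) \<cdot>\<^sub>v u"
    have y: "dim_vec y = n" by (simp add: y_def u)
    have CC: "C *\<^sub>v (C *\<^sub>v u) = (complex_of_real (b i) * complex_of_real (b i)) \<cdot>\<^sub>v u"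
    proof -
      have "C *\<^sub>v (C *\<^sub>v u) = B *\<^sub>v (B *\<^sub>v u)"
        using u eq by (simp add: mult_vec_dim(1)[symmetric])
      also have "\<dots> = (complex_of_real (b i) * complex_of_real (b i)) \<cdot>\<^sub>v u"
        using ev[OF i, folded u_def] u
        by (simp add: mult_mat_vec[of _ n n] carrier_matI smult_smult_assoc)
      finally show ?thesis .
    qed
    have Cy: "C *\<^sub>v y = (- complex_of_real (b i)) \<cdot>\<^sub>v y"
    proof -
      have "C *\<^sub>v y = C *\<^sub>v (C *\<^sub>v u) - complex_of_real (b i) \<cdot>\<^sub>v (C *\<^sub>v u)"
      proof -
        have c: "C \<in> carrier_mat n n" "C *\<^sub>v u \<in> carrier_vec n"
          by (auto intro: carrier_matI carrier_vecI)
        have "C *\<^sub>v y = C *\<^sub>v (C *\<^sub>v u) - C *\<^sub>v (complex_of_real (b i) \<cdot>\<^sub>v u)"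
          unfolding y_def using c u(1) by (intro mult_minus_distrib_mat_vec) auto
        then show ?thesis by (simp only: mult_mat_vec[OF c(1) u(1)])
      qed
      also have "\<dots> = (- complex_of_real (b i)) \<cdot>\<^sub>v y"
        unfolding CC using u by (intro eq_vecI) (auto simp: y_def power2_eq_square algebra_simps)
      finally show ?thesis .
    qed
    have yCy: "ip y (C *\<^sub>v y) = - of_real (b i * vnorm2 y)"
      unfolding Cy of_real_mult ip_self[symmetric] using y by (simp add: ip_def sum_distrib_left mult_ac sum_negf)
    have "b i * vnorm2 y = 0"
      using psdD(3)[OF C, of y] y mult_nonneg_nonneg[OF b0, of "vnorm2 y"]
      by (intro antisym) (simp_all add: yCy)
    then have "vnorm2 y = 0"
    \<comment> \<open>For \<open>b i = 0\<close> the product equation says nothing. Then y = C u,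
      and moving C across gives that the inner product of y with itself equals that of u with C y,
      which is 0.\<close>
    proof (cases "b i = 0")
      case True
      then have yu: "y = C *\<^sub>v u" using u by (intro eq_vecI) (auto simp: y_def)
      have "ip y y = ip u (C *\<^sub>v y)"
        using u y ip_adj[of C u y] psdD(2)[OF C] by (simp add: yu)
      also have "\<dots> = 0" unfolding Cy using True u y by (simp add: ip_def)
      finally show ?thesis by (simp add: ip_self)
    qed auto
    then have y0: "y = 0\<^sub>v n" using y by (simp add: vnorm2_eq_0)
    have "C *\<^sub>v u = complex_of_real (b i) \<cdot>\<^sub>v u"
    proof (rule eq_vecI)
      fix k assume k: "k < dim_vec (complex_of_real (b i) \<cdot>\<^sub>v u)"
      then have "y $ k = 0" using y0 u by simp
      then show "(C *\<^sub>v u) $ k = (complex_of_real (b i) \<cdot>\<^sub>v u) $ k"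
        using k u by (simp add: y_def)
    qed (use u in simp)
    then show ?thesis using ev[OF i] by (simp add: u_def)
  qed
  then have "col (B * U) i = col (C * U) i" if "i < n" for i
    using that by (simp add: col_mult2[of _ n n _ n] carrier_matI)
  then have "B * U = C * U" by (intro mat_col_eqI) auto
  then have "(B * U) * adj U = (C * U) * adj U" by simp
  then show ?thesis by (simp add: mat_alg UU)
qed

lemma msqrt_psd:
  assumes X: "psd X" and d: "dim_row X = n"
  shows "psd (msqrt X)" "msqrt X * msqrt X = X" "msqrt X \<in> carrier_mat n n"
proof -
  have d' [simp]: "dim_row X = n" "dim_col X = n" using d psdD(1)[OF X] by auto
  obtain U b where U: "unitary n U" and XU: "X = U * (real_diag n b * adj U)"
    and ev: "\<And>i. i < n \<Longrightarrow> X *\<^sub>v col U i = complex_of_real (b i) \<cdot>\<^sub>v col U i"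
    using hermitian_spectral_real[OF carrier_matI[OF d'] psdD(2)[OF X]] by metis
  have Ud [simp]: "dim_row U = n" "dim_col U = n" and UU: "adj U * U = 1\<^sub>m n"
    using U by (auto simp: unitary_def)
  have b0: "0 \<le> b i" if i: "i < n" for i
    using eigenvalue_psd_nonneg[OF X d _ _ ev[OF i]] unitary_col_nonzero[OF U i]
    by (simp add: carrier_vecI)
  \<comment> \<open>Fourth roots of the eigenvalues: the square root is then obtained as the Gram
    matrix of \<open>G\<close>, so that it is visibly nonnegative.\<close>
  define G where "G = real_diag n (\<lambda>i. sqrt (sqrt (b i))) * adj U"
  define B where "B = adj G * G"
  \<comment> \<open>The functions of i agree only for i < n, where \<open>b i\<close> is
    nonnegative, so the equations are between diagonal matrices. The absolute values are the normal
    form of a product of two equal square roots.\<close>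
  have sq: "real_diag n (\<lambda>i. sqrt (b i) * sqrt (b i)) = real_diag n b"
    "real_diag n (\<lambda>i. sqrt (sqrt (b i)) * sqrt (sqrt (b i))) = real_diag n (\<lambda>i. sqrt (b i))"
    "real_diag n (\<lambda>i. \<bar>b i\<bar>) = real_diag n b" "real_diag n (\<lambda>i. sqrt \<bar>b i\<bar>) = real_diag n (\<lambda>i. sqrt (b i))"
    "real_diag n (\<lambda>i. \<bar>sqrt (b i)\<bar>) = real_diag n (\<lambda>i. sqrt (b i))"
    using b0 by (auto simp: real_diag_def intro!: eq_matI)
  have UUX: "adj U * (U * X) = X" if "dim_row X = n" for X
    using that by (simp add: mult_assoc_dim[symmetric] UU one_mult_dim)
  have dgX: "real_diag n d * (real_diag n e * X) = real_diag n (\<lambda>i. d i * e i) * X" if "dim_row X = n" for X d e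
    using that by (simp add: mult_assoc_dim[symmetric] real_diag_mult)
  have "B * B = X"
    by (simp add: B_def G_def XU mat_alg UUX dgX sq)
  then have B: "psd B \<and> B * B = X" by (simp add: B_def psd_gram)
  have "msqrt X = B"
    unfolding msqrt_def
  proof (rule the_equality)
    fix C assume C: "psd C \<and> C * C = X"
    then have "dim_row C = n" by (metis d index_mult_mat(2))
    then show "C = B" using C B by (intro psd_sqrt_unique[of C B n]) (auto simp: B_def G_def)
  qed (fact B)
  then show "psd (msqrt X)" "msqrt X * msqrt X = X" "msqrt X \<in> carrier_mat n n"
    using B by (auto simp: B_def G_def intro!: carrier_matI)
qed

text \<open>X Y and X Z are both orthogonal projections onto the range of X and therefore coincide;
  likewise Y X and Z X. Then Y = Y X Y = Z X Z = Z.\<close>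

lemma pinv_unique:
  assumes d: "dim_row X = n" "dim_col X = k"
    and Y: "Y \<in> carrier_mat k n" "X * Y * X = X" "Y * X * Y = Y" "adj (X * Y) = X * Y" "adj (Y * X) = Y * X"
    and Z: "Z \<in> carrier_mat k n" "X * Z * X = X" "Z * X * Z = Z" "adj (X * Z) = X * Z" "adj (Z * X) = Z * X"
  shows "Y = Z"
proof -
  have dims [simp]: "dim_row X = n" "dim_col X = k" "dim_row Y = k" "dim_col Y = n" "dim_row Z = k" "dim_col Z = n"
    using d Y Z by auto
  have 1: "X * Y = X * Z"
  proof -
    have "X * Y = (X * Z * X) * Y" by (simp add: Z)
    also have "\<dots> = (X * Z) * (X * Y)" by (simp add: mult_assoc_dim)
    finally have "adj (X * Y) = adj ((X * Z) * (X * Y))" by simp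
    also have "\<dots> = adj (X * Y) * adj (X * Z)" by (rule adj_mult) simp
    also have "\<dots> = (X * Y) * (X * Z)" by (simp only: Y Z)
    also have "\<dots> = (X * Y * X) * Z" by (simp add: mult_assoc_dim)
    finally show ?thesis by (simp only: Y)
  qed
  have 2: "Y * X = Z * X"
  proof -
    have "Y * X = Y * (X * Z * X)" by (simp add: Z)
    also have "\<dots> = (Y * X) * (Z * X)" by (simp add: mult_assoc_dim)
    finally have "adj (Y * X) = adj ((Y * X) * (Z * X))" by simp
    also have "\<dots> = adj (Z * X) * adj (Y * X)" by (rule adj_mult) simp
    also have "\<dots> = (Z * X) * (Y * X)" by (simp only: Y Z)
    also have "\<dots> = Z * (X * Y * X)" by (simp add: mult_assoc_dim)
    finally show ?thesis by (simp only: Y)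
  qed
  have "Y = Y * (X * Y)" using Y(3) by (simp add: mult_assoc_dim)
  also have "\<dots> = (Y * X) * Z" unfolding 1 by (simp add: mult_assoc_dim)
  also have "\<dots> = Z" unfolding 2 by (rule Z)
  finally show ?thesis .
qed

lemma pinv_hermitian:
  assumes X: "X \<in> carrier_mat n n" "adj X = X"
  shows "pinv X \<in> carrier_mat n n" "X * pinv X * X = X" "pinv X * X * pinv X = pinv X"
    "adj (X * pinv X) = X * pinv X" "adj (pinv X * X) = pinv X * X"
proof -
  let ?P = "\<lambda>Y. Y \<in> carrier_mat (dim_col X) (dim_row X) \<and> X * Y * X = X \<and> Y * X * Y = Y
              \<and> adj (X * Y) = X * Y \<and> adj (Y * X) = Y * X"
  obtain U b where U: "unitary n U" and XU: "X = U * (real_diag n b * adj U)"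
    using hermitian_spectral_real[OF X] by blast
  have Ud [simp]: "dim_row U = n" "dim_col U = n" and UU: "adj U * U = 1\<^sub>m n"
    using U by (auto simp: unitary_def)
  have UUX: "adj U * (U * X) = X" if "dim_row X = n" for X
    using that by (simp add: mult_assoc_dim[symmetric] UU one_mult_dim)
  have dgX: "real_diag n d * (real_diag n e * X) = real_diag n (\<lambda>i. d i * e i) * X" if "dim_row X = n" for X d e
    using that by (simp add: mult_assoc_dim[symmetric] real_diag_mult)
  have inv: "real_diag n (\<lambda>i. b i * (inverse (b i) * b i)) = real_diag n b" "real_diag n (\<lambda>i. b i * inverse (b i) * b i) = real_diag n b"
    "real_diag n (\<lambda>i. inverse (b i) * b i * inverse (b i)) = real_diag n (\<lambda>i. inverse (b i))"
    "real_diag n (\<lambda>i. inverse (b i) * (b i * inverse (b i))) = real_diag n (\<lambda>i. inverse (b i))"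
    by (rule arg_cong[of _ _ "real_diag n"], rule ext, case_tac "b i = 0"; simp)+
  \<comment> \<open>As \<open>inverse 0 = 0\<close>, inverting the eigenvalues entrywise leaves the
    kernel alone, which is exactly what the Penrose equations ask for.\<close>
  have ex: "?P (U * (real_diag n (\<lambda>i. inverse (b i)) * adj U))"
    by (intro conjI; (rule carrier_matI)?; simp add: XU mat_alg UUX dgX inv)
  have uniq: "Y = Z" if "?P Y" "?P Z" for Y Z
    using that unfolding carrier_matD[OF X(1)]
    by (elim conjE) (rule pinv_unique[OF carrier_matD[OF X(1)]])
  have "\<exists>!Y. ?P Y" by (rule ex1I[of ?P, OF ex]) (rule uniq[OF _ ex])
  from theI'[OF this] have "?P (pinv X)" unfolding pinv_def .
  then show "pinv X \<in> carrier_mat n n" "X * pinv X * X = X" "pinv X * X * pinv X = pinv X"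
    "adj (X * pinv X) = X * pinv X" "adj (pinv X * X) = pinv X * X"
    unfolding carrier_matD[OF X(1)] by blast+
qed

text \<open>For an orthogonal projection, |v|^2 - |A v|^2 = |v - A v|^2.\<close>

lemma projection_contraction:
  assumes A: "A \<in> carrier_mat n n" "adj A = A" "A * A = A"
  shows "contraction n A"
  unfolding contraction_def
proof (intro conjI ballI)
  fix v :: "complex vec" assume v: "v \<in> carrier_vec n"
  define t where "t = A *\<^sub>v v"
  have d: "dim_vec v = n" "dim_vec t = n" using v A by (auto simp: t_def)
  have "ip t v = ip v t"
    using A v unfolding t_def by (subst ip_adj) auto
  moreover have "ip t t = ip v t"
  proof -
    have "ip t t = ip v (A *\<^sub>v (A *\<^sub>v v))" unfolding t_def using A v by (subst ip_adj) auto
    also have "A *\<^sub>v (A *\<^sub>v v) = t" using A v by (simp add: t_def mult_vec_dim(1)[symmetric])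
    finally show ?thesis .
  qed
  moreover have "0 \<le> Re (ip (v - t) (v - t))" by (simp add: ip_self)
  moreover have "ip (v - t) (v - t) = ip v v - ip v t - (ip t v - ip t t)"
    using d by (simp add: ip_add)
  ultimately have "0 \<le> Re (ip v v - ip t t)" by simp
  then show "vnorm2 (A *\<^sub>v v) \<le> vnorm2 v" by (simp add: ip_self t_def)
qed (rule A)

text \<open>Write L = l l and R = r r. Then l y = w E S r, where E = l l^+ is an orthogonal
  projection, and the claim becomes |w E S r v| \<le> |r v|: the factors w, E and S are all
  contractive. Invertibility of L plays no part because only l l^+ occurs.\<close>

lemma schur_complement_bound:
  assumes L: "psd L" "dim_row L = n" and R: "psd R" "dim_row R = n" and S: "contraction n S" and w: "cmod w \<le> 1"
  defines "y \<equiv> w \<cdot>\<^sub>m (pinv (msqrt L) * S * msqrt R)"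
  shows "psd (R - adj y * (L * y))"
proof -
  note sL = msqrt_psd[OF L] and sR = msqrt_psd[OF R]
  note pL = pinv_hermitian[OF sL(3) psdD(2)[OF sL(1)]]
  define l where "l = msqrt L"
  define r where "r = msqrt R"
  have dims [simp]: "dim_row l = n" "dim_col l = n" "dim_row r = n" "dim_col r = n"
     "dim_row (pinv l) = n" "dim_col (pinv l) = n" "dim_row S = n" "dim_col S = n"
     "dim_row L = n" "dim_row R = n" "dim_col L = n" "dim_col R = n"
    using sL sR pL S L R psdD(1)[OF L(1)] psdD(1)[OF R(1)] unfolding l_def r_def by (auto simp: contraction_def)
  have la [simp]: "adj l = l" "adj r = r" "adj R = R" "adj L = L"
    using psdD(2)[OF sL(1)] psdD(2)[OF sR(1)] psdD(2)[OF L(1)] psdD(2)[OF R(1)] by (auto simp: l_def r_def)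
  define E where "E = l * pinv l"
  have Ed [simp]: "dim_row E = n" "dim_col E = n" by (auto simp: E_def)
  have "contraction n E"
    using pL by (intro projection_contraction) (auto simp: E_def l_def[symmetric] mult_assoc_dim intro!: carrier_matI)
  define K where "K = w \<cdot>\<^sub>m (E * (S * r))"
  have Kd [simp]: "dim_row K = n" "dim_col K = n" by (auto simp: K_def)
  have LE: "L * X = l * (l * X)" if "dim_row X = n" for X
    using that sL(2) by (simp add: mult_assoc_dim[symmetric] l_def[symmetric])
  have ly: "l * y = K" by (simp add: y_def K_def E_def mat_alg l_def[symmetric] r_def[symmetric])
  have yd [simp]: "dim_row y = n" "dim_col y = n" by (auto simp: y_def l_def[symmetric] r_def[symmetric])
  have "adj y * (L * y) = adj (l * y) * (l * y)" by (simp add: LE mat_alg)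
  also have "\<dots> = adj K * K" by (simp add: ly)
  finally have yLy: "adj y * (L * y) = adj K * K" .
  show ?thesis unfolding yLy
  proof (rule psdI[of _ n])
    show "adj (R - adj K * K) = R - adj K * K" by (simp add: mat_alg)
    fix v :: "complex vec" assume v: "v \<in> carrier_vec n"
    define u where "u = r *\<^sub>v v"
    have u: "u \<in> carrier_vec n" "dim_vec v = n" using v by (auto simp: u_def intro: carrier_vecI)
    have "R = adj r * r" using sR by (simp add: r_def[symmetric])
    then have "ip v ((R - adj K * K) *\<^sub>v v) = vnorm2 u - vnorm2 (K *\<^sub>v v)"
    proof -
      have "(R - adj K * K) *\<^sub>v v = adj r *\<^sub>v u - adj K *\<^sub>v (K *\<^sub>v v)"
        using u \<open>R = adj r * r\<close> by (metis (no_types, lifting) Kd adj_dim dims(3,4) index_mult_mat(2,3) mult_vec_dim(1,3) u_def)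
      moreover have "ip v (adj r *\<^sub>v u) = ip u u" using u ip_adj[of r v u] by (simp add: u_def)
      moreover have "ip v (adj K *\<^sub>v (K *\<^sub>v v)) = ip (K *\<^sub>v v) (K *\<^sub>v v)"
        using u ip_adj[of K v "K *\<^sub>v v"] by simp
      ultimately show ?thesis using u by (simp add: ip_add ip_self)
    qed
    moreover have "vnorm2 (K *\<^sub>v v) \<le> vnorm2 u"
    proof -
      have "vnorm2 (K *\<^sub>v v) = (cmod w)\<^sup>2 * vnorm2 (E *\<^sub>v (S *\<^sub>v u))"
        using u by (simp add: K_def mult_vec_dim u_def vnorm2_def norm_mult power_mult_distrib sum_distrib_left)
      also have "\<dots> \<le> 1 * vnorm2 (E *\<^sub>v (S *\<^sub>v u))"
        using w by (intro mult_right_mono) (auto simp: power_le_one)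
      also have "\<dots> \<le> vnorm2 (S *\<^sub>v u)"
      proof -
        have "S *\<^sub>v u \<in> carrier_vec n" by (rule carrier_vecI) simp
        then show ?thesis using \<open>contraction n E\<close> unfolding contraction_def by simp
      qed
      also have "\<dots> \<le> vnorm2 u" using S u by (simp add: contraction_def)
      finally show ?thesis .
    qed
    ultimately show "0 \<le> Re (ip v ((R - adj K * K) *\<^sub>v v))" by simp
  qed (rule carrier_matI; simp)
qed

subsection \<open>Duality for contractive matrices\<close>

lemma smult_smult_dim: "k \<cdot>\<^sub>m (l \<cdot>\<^sub>m A) = (k * l) \<cdot>\<^sub>m A" for A :: "complex mat"
  by (rule eq_matI) auto

lemma one_smult_mat [simp]: "1 \<cdot>\<^sub>m A = A" for A :: "complex mat"
  by (rule eq_matI) auto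

lemma mat_eq_diffI: "X + Y = Z \<Longrightarrow> dim_row X = dim_row Y \<Longrightarrow> dim_col X = dim_col Y \<Longrightarrow> X = Z - Y" for X Y Z :: "complex mat"
  by (rule eq_matI) auto

lemma mat_eq_addI:
  fixes X Y Z :: "complex mat"
  assumes "X - Y = Z" "dim_row X = dim_row Y" "dim_col X = dim_col Y" shows "X = Z + Y"
  using assms by (intro eq_matI) auto

lemma mat_diff_swap:
  fixes X Y Z :: "complex mat"
  assumes "X - Y = - Z" "dim_row X = dim_row Z" "dim_col X = dim_col Z" "dim_row Y = dim_row Z" "dim_col Y = dim_col Z"
  shows "Y - X = Z"
proof (rule eq_matI)
  fix i j assume "i < dim_row Z" "j < dim_col Z"
  moreover have "(X - Y) $$ (i,j) = (- Z) $$ (i,j)" by (simp only: assms)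
  ultimately show "(Y - X) $$ (i,j) = Z $$ (i,j)" using assms(2-) by (simp add: algebra_simps)
qed (use assms in auto)

lemma mat_diff_zero:
  fixes X Y :: "complex mat"
  assumes "X - Y = 0\<^sub>m n k" "X \<in> carrier_mat n k" "Y \<in> carrier_mat n k"
  shows "X = Y"
  using mat_eq_addI[OF assms(1)] assms(2,3) by (simp add: left_add_zero_mat)

text \<open>\<open>adj_mat\<close> is the adjugate, not the adjoint \<open>adj\<close>. The last
  equation is what carries holomorphy over to inverses: apart from the factor 1 / det, the entries
  are polynomials in the entries of A.\<close>

lemma minv:
  assumes A: "A \<in> carrier_mat n n" and d: "det A \<noteq> 0"
  shows "minv A \<in> carrier_mat n n" "A * minv A = 1\<^sub>m n" "minv A * A = 1\<^sub>m n"
    "minv A = inverse (det A) \<cdot>\<^sub>m adj_mat A"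
proof -
  note am = adj_mat[OF A]
  let ?B = "inverse (det A) \<cdot>\<^sub>m adj_mat A"
  have B: "?B \<in> carrier_mat n n" using am(1) by simp
  have AB: "A * ?B = 1\<^sub>m n"
    using am A d by (simp add: mult_smult_dim smult_smult_dim)
  have BA: "?B * A = 1\<^sub>m n"
    using am A d by (simp add: smult_mult_dim smult_smult_dim)
  have "\<exists>B. B \<in> carrier_mat (dim_row A) (dim_row A) \<and>
                 A * B = 1\<^sub>m (dim_row A) \<and> B * A = 1\<^sub>m (dim_row A)"
    using A B AB BA by auto
  from someI_ex[OF this]
  show 1: "minv A \<in> carrier_mat n n" "A * minv A = 1\<^sub>m n" "minv A * A = 1\<^sub>m n"
    using A by (auto simp: minv_def)
  have "minv A * (A * ?B) = (minv A * A) * ?B"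
    using A B 1(1) by (subst mult_assoc_dim) auto
  then show "minv A = ?B" using 1 AB A B by (metis left_mult_one_mat right_mult_one_mat)
qed

lemma injective_mat_det:
  fixes A :: "complex mat"
  assumes A: "A \<in> carrier_mat n n" and inj: "\<And>v. v \<in> carrier_vec n \<Longrightarrow> A *\<^sub>v v = 0\<^sub>v n \<Longrightarrow> v = 0\<^sub>v n"
  shows "det A \<noteq> 0"
  using det_0_iff_vec_prod_zero[OF A] inj by auto

text \<open>Potapov--Ginzburg transform: with \<open>p = (1 + J) / 2\<close> and \<open>q = (1 - J) / 2\<close> the matrix
  \<open>K = (p A + q) (q A + p)\<^sup>-\<^sup>1\<close> is a contraction, and
  \<open>J - A J A\<^sup>* = C (1 - K K\<^sup>*) C\<^sup>*\<close> for \<open>C = p - A q\<close>.\<close>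

lemma J_contractive_adj:
  assumes J: "signature d J" and A: "A \<in> carrier_mat d d"
    and psd: "psd (J - adj A * J * A)"
  shows "psd (J - A * J * adj A)"
proof -
  have Jd [simp]: "dim_row J = d" "dim_col J = d" and Ja [simp]: "adj J = J" and JJ: "J * J = 1\<^sub>m d"
    and Ad [simp]: "dim_row A = d" "dim_col A = d"
    using J A by (auto simp: signature_def)
  define p where "p = (1/2) \<cdot>\<^sub>m (1\<^sub>m d + J)"
  define q where "q = (1/2) \<cdot>\<^sub>m (1\<^sub>m d - J)"
  have dims [simp]: "dim_row p = d" "dim_col p = d" "dim_row q = d" "dim_col q = d"
    by (auto simp: p_def q_def)
  have pa [simp]: "adj p = p" "adj q = q"
    by (simp_all add: p_def q_def mat_alg)
  have pp: "p * p = p" and qq: "q * q = q" and pq: "p * q = 0\<^sub>m d d" and qp: "q * p = 0\<^sub>m d d"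
    by (rule eq_matI; simp add: p_def q_def mat_alg JJ del: index_mult_mat(1) index_one_mat(1); simp add: field_simps)+
  have Jpq: "J = p - q" and one: "p + q = 1\<^sub>m d"
    by (rule eq_matI; simp add: p_def q_def field_simps)+
  have 2: "p * (p * X) = p * X" "q * (q * X) = q * X" "p * (q * X) = 0\<^sub>m d (dim_col X)" "q * (p * X) = 0\<^sub>m d (dim_col X)"
    if "dim_row X = d" for X
    using that by (simp_all add: mult_assoc_dim[symmetric] pp qq pq qp zero_mult_dim)
  note rules = mat_alg pp qq pq qp 2
  define B where "B = q * A + p"
  define Z where "Z = p * A + q"
  define C where "C = p - A * q"
  define D where "D = A * p - q"
  have dims2 [simp]: "dim_row B = d" "dim_col B = d" "dim_row Z = d" "dim_col Z = d"
    "dim_row C = d" "dim_col C = d" "dim_row D = d" "dim_col D = d"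
    by (auto simp: B_def Z_def C_def D_def)
  have BZ: "adj B * B = (J - adj A * J * A) + adj Z * Z"
    by (rule eq_matI; simp add: B_def Z_def Jpq rules del: index_mult_mat(1))
  \<comment> \<open>\<open>BZ\<close> makes Z v no longer than B v. Together with this identity, B v
    = 0 forces Z v = 0 and then v = 0, so \<open>B\<close> is invertible.\<close>
  have pBqZ: "p * B + q * Z = 1\<^sub>m d"
    unfolding one[symmetric] by (rule eq_matI; simp add: B_def Z_def rules del: index_mult_mat(1))
  \<comment> \<open>This turns K = Z B^-1 into a factor on the other side: D = C K, through which
    the defect of the adjoint is expressed by K.\<close>
  have CZ: "C * Z = D * B"
  proof -
    have e: "A * p = A - A * q" "p * A = A - q * A"
    proof -
      have "A * p + A * q = A * (p + q)" "p * A + q * A = (p + q) * A" by (simp_all add: mat_alg)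
      then show "A * p = A - A * q" "p * A = A - q * A"
        by (intro mat_eq_diffI; simp add: one one_mult_dim)+
    qed
    show ?thesis
      by (rule eq_matI; simp add: C_def D_def Z_def B_def rules e del: index_mult_mat(1))
  qed
  have JA: "J - A * J * adj A = C * adj C - D * adj D"
    by (rule eq_matI; simp add: C_def D_def Jpq rules del: index_mult_mat(1))
  have le: "vnorm2 (Z *\<^sub>v v) \<le> vnorm2 (B *\<^sub>v v)" if v: "v \<in> carrier_vec d" for v
  proof -
    have "0 \<le> Re (ip v ((J - adj A * J * A) *\<^sub>v v))" using psdD(3)[OF psd] v by simp
    moreover have "ip v ((adj B * B) *\<^sub>v v) = ip v ((J - adj A * J * A) *\<^sub>v v) + ip v ((adj Z * Z) *\<^sub>v v)"
      unfolding BZ using v by (subst mult_vec_dim(2)) (auto simp: ip_add)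
    moreover have "ip v ((adj B * B) *\<^sub>v v) = vnorm2 (B *\<^sub>v v)" "ip v ((adj Z * Z) *\<^sub>v v) = vnorm2 (Z *\<^sub>v v)"
      using v by (simp_all add: mult_vec_dim ip_adj[symmetric] ip_self)
    ultimately show ?thesis
      by (metis Re_complex_of_real le_add_same_cancel2 plus_complex.sel(1))
  qed
  have "det B \<noteq> 0"
  proof (rule injective_mat_det[of _ d])
    fix v :: "complex vec" assume v: "v \<in> carrier_vec d" and 0: "B *\<^sub>v v = 0\<^sub>v d"
    have "vnorm2 (Z *\<^sub>v v) = 0"
      using le[OF v] vnorm2_nonneg[of "Z *\<^sub>v v"] vnorm2_eq_0[of "0\<^sub>v d"] 0
      by (intro antisym) simp_all
    then have "Z *\<^sub>v v = 0\<^sub>v d" by (simp add: vnorm2_eq_0)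
    moreover have "v = p *\<^sub>v (B *\<^sub>v v) + q *\<^sub>v (Z *\<^sub>v v)"
      using v arg_cong[OF pBqZ, of "\<lambda>M. M *\<^sub>v v"] by (simp add: mult_vec_dim)
    ultimately show "v = 0\<^sub>v d" using 0 by (auto simp: scalar_prod_def)
  qed (rule carrier_matI; simp)
  then have Bi: "minv B \<in> carrier_mat d d" "B * minv B = 1\<^sub>m d"
    using minv(1,2)[of B d] carrier_matI[OF dims2(1,2)] by blast+
  then have Bd [simp]: "dim_row (minv B) = d" "dim_col (minv B) = d" by auto
  define K where "K = Z * minv B"
  have Kd [simp]: "dim_row K = d" "dim_col K = d" by (auto simp: K_def)
  have "contraction d K"
    unfolding contraction_def
  proof (intro conjI ballI)
    fix v :: "complex vec" assume v: "v \<in> carrier_vec d"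
    have "vnorm2 (Z *\<^sub>v (minv B *\<^sub>v v)) \<le> vnorm2 (B *\<^sub>v (minv B *\<^sub>v v))"
      by (rule le, rule carrier_vecI) simp
    also have "B *\<^sub>v (minv B *\<^sub>v v) = v"
      using v Bi by (simp add: mult_vec_dim(1)[symmetric])
    also have "Z *\<^sub>v (minv B *\<^sub>v v) = K *\<^sub>v v" using v by (simp add: K_def mult_vec_dim)
    finally show "vnorm2 (K *\<^sub>v v) \<le> vnorm2 v" .
  qed (rule carrier_matI; simp)
  from adj_contraction[OF this]
  have K: "vnorm2 (adj K *\<^sub>v v) \<le> vnorm2 v" if "v \<in> carrier_vec d" for v
    using that by (auto simp: contraction_def)
  have "C * K = (C * Z) * minv B" by (simp add: K_def mat_alg)
  also have "\<dots> = D" using Bi by (simp add: CZ mat_alg)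
  finally have CK: "D = C * K" by simp
  show ?thesis
  proof (rule psdI[of _ d])
    fix v :: "complex vec" assume v: "v \<in> carrier_vec d"
    have "ip v ((J - A * J * adj A) *\<^sub>v v) = vnorm2 (adj C *\<^sub>v v) - vnorm2 (adj D *\<^sub>v v)"
      unfolding JA using v by (simp add: mult_vec_dim ip_add ip_self[symmetric] ip_adj)
    moreover have "vnorm2 (adj D *\<^sub>v v) \<le> vnorm2 (adj C *\<^sub>v v)"
    proof -
      have "adj C *\<^sub>v v \<in> carrier_vec d" by (rule carrier_vecI) simp
      moreover have "adj D *\<^sub>v v = adj K *\<^sub>v (adj C *\<^sub>v v)"
        using v by (simp add: CK adj_mult mult_vec_dim(1))
      ultimately show ?thesis using K by simp
    qed
    ultimately show "0 \<le> Re (ip v ((J - A * J * adj A) *\<^sub>v v))" by simp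
  next
    show "adj (J - A * J * adj A) = J - A * J * adj A" by (simp add: mat_alg)
  qed (rule carrier_matI; simp)
qed

subsection \<open>Christoffel--Darboux identities\<close>

text \<open>\<open>N\<close> stands for the block shift, \<open>E0\<close> and \<open>F\<close> for the first and the last block row of the
  identity, \<open>S\<close> for the Toeplitz matrix, and \<open>M w\<close> for the inverse of \<open>1 - w N\<^sup>*\<close>.\<close>

locale toeplitz_kernel =
  fixes m d :: nat and J Jb S N E0 F :: "complex mat" and M :: "complex \<Rightarrow> complex mat"
  assumes J: "signature m J" and Jb: "signature d Jb"
    and dims [simp]: "dim_row S = d" "dim_col S = d" "dim_row N = d" "dim_col N = d"
      "dim_row E0 = m" "dim_col E0 = d" "dim_row F = m" "dim_col F = d"
      "dim_row (M w) = d" "dim_col (M w) = d"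
    and NS: "N * S = S * N"
    and JN: "Jb - N * (Jb * adj N) = adj E0 * (J * E0)"
    and E0J: "E0 * Jb = J * E0"
    and E0E0: "E0 * adj E0 = 1\<^sub>m m"
    and E0N: "E0 * N = 0\<^sub>m m d"
    and FN: "F * adj N = 0\<^sub>m m d"
    and M1: "M w = 1\<^sub>m d + w \<cdot>\<^sub>m (adj N * M w)"
    and M2: "M w = 1\<^sub>m d + w \<cdot>\<^sub>m (M w * adj N)"
    and MJ: "M w * Jb = Jb * M w"
begin

lemma Jdims [simp]: "dim_row J = m" "dim_col J = m" "dim_row Jb = d" "dim_col Jb = d"
  and Jadj [simp]: "adj J = J" "adj Jb = Jb"
  and JJ: "J * J = 1\<^sub>m m" "Jb * Jb = 1\<^sub>m d"
  using J Jb by (auto simp: signature_def)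

lemma mult_rule: "A * B = C \<Longrightarrow> dim_col A = dim_row B \<Longrightarrow> dim_col B = dim_row X \<Longrightarrow> A * (B * X) = C * X"
  for A B C X :: "complex mat"
  by (metis mult_assoc_dim)

lemma JJX: "dim_row X = m \<Longrightarrow> J * (J * X) = X" "dim_row X = d \<Longrightarrow> Jb * (Jb * X) = X"
  by (simp_all add: mult_rule[OF JJ(1)] mult_rule[OF JJ(2)] one_mult_dim)

abbreviation "P \<equiv> Jb - S * (Jb * adj S)"
text \<open>The first block column of \<open>S\<close>: the stacked coefficients of the
  sequence.\<close>

abbreviation "a \<equiv> S * adj E0"
abbreviation "E w \<equiv> E0 * M w"

lemma NSX: "dim_row X = d \<Longrightarrow> N * (S * X) = S * (N * X)"
  by (simp add: mult_assoc_dim[symmetric] NS)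

lemma NS': "adj N * adj S = adj S * adj N"
  by (simp add: adj_mult[symmetric] NS)

lemma NSX': "dim_row X = d \<Longrightarrow> adj N * (adj S * X) = adj S * (adj N * X)"
  by (simp add: mult_assoc_dim[symmetric] NS')

text \<open>\<open>M w\<close> is the two-sided inverse of 1 - w N^*. The adjoint of
  \<open>S\<close> commutes with N^*, hence with this matrix and with its inverse.\<close>

lemma MS: "M w * adj S = adj S * M w"
proof -
  define T where "T = 1\<^sub>m d - w \<cdot>\<^sub>m adj N"
  have [simp]: "dim_row T = d" "dim_col T = d" by (auto simp: T_def)
  have MT: "M w * T = 1\<^sub>m d" "T * M w = 1\<^sub>m d"
  proof -
    have "M w * T = M w - w \<cdot>\<^sub>m (M w * adj N)" "T * M w = M w - w \<cdot>\<^sub>m (adj N * M w)"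
      by (simp_all add: T_def mat_alg)
    moreover have "M w - w \<cdot>\<^sub>m (M w * adj N) = 1\<^sub>m d"
      by (subst (1) M2, rule eq_matI; simp del: index_mult_mat(1))
    moreover have "M w - w \<cdot>\<^sub>m (adj N * M w) = 1\<^sub>m d"
      by (subst (1) M1, rule eq_matI; simp del: index_mult_mat(1))
    ultimately show "M w * T = 1\<^sub>m d" "T * M w = 1\<^sub>m d" by simp_all
  qed
  have TS: "T * adj S = adj S * T"
    by (simp add: T_def mat_alg NS')
  have "M w * adj S = M w * (adj S * (T * M w))" by (simp add: MT one_mult_dim)
  also have "\<dots> = M w * ((adj S * T) * M w)" by (simp add: mult_assoc_dim)
  also have "\<dots> = (M w * T) * (adj S * M w)" unfolding TS[symmetric] by (simp add: mult_assoc_dim)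
  finally show ?thesis by (simp add: MT one_mult_dim)
qed

lemma MSX: "dim_row X = d \<Longrightarrow> M w * (adj S * X) = adj S * (M w * X)"
  by (simp add: mult_assoc_dim[symmetric] MS)

text \<open>The difference quotient of \<open>M w * G\<close>: by \<open>M_K\<close> it equals (M_w
  G - G) / w, written without the division so that w = 0 is included.\<close>

definition K :: "complex \<Rightarrow> complex mat \<Rightarrow> complex mat" where
  "K w G = adj N * (M w * G)"

lemma K_dims [simp]: "dim_row (K w G) = d" "dim_col (K w G) = dim_col G"
  by (auto simp: K_def)

lemma M_K: "dim_row G = d \<Longrightarrow> M w * G = G + w \<cdot>\<^sub>m K w G"
  by (subst M1) (simp add: K_def mat_alg)

lemma EJ: "dim_row G = d \<Longrightarrow> E0 * (M w * (Jb * G)) = J * (E0 * (M w * G))"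
  by (metis (no_types, lifting) E0J Jdims(2,3,4) MJ dims(5,6,9,10) index_mult_mat(2) mult_assoc_dim)

text \<open>\<open>JN\<close> replaces the corner term by a difference of block-diagonal ones, and
  since S^* commutes with N^* and with \<open>M\<close>, the two differences combine to P - N P N^*.
  With columns \<open>G\<close> and \<open>H\<close> attached, the subtracted part is a form in
  \<open>K\<close>.\<close>

lemma kernel_shift:
  assumes G [simp]: "dim_row G = d" and H [simp]: "dim_row H = d"
  shows "adj (E v * G) * (J * (E w * H)) - adj (E v * (adj S * G)) * (J * (E w * (adj S * H)))
    = adj (M v * G) * (P * (M w * H)) - adj (K v G) * (P * K w H)"
proof -
  define g where "g = M v * G"
  define h where "h = M w * H"
  have [simp]: "dim_row g = d" "dim_row h = d" "dim_col g = dim_col G" "dim_col h = dim_col H"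
    by (auto simp: g_def h_def)
  have E: "E v * G = E0 * g" "E w * H = E0 * h" "E v * (adj S * G) = E0 * (adj S * g)" "E w * (adj S * H) = E0 * (adj S * h)"
    by (simp_all add: g_def h_def mult_assoc_dim MSX)
  have JNX: "adj E0 * (J * (E0 * X)) = Jb * X - N * (Jb * (adj N * X))" if "dim_row X = d" for X
  proof -
    have "adj E0 * (J * (E0 * X)) = (adj E0 * (J * E0)) * X" using that by (simp add: mult_assoc_dim)
    then show ?thesis using that by (simp add: JN[symmetric] mat_alg)
  qed
  show ?thesis unfolding E K_def g_def[symmetric] h_def[symmetric]
    by (rule eq_matI; simp add: mat_alg JNX NSX' del: index_mult_mat(1); simp add: NSX[symmetric] mat_alg del: index_mult_mat(1))
qed

text \<open>After M_v G = G + v K, the mixed terms contain P G or P H next to a \<open>K\<close>.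
  The range of \<open>K\<close> is annihilated by \<open>F\<close>, so the last-block part of P G
  drops out and the mixed terms see only \<open>r\<close>; they cancel against the expansion of the
  left side. What remains are boundary terms and the multiple 1 - conj(v) w of a form in P. Both
  kinds of right-hand side, first column and last block, are kept general so that one identity
  serves the right polynomials (l = 0), the left ones (r = 0), and their combinations.\<close>

lemma christoffel_darboux:
  assumes G [simp]: "dim_row G = d" "dim_col G = p" and H [simp]: "dim_row H = d" "dim_col H = q"
    and r [simp]: "dim_row r = m" "dim_col r = p" "dim_row l = m" "dim_col l = p"
    and r' [simp]: "dim_row r' = m" "dim_col r' = q" "dim_row l' = m" "dim_col l' = q"
    and PG: "P * G = adj F * l + a * (J * r)"
    and PH: "P * H = adj F * l' + a * (J * r')"
  shows "adj (J * (r + E v * (adj S * G))) * (J * (J * (r' + E w * (adj S * H))))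
     - adj (J * (E v * G)) * (J * (J * (E w * H)))
   = adj r * (J * (r' + adj a * H)) - adj (F * G) * l' + (1 - cnj v * w) \<cdot>\<^sub>m (adj (K v G) * (P * K w H))"
proof -
  have ES: "E w * (adj S * G) = adj a * G + w \<cdot>\<^sub>m (adj a * K w G)" if [simp]: "dim_row G = d" for w G
  proof -
    have "E w * (adj S * G) = E0 * (adj S * (M w * G))" by (simp add: mult_assoc_dim MSX)
    then show ?thesis by (simp add: M_K mat_alg)
  qed
  \<comment> \<open>The last block row of N^* is zero.\<close>
  have FK: "F * K w X = 0\<^sub>m m (dim_col X)" if "dim_row X = d" for w X
    using that by (simp add: K_def mult_rule[OF FN] zero_mult_dim)
  have Padj: "adj P = P" by (simp add: mat_alg)
  have Pd [simp]: "dim_row P = d" "dim_col P = d" by auto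
  have GPK: "adj G * (P * K w H) = adj r * (J * (adj a * K w H))"
  proof -
    have "adj G * (P * K w H) = adj (P * G) * K w H" by (simp add: adj_mult Padj mult_assoc_dim)
    also have "\<dots> = adj l * (F * K w H) + adj r * (J * (adj a * K w H))"
      unfolding PG by (simp add: mat_alg)
    also have "adj l * (F * K w H) = 0\<^sub>m p q" by (simp add: FK zero_mult_dim)
    finally show ?thesis by (simp add: left_add_zero_mat[of _ p q] carrier_matI)
  qed
  have KPH: "adj (K v G) * (P * H) = adj (K v G) * (a * (J * r'))"
  proof -
    have "adj (K v G) * (P * H) = adj (F * K v G) * l' + adj (K v G) * (a * (J * r'))"
      unfolding PH by (simp add: mat_alg)
    also have "adj (F * K v G) * l' = 0\<^sub>m p q" by (simp add: FK zero_mult_dim)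
    finally show ?thesis by (simp add: left_add_zero_mat[of _ p q] carrier_matI)
  qed
  define EG where "EG = E v * G"
  define EH where "EH = E w * H"
  define FG where "FG = E v * (adj S * G)"
  define FH where "FH = E w * (adj S * H)"
  have [simp]: "dim_row EG = m" "dim_col EG = p" "dim_row EH = m" "dim_col EH = q"
    "dim_row FG = m" "dim_col FG = p" "dim_row FH = m" "dim_col FH = q"
    by (auto simp: EG_def EH_def FG_def FH_def)
  have ker: "adj EG * (J * EH) - adj FG * (J * FH) =
     adj G * (P * H) + w \<cdot>\<^sub>m (adj G * (P * K w H)) + cnj v \<cdot>\<^sub>m (adj (K v G) * (P * H))
     + (cnj v * w - 1) \<cdot>\<^sub>m (adj (K v G) * (P * K w H))"
  proof -
    define Q where "Q = P"
    have [simp]: "dim_row Q = d" "dim_col Q = d" by (auto simp: Q_def)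
    have "adj EG * (J * EH) - adj FG * (J * FH) = adj (M v * G) * (Q * (M w * H)) - adj (K v G) * (Q * K w H)"
      unfolding EG_def EH_def FG_def FH_def Q_def by (rule kernel_shift; simp)
    also have "\<dots> = adj G * (Q * H) + w \<cdot>\<^sub>m (adj G * (Q * K w H)) + cnj v \<cdot>\<^sub>m (adj (K v G) * (Q * H))
     + (cnj v * w - 1) \<cdot>\<^sub>m (adj (K v G) * (Q * K w H))"
      by (simp add: M_K mat_alg, rule eq_matI; simp del: index_mult_mat(1); simp add: algebra_simps)
    finally show ?thesis by (simp only: Q_def)
  qed
  have FG_eq: "FG = adj a * G + v \<cdot>\<^sub>m (adj a * K v G)" and FH_eq: "FH = adj a * H + w \<cdot>\<^sub>m (adj a * K w H)"
    by (simp_all add: FG_def FH_def ES)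
  define Z where "Z = adj (K v G) * (P * K w H)"
  have [simp]: "dim_row Z = p" "dim_col Z = q" by (auto simp: Z_def)
  have "adj (J * (r + FG)) * (J * (J * (r' + FH))) - adj (J * EG) * (J * (J * EH))
    = adj r * (J * r') + adj r * (J * FH) + adj FG * (J * r') - (adj EG * (J * EH) - adj FG * (J * FH))"
    by (simp add: mat_alg JJX, rule eq_matI; simp del: index_mult_mat(1))
  also have "\<dots> = adj r * (J * (r' + adj a * H)) - adj (F * G) * l' + (1 - cnj v * w) \<cdot>\<^sub>m Z"
    unfolding ker GPK KPH unfolding PH Z_def[symmetric] FG_eq FH_eq
    by (simp add: mat_alg, rule eq_matI; simp del: index_mult_mat(1); simp add: algebra_simps)
  finally show ?thesis by (simp only: EG_def EH_def FG_def FH_def Z_def)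
qed

end

context toeplitz_kernel
begin

abbreviation "Q \<equiv> Jb - adj S * (Jb * S)"

text \<open>Passage from the Q-equation to a P-equation. \<open>U\<close> is governed by Q, but the
  kernel identity is about P; the dual column T = Jb S U satisfies P T = a J R and expresses both
  polynomials in the shape required there. The relation R + a^* T = J is the first block of Jb U =
  E0^* R + S^* T.\<close>

lemma right_solution:
  assumes U [simp]: "dim_row U = d" "dim_col U = m" and R [simp]: "dim_row R = m" "dim_col R = m"
    and EU: "E0 * U = 1\<^sub>m m" and QU: "Q * U = adj E0 * R" and T: "T = Jb * (S * U)"
  shows "P * T = a * (J * R)" "R + adj a * T = J"
    "E w * U = J * (R + E w * (adj S * T))" "E w * (S * U) = J * (E w * T)"
proof -
  have Td [simp]: "dim_row T = d" "dim_col T = m" by (auto simp: T)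
  have JU: "Jb * U = adj E0 * R + adj S * T"
  proof -
    have "Jb * U - adj S * T = adj E0 * R" unfolding QU[symmetric] by (simp add: T mat_alg)
    then show ?thesis by (rule mat_eq_addI) simp_all
  qed
  have U_eq: "U = Jb * (adj E0 * R + adj S * T)" unfolding JU[symmetric] by (simp add: JJX)
  have SU: "S * U = Jb * T" by (simp add: T JJX)
  have "Jb * T = S * (Jb * (adj E0 * R)) + S * (Jb * (adj S * T))"
    unfolding SU[symmetric] by (subst U_eq) (simp add: mat_alg)
  moreover have "Jb * (adj E0 * R) = adj E0 * (J * R)"
  proof -
    have "Jb * adj E0 = adj (E0 * Jb)" by (simp add: adj_mult)
    also have "\<dots> = adj E0 * J" by (simp add: E0J adj_mult)
    finally show ?thesis by (simp add: mult_assoc_dim[symmetric])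
  qed
  ultimately have 1: "Jb * T = S * (adj E0 * (J * R)) + S * (Jb * (adj S * T))" by simp
  show "P * T = a * (J * R)"
    by (simp add: mat_alg 1, rule eq_matI; simp del: index_mult_mat(1))
  have E0EX: "E0 * (adj E0 * X) = X" if "dim_row X = m" for X
    using that by (simp add: mult_assoc_dim[symmetric] E0E0 one_mult_dim)
  have "E0 * (Jb * U) = J" using EU by (simp add: mult_assoc_dim[symmetric] E0J) (simp add: mult_assoc_dim one_mult_dim)
  then show "R + adj a * T = J" unfolding JU by (simp add: mat_alg E0EX)
  \<comment> \<open>N^* annihilates the first block column, so \<open>M w\<close> fixes it and the
    evaluation of a constant is that constant.\<close>
  have E0M: "E0 * (M w * (adj E0 * X)) = X" if [simp]: "dim_row X = m" for X
  proof -
    have "M w * (adj E0 * X) = adj E0 * X + w \<cdot>\<^sub>m (M w * (adj N * (adj E0 * X)))"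
      by (subst M2) (simp add: mat_alg)
    moreover have "adj N * (adj E0 * X) = 0\<^sub>m d (dim_col X)"
    proof -
      have "adj N * adj E0 = adj (E0 * N)" by (simp add: adj_mult)
      then show ?thesis by (simp add: mult_assoc_dim[symmetric] E0N zero_mult_dim)
    qed
    ultimately have "M w * (adj E0 * X) = adj E0 * X"
      by (simp add: zero_mult_dim) (rule eq_matI; simp del: index_mult_mat(1))
    then show ?thesis by (simp add: E0EX)
  qed
  show "E w * U = J * (R + E w * (adj S * T))"
    by (subst U_eq) (simp add: mat_alg EJ E0M)
  show "E w * (S * U) = J * (E w * T)"
    unfolding SU by (simp add: mat_alg EJ)
qed

context
  fixes U X R L :: "complex mat"
  assumes U [simp]: "dim_row U = d" "dim_col U = m" and R [simp]: "dim_row R = m" "dim_col R = m"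
    and X [simp]: "dim_row X = d" "dim_col X = m" and L [simp]: "dim_row L = m" "dim_col L = m"
    and EU: "E0 * U = 1\<^sub>m m" and QU: "Q * U = adj E0 * R"
    and FX: "F * X = 1\<^sub>m m" and PX: "P * X = adj F * L"
    and RL [simp]: "adj R = R" "adj L = L"
begin

text \<open>Numerator and denominator are affine in y and belong to the single column G = X y + T,
  to which the kernel identity applies with v = w. Here y stands for w Z(w), whose bound against R
  and L is \<open>schur_complement_bound\<close>.\<close>

lemma fraction_identity:
  fixes w :: complex
  assumes y [simp]: "dim_row y = m" "dim_col y = m"
  defines "DD \<equiv> J * (E w * (adj S * (X * y))) + E w * U" and "NN \<equiv> J * (E w * (X * y)) + E w * (S * U)"
  shows "adj DD * (J * DD) - adj NN * (J * NN)
    = (R - adj y * (L * y)) + (1 - cnj w * w) \<cdot>\<^sub>m (adj (K w (X * y + Jb * (S * U))) * (P * K w (X * y + Jb * (S * U))))"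
proof -
  define T where "T = Jb * (S * U)"
  have Td [simp]: "dim_row T = d" "dim_col T = m" by (auto simp: T_def)
  note sol = right_solution[OF U R EU QU T_def]
  define G where "G = X * y + T"
  have Gd [simp]: "dim_row G = d" "dim_col G = m" by (auto simp: G_def)
  have PG: "P * G = adj F * (L * y) + a * (J * R)"
  proof -
    have "P * G = P * (X * y) + P * T" unfolding G_def by (rule mult_add_dim) simp_all
    also have "P * (X * y) = (P * X) * y" by (simp add: mult_assoc_dim)
    also have "\<dots> = adj F * (L * y)" unfolding PX by (simp add: mult_assoc_dim)
    finally show ?thesis unfolding sol(1) .
  qed
  have D: "DD = J * (R + E w * (adj S * G))"
    unfolding DD_def sol(3) by (simp add: G_def mat_alg, rule eq_matI; simp del: index_mult_mat(1))
  have N: "NN = J * (E w * G)"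
    unfolding NN_def sol(4) by (simp add: G_def mat_alg)
  \<comment> \<open>The mixed boundary term: P is self-adjoint, so it can be moved from X to T,
    where it gives a J R. The result cancels the X y part of R J a^* G.\<close>
  have TPX: "adj T * (adj F * (L * y)) = R * (J * (adj a * (X * y)))"
  proof -
    have "adj T * (adj F * (L * y)) = adj T * ((P * X) * y)" unfolding PX by (simp add: mult_assoc_dim)
    also have "\<dots> = adj (P * T) * (X * y)" by (simp add: mat_alg)
    also have "\<dots> = R * (J * (adj a * (X * y)))" unfolding sol(1) by (simp add: mat_alg)
    finally show ?thesis .
  qed
  have "adj R * (J * (R + adj a * G)) - adj (F * G) * (L * y) = R - adj y * (L * y)"
  proof -
    have "R * (J * (R + adj a * T)) = R" unfolding sol(2) by (simp add: JJ one_mult_dim)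
    then have 1: "R * (J * R) + R * (J * (adj a * T)) = R" by (simp add: mat_alg)
    have "adj R * (J * (R + adj a * G)) - adj (F * G) * (L * y) =
      (R * (J * R) + R * (J * (adj a * T))) + R * (J * (adj a * (X * y))) - (adj (F * X * y) * (L * y) + adj T * (adj F * (L * y)))"
      by (simp add: G_def mat_alg, rule eq_matI; simp del: index_mult_mat(1))
    also have "\<dots> = R - adj y * (L * y)"
      unfolding 1 TPX FX by (simp add: one_mult_dim, rule eq_matI; simp del: index_mult_mat(1))
    finally show ?thesis .
  qed
  then show ?thesis
    using christoffel_darboux[OF Gd Gd R _ _ R _ _ PG PG, of w w] unfolding D N T_def[symmetric] G_def[symmetric]
    by simp
qed

context
  fixes v w :: complex
  assumes vw: "cnj v * w = 1"
begin

text \<open>At reflected points the factor 1 - conj(v) w vanishes and only boundary terms survive.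
  For G = H = T, with no last-block part, they are R J (R + a^* T) = R.\<close>

lemma cd_right: "adj (E v * U) * (J * (E w * U)) - adj (E v * (S * U)) * (J * (E w * (S * U))) = R"
proof -
  define T where "T = Jb * (S * U)"
  have Td [simp]: "dim_row T = d" "dim_col T = m" by (auto simp: T_def)
  note sol = right_solution[OF U R EU QU T_def]
  have PT: "P * T = adj F * 0\<^sub>m m m + a * (J * R)"
    unfolding sol(1) by (simp add: zero_mult_dim, rule eq_matI; simp del: index_mult_mat(1))
  have "adj R * (J * (R + adj a * T)) - adj (F * T) * 0\<^sub>m m m + (1 - cnj v * w) \<cdot>\<^sub>m (adj (K v T) * (P * K w T)) = R"
    unfolding sol(2) vw by (simp add: JJ one_mult_dim zero_mult_dim, rule eq_matI; simp del: index_mult_mat(1))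
  then show ?thesis
    using christoffel_darboux[OF Td Td R _ _ R _ _ PT PT, of v w] unfolding sol(3,4)
    by simp
qed

text \<open>The case G = H = X with no first-column part. The boundary terms give -L because F X =
  I; the sign is absorbed by exchanging the two products.\<close>

lemma cd_left: "adj (E v * X) * (J * (E w * X)) - adj (E v * (adj S * X)) * (J * (E w * (adj S * X))) = L"
proof -
  have PX': "P * X = adj F * L + a * (J * 0\<^sub>m m m)"
    unfolding PX by (simp add: zero_mult_dim, rule eq_matI; simp del: index_mult_mat(1))
  have "adj (0\<^sub>m m m) * (J * (0\<^sub>m m m + adj a * X)) - adj (F * X) * L + (1 - cnj v * w) \<cdot>\<^sub>m (adj (K v X) * (P * K w X)) = - L"
    unfolding FX vw by (simp add: one_mult_dim zero_mult_dim, rule eq_matI; simp del: index_mult_mat(1))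
  moreover have "0\<^sub>m m m + E u * (adj S * X) = E u * (adj S * X)" for u
    by (rule eq_matI; simp del: index_mult_mat(1))
  ultimately have e: "adj (J * (E v * (adj S * X))) * (J * (J * (E w * (adj S * X)))) - adj (J * (E v * X)) * (J * (J * (E w * X))) = - L"
    using christoffel_darboux[OF X X _ _ L _ _ L PX' PX', of v w] by simp
  have JJJ: "adj (J * G) * (J * (J * H)) = adj G * (J * H)" if "dim_row G = m" "dim_row H = m" for G H
    using that by (simp add: mat_alg JJX)
  have "adj (E v * (adj S * X)) * (J * (E w * (adj S * X))) - adj (E v * X) * (J * (E w * X)) = - L"
    using e by (simp only: JJJ index_mult_mat(2) dims)
  then show ?thesis by (rule mat_diff_swap) simp_all
qed

text \<open>Here X carries only a last-block part and T only a first-column part, so every boundary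
  term contains a zero factor.\<close>

lemma cd_mixed: "adj (E v * (adj S * X)) * (E w * U) = adj (E v * X) * (E w * (S * U))"
proof -
  define T where "T = Jb * (S * U)"
  have Td [simp]: "dim_row T = d" "dim_col T = m" by (auto simp: T_def)
  note sol = right_solution[OF U R EU QU T_def]
  have PT: "P * T = adj F * 0\<^sub>m m m + a * (J * R)"
    unfolding sol(1) by (simp add: zero_mult_dim, rule eq_matI; simp del: index_mult_mat(1))
  have PX': "P * X = adj F * L + a * (J * 0\<^sub>m m m)"
    unfolding PX by (simp add: zero_mult_dim, rule eq_matI; simp del: index_mult_mat(1))
  have "adj (0\<^sub>m m m) * (J * (R + adj a * T)) - adj (F * X) * 0\<^sub>m m m + (1 - cnj v * w) \<cdot>\<^sub>m (adj (K v X) * (P * K w T)) = 0\<^sub>m m m"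
    unfolding FX vw by (simp add: one_mult_dim zero_mult_dim, rule eq_matI; simp del: index_mult_mat(1))
  moreover have "0\<^sub>m m m + E u * (adj S * X) = E u * (adj S * X)" for u
    by (rule eq_matI; simp del: index_mult_mat(1))
  ultimately have e: "adj (J * (E v * (adj S * X))) * (J * (E w * U)) - adj (J * (E v * X)) * (J * (E w * (S * U))) = 0\<^sub>m m m"
    using christoffel_darboux[OF X Td _ _ L R _ _ PX' PT, of v w] unfolding sol(3,4) by simp
  have JJJ: "adj (J * G) * (J * H) = adj G * H" if "dim_row G = m" "dim_row H = m" for G H
    using that by (simp add: mat_alg JJX)
  have "adj (E v * (adj S * X)) * (E w * U) - adj (E v * X) * (E w * (S * U)) = 0\<^sub>m m m"
    using e by (simp only: JJJ index_mult_mat(2) dims)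
  then show ?thesis by (rule mat_diff_zero) (auto intro!: carrier_matI)
qed

end

text \<open>The equality of quotients with denominators cleared. Expand in the explicit factor w,
  leaving the common w^n aside: the terms with w^0 and w^2 agree by the mixed identity, used
  directly and in adjoint form. Those with w^1 differ by Y R - L Z, by \<open>cd_right\<close> and
  \<open>cd_left\<close>, and this vanishes by \<open>YZ\<close>.\<close>

lemma left_right_fractions:
  fixes n :: nat and v w :: complex
  assumes w: "w \<noteq> 0" and v: "v = 1 / cnj w"
    and Y [simp]: "dim_row Y = m" "dim_col Y = m" and Z [simp]: "dim_row Z = m" "dim_col Z = m"
    and YZ: "Y * R = L * Z"
  defines "t \<equiv> w ^ n \<cdot>\<^sub>m adj (E v * X)" and "s \<equiv> w ^ n \<cdot>\<^sub>m adj (E v * (adj S * X))"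
    and "p \<equiv> w ^ n \<cdot>\<^sub>m adj (E v * (S * U))" and "r \<equiv> w ^ n \<cdot>\<^sub>m adj (E v * U)"
  shows "(w \<cdot>\<^sub>m (Y * (p * J)) + t) * (w \<cdot>\<^sub>m (J * (E w * X * Z)) + E w * (S * U))
       = (w \<cdot>\<^sub>m (Y * (r * J)) + s) * (w \<cdot>\<^sub>m (J * (E w * (adj S * X) * Z)) + E w * U)"
proof -
  have vw: "cnj v * w = 1" and wv: "cnj w * v = 1" using w v by auto
  define A1 where "A1 = adj (E v * X)"
  define A2 where "A2 = adj (E v * (adj S * X))"
  define A3 where "A3 = adj (E v * (S * U))"
  define A4 where "A4 = adj (E v * U)"
  define B1 where "B1 = E w * X"
  define B2 where "B2 = E w * (adj S * X)"
  define B3 where "B3 = E w * (S * U)"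
  define B4 where "B4 = E w * U"
  have [simp]: "dim_row A1 = m" "dim_col A1 = m" "dim_row A2 = m" "dim_col A2 = m" "dim_row A3 = m" "dim_col A3 = m" "dim_row A4 = m" "dim_col A4 = m"
     "dim_row B1 = m" "dim_col B1 = m" "dim_row B2 = m" "dim_col B2 = m" "dim_row B3 = m" "dim_col B3 = m" "dim_row B4 = m" "dim_col B4 = m"
    by (auto simp: A1_def A2_def A3_def A4_def B1_def B2_def B3_def B4_def)
  have c1: "A4 * (J * B4) - A3 * (J * B3) = R" using cd_right[OF vw] by (simp add: A3_def A4_def B3_def B4_def)
  have c2: "A1 * (J * B1) - A2 * (J * B2) = L" using cd_left[OF vw] by (simp add: A1_def A2_def B1_def B2_def)
  have c3: "A2 * B4 = A1 * B3" using cd_mixed[OF vw] by (simp add: A1_def A2_def B3_def B4_def)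
  \<comment> \<open>The mixed identity with v and w exchanged, then adjoined; the condition conj(v)
    w = 1 is symmetric under conjugation.\<close>
  have c4: "A4 * B2 = A3 * B1"
  proof -
    have "adj (adj (E w * (adj S * X)) * (E v * U)) = adj (adj (E w * X) * (E v * (S * U)))"
      by (simp only: cd_mixed[OF wv])
    then show ?thesis by (subst (asm) (1 2) adj_mult) (simp_all add: A3_def A4_def B1_def B2_def)
  qed
  have c4X: "A4 * (B2 * Z) = A3 * (B1 * Z)" using c4 by (simp add: mult_assoc_dim[symmetric])
  have JJZ: "J * (J * H) = H" if "dim_row H = m" for H using that by (rule JJX)
  have "Y * (A4 * (J * B4)) - Y * (A3 * (J * B3)) = A1 * (J * (B1 * Z)) - A2 * (J * (B2 * Z))"
  proof -
    have "Y * (A4 * (J * B4)) - Y * (A3 * (J * B3)) = Y * R" unfolding c1[symmetric] by (simp add: mat_alg)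
    also have "\<dots> = A1 * (J * (B1 * Z)) - A2 * (J * (B2 * Z))" unfolding YZ c2[symmetric] by (simp add: mat_alg)
    finally show ?thesis .
  qed
  then have e: "Y * (A4 * (J * B4)) = A1 * (J * (B1 * Z)) - A2 * (J * (B2 * Z)) + Y * (A3 * (J * B3))"
    by (rule mat_eq_addI) simp_all
  show ?thesis
    unfolding t_def s_def p_def r_def A1_def[symmetric] A2_def[symmetric] A3_def[symmetric] A4_def[symmetric]
      B1_def[symmetric] B2_def[symmetric] B3_def[symmetric] B4_def[symmetric]
  proof (rule eq_matI)
    fix i j assume "i < dim_row ((w \<cdot>\<^sub>m (Y * (w ^ n \<cdot>\<^sub>m A4 * J)) + w ^ n \<cdot>\<^sub>m A2) * (w \<cdot>\<^sub>m (J * (B2 * Z)) + B4))"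
      "j < dim_col ((w \<cdot>\<^sub>m (Y * (w ^ n \<cdot>\<^sub>m A4 * J)) + w ^ n \<cdot>\<^sub>m A2) * (w \<cdot>\<^sub>m (J * (B2 * Z)) + B4))"
    then have ij: "i < m" "j < m" by auto
    have e': "(Y * (A4 * (J * B4))) $$ (i,j) = (Y * (A3 * (J * B3))) $$ (i,j) + (A1 * (J * (B1 * Z))) $$ (i,j) - (A2 * (J * (B2 * Z))) $$ (i,j)"
      unfolding e using ij by (simp add: algebra_simps del: index_mult_mat(1))
    show "((w \<cdot>\<^sub>m (Y * (w ^ n \<cdot>\<^sub>m A3 * J)) + w ^ n \<cdot>\<^sub>m A1) * (w \<cdot>\<^sub>m (J * (B1 * Z)) + B3)) $$ (i,j)
      = ((w \<cdot>\<^sub>m (Y * (w ^ n \<cdot>\<^sub>m A4 * J)) + w ^ n \<cdot>\<^sub>m A2) * (w \<cdot>\<^sub>m (J * (B2 * Z)) + B4)) $$ (i,j)"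
      using ij by (simp add: mat_alg JJZ c3 c4X e' del: index_mult_mat(1)) (simp add: algebra_simps)
  qed auto
qed

end

end

subsection \<open>Block Toeplitz matrices\<close>

lemma sum_lessThan_add: "(\<Sum>k<a + b. f k) = (\<Sum>k<a. f k) + (\<Sum>r<b. f (a + r))" for f :: "nat \<Rightarrow> 'a::comm_monoid_add"
  by (induction b) (auto simp: add.assoc)

lemma sum_blocks: "(\<Sum>k<n * m. f k) = (\<Sum>q<n. \<Sum>r<m. f (q * m + r))" for f :: "nat \<Rightarrow> 'a::comm_monoid_add"
proof (induction n)
  case (Suc n)
  have "(\<Sum>k<Suc n * m. f k) = (\<Sum>k<n * m + m. f k)" by (simp add: add.commute)
  also have "\<dots> = (\<Sum>q<Suc n. \<Sum>r<m. f (q * m + r))" unfolding sum_lessThan_add Suc by simp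
  finally show ?case .
qed simp

lemma block_index:
  fixes i m n :: nat
  assumes "i < (n + 1) * m"
  obtains q r where "i = q * m + r" "r < m" "q \<le> n"
proof
  have "0 < m" using assms by (cases m) auto
  then show "i = i div m * m + i mod m" "i mod m < m" by auto
  have "i div m < n + 1" using assms by (simp add: less_mult_imp_div_less)
  then show "i div m \<le> n" by simp
qed

lemma block_less [simp]: "r < m \<Longrightarrow> q \<le> n \<Longrightarrow> q * m + r < (n + 1) * m" for q r m n :: nat
proof -
  assume "r < m" "q \<le> n"
  then have "q * m + r < q * m + m" "q * m \<le> n * m" by auto
  then show ?thesis unfolding add_mult_distrib by linarith
qed

lemma block_less_unfolded [simp]:
  fixes q r m n :: nat
  assumes "r < m" "q \<le> n"
  shows "q * m + r < m + n * m"
  using block_less[OF assms] unfolding add_mult_distrib by linarith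

lemma block_div_mod [simp]: "r < m \<Longrightarrow> (q * m + r) div m = q" "r < m \<Longrightarrow> (q * m + r) mod m = r" for q r m :: nat
  by auto

lemma single_sum: "(\<Sum>k<d. f k) = f k0" if "k0 < d" "\<And>k. k < d \<Longrightarrow> k \<noteq> k0 \<Longrightarrow> f k = 0"
  for f :: "nat \<Rightarrow> complex"
  using that by (subst sum.remove[of _ k0]) (auto intro!: sum.neutral)

lemma mult_index_single:
  fixes A B :: "complex mat"
  assumes "dim_col A = dim_row B" "i < dim_row A" "j < dim_col B" "k0 < dim_row B"
    and "\<And>k. k < dim_row B \<Longrightarrow> k \<noteq> k0 \<Longrightarrow> A $$ (i,k) * B $$ (k,j) = 0"
  shows "(A * B) $$ (i,j) = A $$ (i,k0) * B $$ (k0,j)"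
  using assms by (subst mult_index_sum) (auto intro!: single_sum)

lemma mult_index_zero:
  fixes A B :: "complex mat"
  assumes "dim_col A = dim_row B" "i < dim_row A" "j < dim_col B"
    and "\<And>k. k < dim_row B \<Longrightarrow> A $$ (i,k) * B $$ (k,j) = 0"
  shows "(A * B) $$ (i,j) = 0"
  using assms by (subst mult_index_sum) (auto intro!: sum.neutral)

section \<open>The block shift, its resolvent and the edge blocks\<close>

definition block_shift :: "nat \<Rightarrow> nat \<Rightarrow> complex mat" where
  "block_shift m n = mat ((n+1)*m) ((n+1)*m) (\<lambda>(i,j). if i = j + m then 1 else 0)"

definition first_block :: "nat \<Rightarrow> nat \<Rightarrow> complex mat" where
  "first_block m n = mat m ((n+1)*m) (\<lambda>(i,j). if i = j then 1 else 0)"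

definition last_block :: "nat \<Rightarrow> nat \<Rightarrow> complex mat" where
  "last_block m n = mat m ((n+1)*m) (\<lambda>(i,j). if j = n * m + i then 1 else 0)"

text \<open>The finite Neumann series of the nilpotent w N^*. Having it in closed form gives the
  inverse of 1 - w N^* at every complex w, including points outside the disc.\<close>

definition shift_inv :: "nat \<Rightarrow> nat \<Rightarrow> complex \<Rightarrow> complex mat" where
  "shift_inv m n w = mat ((n+1)*m) ((n+1)*m)
     (\<lambda>(i,j). if i mod m = j mod m \<and> i div m \<le> j div m then w ^ (j div m - i div m) else 0)"

lemma block_dims [simp]:
  "dim_row (block_shift m n) = (n+1)*m" "dim_col (block_shift m n) = (n+1)*m"
  "dim_row (first_block m n) = m" "dim_col (first_block m n) = (n+1)*m"
  "dim_row (last_block m n) = m" "dim_col (last_block m n) = (n+1)*m"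
  "dim_row (shift_inv m n w) = (n+1)*m" "dim_col (shift_inv m n w) = (n+1)*m"
  "dim_row (blockmat m r c f) = r * m" "dim_col (blockmat m r c f) = c * m"
  "dim_row (Smat m A n) = (n+1)*m" "dim_col (Smat m A n) = (n+1)*m"
  "dim_row (Jblk m J n) = (n+1)*m" "dim_col (Jblk m J n) = (n+1)*m"
  "dim_row (yvec m A n) = n*m" "dim_col (yvec m A n) = m"
  "dim_row (zvec m A n) = m" "dim_col (zvec m A n) = n*m"
  by (auto simp: block_shift_def first_block_def last_block_def shift_inv_def blockmat_def Smat_def Jblk_def yvec_def zvec_def)

lemma shift_mult:
  assumes X: "dim_row X = (n+1)*m" and i: "i < (n+1)*m" and j: "j < dim_col X"
  shows "(block_shift m n * X) $$ (i,j) = (if m \<le> i then X $$ (i - m,j) else 0)"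
proof (cases "m \<le> i")
  case True
  then show ?thesis using X i j
    by (subst mult_index_single[of _ _ _ _ "i - m"]) (auto simp: block_shift_def)
next
  case False
  then show ?thesis using X i j
    by (subst mult_index_zero) (auto simp: block_shift_def)
qed

lemma mult_shift:
  assumes X: "dim_col X = (n+1)*m" and i: "i < dim_row X" and j: "j < (n+1)*m"
  shows "(X * block_shift m n) $$ (i,j) = (if j + m < (n+1)*m then X $$ (i, j+m) else 0)"
proof (cases "j + m < (n+1)*m")
  case True
  then show ?thesis using X i j
    by (subst mult_index_single[of _ _ _ _ "j + m"]) (auto simp: block_shift_def)
next
  case False
  then show ?thesis using X i j
    by (subst mult_index_zero) (auto simp: block_shift_def)
qed

lemma adj_shift_mult:
  assumes X: "dim_row X = (n+1)*m" and i: "i < (n+1)*m" and j: "j < dim_col X"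
  shows "(adj (block_shift m n) * X) $$ (i,j) = (if i + m < (n+1)*m then X $$ (i + m,j) else 0)"
proof -
  have "(adj (block_shift m n) * X) $$ (i,j) = cnj ((adj X * block_shift m n) $$ (j,i))"
    using adj_index[of i "adj X * block_shift m n" j] X i j by (simp add: adj_mult del: index_mult_mat(1))
  then show ?thesis using X i j by (simp add: mult_shift del: index_mult_mat(1))
qed

lemma mult_adj_shift:
  assumes X: "dim_col X = (n+1)*m" and i: "i < dim_row X" and j: "j < (n+1)*m"
  shows "(X * adj (block_shift m n)) $$ (i,j) = (if m \<le> j then X $$ (i, j - m) else 0)"
proof -
  have "(X * adj (block_shift m n)) $$ (i,j) = cnj ((block_shift m n * adj X) $$ (j,i))"
    using adj_index[of i "block_shift m n * adj X" j] X i j by (simp add: adj_mult del: index_mult_mat(1))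
  then show ?thesis using X i j by (simp add: shift_mult del: index_mult_mat(1))
qed

lemma first_mult:
  assumes "dim_row X = (n+1)*m" "i < m" "j < dim_col X"
  shows "(first_block m n * X) $$ (i,j) = X $$ (i,j)"
  using assms by (subst mult_index_single[of _ _ _ _ i]) (auto simp: first_block_def)

lemma mult_first:
  assumes "dim_col X = m" "i < dim_row X" "j < (n+1)*m"
  shows "(X * first_block m n) $$ (i,j) = (if j < m then X $$ (i,j) else 0)"
proof (cases "j < m")
  case True
  then show ?thesis using assms by (subst mult_index_single[of _ _ _ _ j]) (auto simp: first_block_def)
next
  case False
  then show ?thesis using assms by (subst mult_index_zero) (auto simp: first_block_def)
qed

lemma adj_first_mult:
  assumes X: "dim_row X = m" and i: "i < (n+1)*m" and j: "j < dim_col X"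
  shows "(adj (first_block m n) * X) $$ (i,j) = (if i < m then X $$ (i,j) else 0)"
proof -
  have "(adj (first_block m n) * X) $$ (i,j) = cnj ((adj X * first_block m n) $$ (j,i))"
    using adj_index[of i "adj X * first_block m n" j] X i j by (simp add: adj_mult del: index_mult_mat(1))
  then show ?thesis using X i j by (simp add: mult_first del: index_mult_mat(1))
qed

lemma last_mult:
  assumes "dim_row X = (n+1)*m" "i < m" "j < dim_col X"
  shows "(last_block m n * X) $$ (i,j) = X $$ (n * m + i,j)"
  using assms by (subst mult_index_single[of _ _ _ _ "n * m + i"]) (auto simp: last_block_def)

lemma adj_last_mult:
  assumes "dim_row X = m" "i < (n+1)*m" "j < dim_col X"
  shows "(adj (last_block m n) * X) $$ (i,j) = (if n * m \<le> i then X $$ (i - n * m,j) else 0)"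
proof (cases "n * m \<le> i")
  case True
  then show ?thesis using assms by (subst mult_index_single[of _ _ _ _ "i - n * m"]) (auto simp: last_block_def)
next
  case False
  then show ?thesis using assms by (subst mult_index_zero) (auto simp: last_block_def)
qed

lemma Smat_index: "i < (n+1)*m \<Longrightarrow> j < (n+1)*m \<Longrightarrow> (\<And>k. k \<le> n \<Longrightarrow> A k \<in> carrier_mat m m) \<Longrightarrow>
   Smat m A n $$ (i,j) = (if j div m \<le> i div m then A (i div m - j div m) $$ (i mod m, j mod m) else 0)"
  by (cases "m = 0") (auto simp: Smat_def blockmat_def)

lemma Jblk_index: "i < (n+1)*m \<Longrightarrow> j < (n+1)*m \<Longrightarrow>
   Jblk m J n $$ (i,j) = (if i div m = j div m then J $$ (i mod m, j mod m) else 0)"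
  by (cases "m = 0") (auto simp: Jblk_def blockmat_def)

text \<open>Block p of a stacked column is thereby the coefficient of w^p: multiplying by the first
  block row of the resolvent evaluates a polynomial.\<close>

lemma eval_mult:
  assumes X: "dim_row X = (n+1)*m" and i: "i < m" and j: "j < dim_col X"
  shows "(first_block m n * shift_inv m n w * X) $$ (i,j) = (\<Sum>p\<le>n. w ^ p * X $$ (p * m + i, j))"
proof -
  have E: "(first_block m n * shift_inv m n w) $$ (i, q * m + r) = (if r = i then w ^ q else 0)" if "q \<le> n" "r < m" for q r
    using that i block_less[OF that(2,1)]
    by (subst first_mult) (auto simp: shift_inv_def)
  have "(first_block m n * shift_inv m n w * X) $$ (i,j) = (\<Sum>k<(n+1)*m. (first_block m n * shift_inv m n w) $$ (i,k) * X $$ (k,j))"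
    using assms by (subst mult_index_sum) auto
  also have "\<dots> = (\<Sum>q<n+1. \<Sum>r<m. (first_block m n * shift_inv m n w) $$ (i, q * m + r) * X $$ (q * m + r,j))"
    by (rule sum_blocks)
  also have "\<dots> = (\<Sum>q<n+1. w ^ q * X $$ (q * m + i, j))"
    using i by (intro sum.cong refl, subst single_sum[of i]) (auto simp: E simp del: index_mult_mat(1))
  also have "{..<n+1} = {..n}" by auto
  finally show ?thesis .
qed

lemma toeplitz_instance:
  assumes J: "signature m J" and m: "0 < m" and A: "\<And>k. k \<le> n \<Longrightarrow> A k \<in> carrier_mat m m"
  shows "toeplitz_kernel m ((n+1)*m) J (Jblk m J n) (Smat m A n) (block_shift m n) (first_block m n) (last_block m n) (shift_inv m n)"
proof
  have Jd [simp]: "dim_row J = m" "dim_col J = m" "J \<in> carrier_mat m m" and Ja: "adj J = J" and JJ: "J * J = 1\<^sub>m m"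
    using J by (auto simp: signature_def)
  define Jb where "Jb = Jblk m J n"
  have Jbd [simp]: "dim_row Jb = (n+1)*m" "dim_col Jb = (n+1)*m" by (auto simp: Jb_def)
  have Jb_ix: "Jb $$ (q * m + r, q' * m + r') = (if q = q' then J $$ (r,r') else 0)" if "q \<le> n" "q' \<le> n" "r < m" "r' < m" for q q' r r'
    using that block_less[OF that(3,1)] block_less[OF that(4,2)] by (simp add: Jb_def Jblk_index)
  show "signature ((n + 1) * m) (Jblk m J n)"
    unfolding signature_def Jb_def[symmetric]
  proof (intro conjI)
    show "adj Jb = Jb"
    proof (rule eq_matI)
      fix i j assume "i < dim_row Jb" "j < dim_col Jb"
      then have ij: "i < (n+1)*m" "j < (n+1)*m" by auto
      have "cnj (J $$ (j mod m, i mod m)) = J $$ (i mod m, j mod m)"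
        using adj_index[of "i mod m" J "j mod m"] m by (simp add: Ja)
      then show "adj Jb $$ (i,j) = Jb $$ (i,j)" using ij by (simp add: Jb_def Jblk_index)
    qed auto
    show "Jb * Jb = 1\<^sub>m ((n + 1) * m)"
    proof (rule eq_matI)
      fix i j assume "i < dim_row (1\<^sub>m ((n + 1) * m) :: complex mat)" "j < dim_col (1\<^sub>m ((n + 1) * m) :: complex mat)"
      then have ij: "i < (n+1)*m" "j < (n+1)*m" by auto
      obtain q r where i: "i = q * m + r" "r < m" "q \<le> n" using ij(1) by (rule block_index)
      obtain q' r' where j: "j = q' * m + r'" "r' < m" "q' \<le> n" using ij(2) by (rule block_index)
      have "(Jb * Jb) $$ (i,j) = (\<Sum>k<(n+1)*m. Jb $$ (i,k) * Jb $$ (k,j))"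
        using ij by (subst mult_index_sum) auto
      also have "\<dots> = (\<Sum>p<n+1. \<Sum>s<m. Jb $$ (i,p * m + s) * Jb $$ (p * m + s,j))"
        by (rule sum_blocks)
      also have "\<dots> = (\<Sum>s<m. Jb $$ (i,q * m + s) * Jb $$ (q * m + s,j))"
        using i j by (intro single_sum) (auto simp: Jb_ix intro!: sum.neutral)
      also have "\<dots> = (if q = q' then (J * J) $$ (r,r') else 0)"
        using i j by (subst mult_index_sum) (auto simp: Jb_ix)
      also have "\<dots> = 1\<^sub>m ((n + 1) * m) $$ (i,j)"
        using i j ij unfolding JJ by (auto simp: ) (metis block_div_mod)+
      finally show "(Jb * Jb) $$ (i,j) = 1\<^sub>m ((n + 1) * m) $$ (i,j)" .
    qed auto
  qed (rule carrier_matI; simp)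
  \<comment> \<open>N Jb N^* is Jb moved one block down the diagonal, with a zero corner; the
    difference leaves only the corner block J.\<close>
  show "Jblk m J n - block_shift m n * (Jblk m J n * adj (block_shift m n)) = adj (first_block m n) * (J * first_block m n)"
  proof (rule eq_matI)
    fix i j assume "i < dim_row (adj (first_block m n) * (J * first_block m n))" "j < dim_col (adj (first_block m n) * (J * first_block m n))"
    then have ij: "i < (n+1)*m" "j < (n+1)*m" by auto
    obtain q r where i: "i = q * m + r" "r < m" "q \<le> n" using ij(1) by (rule block_index)
    obtain q' r' where j: "j = q' * m + r'" "r' < m" "q' \<le> n" using ij(2) by (rule block_index)
    have less: "q * m + r < m \<longleftrightarrow> q = 0" if "r < m" for q r using that by (cases q) auto
    have minus: "q * m + r - m = (q - 1) * m + r" if "q \<noteq> 0" for q r using that by (cases q) auto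
    have "(Jb - block_shift m n * (Jb * adj (block_shift m n))) $$ (i,j) = Jb $$ (i,j) - (if m \<le> i \<and> m \<le> j then Jb $$ (i - m, j - m) else 0)"
      using ij by (simp add: shift_mult mult_adj_shift del: index_mult_mat(1))
    also have "\<dots> = (if i < m \<and> j < m then J $$ (i,j) else 0)"
      using i j by (auto simp: not_less[symmetric] less minus Jb_ix)
    also have "\<dots> = (adj (first_block m n) * (J * first_block m n)) $$ (i,j)"
      using ij by (simp add: adj_first_mult mult_first del: index_mult_mat(1))
    finally show "(Jblk m J n - block_shift m n * (Jblk m J n * adj (block_shift m n))) $$ (i,j) = (adj (first_block m n) * (J * first_block m n)) $$ (i,j)"
      by (simp only: Jb_def)
  qed auto
  show "first_block m n * Jblk m J n = J * first_block m n"
  proof (rule eq_matI)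
    fix i j assume "i < dim_row (J * first_block m n)" "j < dim_col (J * first_block m n)"
    then have ij: "i < m" "j < (n+1)*m" by auto
    then show "(first_block m n * Jblk m J n) $$ (i,j) = (J * first_block m n) $$ (i,j)"
      by (simp add: first_mult mult_first Jblk_index div_eq_0_iff del: index_mult_mat(1))
  qed auto
  show "first_block m n * adj (first_block m n) = 1\<^sub>m m"
    by (rule eq_matI; simp add: first_mult del: index_mult_mat(1)) (auto simp: first_block_def)
  show "first_block m n * block_shift m n = 0\<^sub>m m ((n + 1) * m)"
    by (rule eq_matI; simp add: first_mult del: index_mult_mat(1)) (auto simp: block_shift_def)
  show "last_block m n * adj (block_shift m n) = 0\<^sub>m m ((n + 1) * m)"
    by (rule eq_matI; simp add: last_mult del: index_mult_mat(1)) (auto simp: block_shift_def)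
  show "shift_inv m n w = 1\<^sub>m ((n + 1) * m) + w \<cdot>\<^sub>m (adj (block_shift m n) * shift_inv m n w)" for w
  proof (rule eq_matI)
    fix i j assume "i < dim_row (1\<^sub>m ((n + 1) * m) + w \<cdot>\<^sub>m (adj (block_shift m n) * shift_inv m n w))"
      "j < dim_col (1\<^sub>m ((n + 1) * m) + w \<cdot>\<^sub>m (adj (block_shift m n) * shift_inv m n w))"
    then have ij: "i < (n+1)*m" "j < (n+1)*m" by auto
    obtain q r where i: "i = q * m + r" "r < m" "q \<le> n" using ij(1) by (rule block_index)
    obtain q' r' where j: "j = q' * m + r'" "r' < m" "q' \<le> n" using ij(2) by (rule block_index)
    have eq: "i = j \<longleftrightarrow> q = q' \<and> r = r'" using i j by (metis block_div_mod)
    have im: "i + m = (q + 1) * m + r" using i by simp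
    have sl: "i + m < (n+1)*m \<longleftrightarrow> q < n"
      unfolding im using i block_less[of r m "q+1" n] by (cases "q < n") auto
    have "(adj (block_shift m n) * shift_inv m n w) $$ (i,j) = (if i + m < (n+1)*m then shift_inv m n w $$ (i + m,j) else 0)"
      by (rule adj_shift_mult) (use ij in auto)
    then have "(adj (block_shift m n) * shift_inv m n w) $$ (i,j) = (if q < n then shift_inv m n w $$ ((q+1) * m + r, j) else 0)"
      unfolding sl unfolding im .
    then have "(w \<cdot>\<^sub>m (adj (block_shift m n) * shift_inv m n w)) $$ (i,j) = (if q < n then w * shift_inv m n w $$ ((q+1) * m + r, j) else 0)"
      using ij by (simp del: index_mult_mat(1))
    moreover have M_ix: "shift_inv m n w $$ (q * m + r, j) = (if r = r' \<and> q \<le> q' then w ^ (q' - q) else 0)" if "q \<le> n" for q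
      using that i j block_less[OF i(2) that] ij by (simp add: shift_inv_def)
    have "shift_inv m n w $$ (i, j) = (if r = r' \<and> q \<le> q' then w ^ (q' - q) else 0)"
      unfolding i(1) by (rule M_ix) (rule i)
    moreover have "shift_inv m n w $$ ((q+1) * m + r, j) = (if r = r' \<and> q + 1 \<le> q' then w ^ (q' - (q + 1)) else 0)" if "q < n"
      by (rule M_ix) (use that in simp)
    ultimately show "shift_inv m n w $$ (i,j) = (1\<^sub>m ((n + 1) * m) + w \<cdot>\<^sub>m (adj (block_shift m n) * shift_inv m n w)) $$ (i,j)"
      using ij i j eq by (auto simp del: index_mult_mat(1) simp: power_Suc[symmetric] Suc_diff_Suc simp del: power_Suc)
  qed auto
  show "shift_inv m n w = 1\<^sub>m ((n + 1) * m) + w \<cdot>\<^sub>m (shift_inv m n w * adj (block_shift m n))" for w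
  proof (rule eq_matI)
    fix i j assume "i < dim_row (1\<^sub>m ((n + 1) * m) + w \<cdot>\<^sub>m (shift_inv m n w * adj (block_shift m n)))"
      "j < dim_col (1\<^sub>m ((n + 1) * m) + w \<cdot>\<^sub>m (shift_inv m n w * adj (block_shift m n)))"
    then have ij: "i < (n+1)*m" "j < (n+1)*m" by auto
    obtain q r where i: "i = q * m + r" "r < m" "q \<le> n" using ij(1) by (rule block_index)
    obtain q' r' where j: "j = q' * m + r'" "r' < m" "q' \<le> n" using ij(2) by (rule block_index)
    have eq: "i = j \<longleftrightarrow> q = q' \<and> r = r'" using i j by (metis block_div_mod)
    have pw: "w ^ (q' - q) = w * w ^ (q' - Suc q)" if "q \<le> q'" "q \<noteq> q'"
      using that by (metis Suc_diff_Suc order_le_neq_trans power_Suc)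
    have pw0: "w ^ q' = w * w ^ (q' - Suc 0)" if "0 < q'" using that by (cases q') auto
    have less: "m \<le> q' * m + r' \<longleftrightarrow> q' \<noteq> 0" using j by (cases q') auto
    have minus: "q' * m + r' - m = (q' - 1) * m + r'" if "q' \<noteq> 0" using that by (cases q') auto
    have "(w \<cdot>\<^sub>m (shift_inv m n w * adj (block_shift m n))) $$ (i,j) = (if q' \<noteq> 0 then w * shift_inv m n w $$ (i, (q' - 1) * m + r') else 0)"
      using ij j by (simp add: mult_adj_shift less minus del: index_mult_mat(1))
    moreover have "shift_inv m n w $$ (i, q' * m + r') = (if r = r' \<and> q \<le> q' then w ^ (q' - q) else 0)" if "q' \<le> n" for q'
      using that i j block_less[OF j(2) that] ij by (simp add: shift_inv_def)
    ultimately show "shift_inv m n w $$ (i,j) = (1\<^sub>m ((n + 1) * m) + w \<cdot>\<^sub>m (shift_inv m n w * adj (block_shift m n))) $$ (i,j)"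
      using ij i j eq by (auto simp del: index_mult_mat(1) simp: pw pw0)
  qed auto
  show "shift_inv m n w * Jblk m J n = Jblk m J n * shift_inv m n w" for w
    unfolding Jb_def[symmetric]
  proof (rule eq_matI)
    fix i j assume "i < dim_row (Jb * shift_inv m n w)" "j < dim_col (Jb * shift_inv m n w)"
    then have ij: "i < (n+1)*m" "j < (n+1)*m" by auto
    obtain q r where i: "i = q * m + r" "r < m" "q \<le> n" using ij(1) by (rule block_index)
    obtain q' r' where j: "j = q' * m + r'" "r' < m" "q' \<le> n" using ij(2) by (rule block_index)
    have M_ix: "shift_inv m n w $$ (q * m + r, q' * m + r') = (if r = r' \<and> q \<le> q' then w ^ (q' - q) else 0)"
      if "q \<le> n" "q' \<le> n" "r < m" "r' < m" for q q' r r'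
      using that block_less[OF that(3,1)] block_less[OF that(4,2)] by (simp add: shift_inv_def)
    have 1: "(shift_inv m n w * Jb) $$ (i,j) = shift_inv m n w $$ (i, q' * m + r) * Jb $$ (q' * m + r, j)"
    proof (rule mult_index_single)
      fix k assume "k < dim_row Jb" "k \<noteq> q' * m + r"
      then obtain p s where "k = p * m + s" "s < m" "p \<le> n" "k \<noteq> q' * m + r"
        using block_index[of k n m] by (metis Jbd(1))
      then show "shift_inv m n w $$ (i, k) * Jb $$ (k, j) = 0"
        using i j by (auto simp: M_ix Jb_ix)
    qed (use ij i j block_less[OF i(2) j(3)] in auto)
    have 2: "(Jb * shift_inv m n w) $$ (i,j) = Jb $$ (i, q * m + r') * shift_inv m n w $$ (q * m + r', j)"
    proof (rule mult_index_single)
      fix k assume "k < dim_row (shift_inv m n w)" "k \<noteq> q * m + r'"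
      then obtain p s where "k = p * m + s" "s < m" "p \<le> n" "k \<noteq> q * m + r'"
        using block_index[of k n m] by (metis block_dims(7))
      then show "Jb $$ (i, k) * shift_inv m n w $$ (k, j) = 0"
        using i j by (auto simp: M_ix Jb_ix)
    qed (use ij i j block_less[OF j(2) i(3)] in auto)
    show "(shift_inv m n w * Jb) $$ (i,j) = (Jb * shift_inv m n w) $$ (i,j)"
      unfolding 1 2 using i j by (simp add: M_ix Jb_ix)
  qed auto
  \<comment> \<open>In block (q, q') both products have the coefficient with index q - q' - 1, or
    zero. The edge cases q = 0 and q' = n are consistent, as both imply q' \<ge> q.\<close>
  show "block_shift m n * Smat m A n = Smat m A n * block_shift m n"
  proof (rule eq_matI)
    fix i j assume "i < dim_row (Smat m A n * block_shift m n)" "j < dim_col (Smat m A n * block_shift m n)"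
    then have ij: "i < (n+1)*m" "j < (n+1)*m" by auto
    obtain q r where i: "i = q * m + r" "r < m" "q \<le> n" using ij(1) by (rule block_index)
    obtain q' r' where j: "j = q' * m + r'" "r' < m" "q' \<le> n" using ij(2) by (rule block_index)
    have S_ix: "Smat m A n $$ (q * m + r, q' * m + r') = (if q' \<le> q then A (q - q') $$ (r,r') else 0)"
      if "q \<le> n" "q' \<le> n" "r < m" "r' < m" for q q' r r'
      using that block_less[OF that(3,1)] block_less[OF that(4,2)] by (simp add: Smat_index A)
    have sl: "m + (q' * m + r') < (n+1)*m \<longleftrightarrow> q' < n"
      using j block_less[of r' m "q'+1" n] by (cases "q' < n") auto
    have less: "m \<le> q * m + r \<longleftrightarrow> q \<noteq> 0" using i by (cases q) auto
    have minus: "q * m + r - m = (q - 1) * m + r" if "q \<noteq> 0" using that by (cases q) auto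
    have "(block_shift m n * Smat m A n) $$ (i,j) = (if q \<noteq> 0 then Smat m A n $$ ((q - 1) * m + r, j) else 0)"
      using ij i(1) by (simp add: shift_mult less minus del: index_mult_mat(1))
    moreover have "(Smat m A n * block_shift m n) $$ (i,j) = (if q' < n then Smat m A n $$ (i, (q' + 1) * m + r') else 0)"
      using ij j(1) sl by (simp add: mult_shift add.commute add.left_commute del: index_mult_mat(1))
    moreover have "Smat m A n $$ ((q - 1) * m + r, j) = (if q' \<le> q - 1 then A (q - 1 - q') $$ (r,r') else 0)" if "q \<noteq> 0"
      unfolding j(1) using i j by (subst S_ix) auto
    moreover have "Smat m A n $$ (i, (q' + 1) * m + r') = (if q' + 1 \<le> q then A (q - (q' + 1)) $$ (r,r') else 0)" if "q' < n"
      unfolding i(1) using i j that by (subst S_ix) auto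
    ultimately show "(block_shift m n * Smat m A n) $$ (i,j) = (Smat m A n * block_shift m n) $$ (i,j)"
      using i j by (auto simp del: index_mult_mat(1))
  qed auto
qed (use J in auto)

section \<open>Bordered block matrices and stacked columns\<close>

lemma col_stack_mult:
  fixes A B C D X Y :: "complex mat"
  assumes "A \<in> carrier_mat a b" "B \<in> carrier_mat a b'" "C \<in> carrier_mat a' b" "D \<in> carrier_mat a' b'"
    "X \<in> carrier_mat b c" "Y \<in> carrier_mat b' c"
  shows "four_block_mat A B C D * (X @\<^sub>r Y) = (A * X + B * Y) @\<^sub>r (C * X + D * Y)"
  unfolding append_rows_def
  using assms by (subst mult_four_block_mat[of _ a b _ b' _ a' _ _ c _ 0]) (auto intro!: cong_four_block_mat)

lemma append_rows_diff:
  fixes A B C D :: "complex mat"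
  assumes "A \<in> carrier_mat a c" "B \<in> carrier_mat b c" "C \<in> carrier_mat a c" "D \<in> carrier_mat b c"
  shows "(A @\<^sub>r B) - (C @\<^sub>r D) = (A - C) @\<^sub>r (B - D)"
  using assms by (intro eq_matI) (auto simp: append_rows_def)

lemma append_rows_index:
  assumes "A \<in> carrier_mat a c" "B \<in> carrier_mat b c" "i < a + b" "j < c"
  shows "(A @\<^sub>r B) $$ (i,j) = (if i < a then A $$ (i,j) else B $$ (i - a,j))"
  using assms by (auto simp: append_rows_def)

lemma append_rows_dims [simp]: "dim_row (A @\<^sub>r B) = dim_row A + dim_row B" "dim_col (A @\<^sub>r B) = dim_col A"
  by (auto simp: append_rows_def)

text \<open>This evaluates the pseudoinverse terms in \<^const>\<open>Lmat\<close> and \<^const>\<open>Rmat\<close>: the columns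
  \<open>y\<close> and \<open>z\<^sup>*\<close> lie in the range of \<open>P\<close> and \<open>Q\<close>, the preimages coming from \<open>V\<close> and \<open>W\<close>.\<close>

lemma pinv_range_form:
  assumes Q: "Q \<in> carrier_mat k k" "adj Q = Q" and T: "dim_row T = k"
  shows "adj (Q * T) * pinv Q * (Q * T) = adj T * (Q * T)"
proof -
  note p = pinv_hermitian[OF Q]
  have [simp]: "dim_row Q = k" "dim_col Q = k" "dim_row (pinv Q) = k" "dim_col (pinv Q) = k" using Q p by auto
  have "adj (Q * T) * pinv Q * (Q * T) = adj T * ((Q * pinv Q * Q) * T)"
    using T by (simp add: mat_alg Q)
  then show ?thesis by (simp only: p)
qed

lemma adj_four_block:
  assumes "A \<in> carrier_mat a b" "B \<in> carrier_mat a b'" "C \<in> carrier_mat a' b" "D \<in> carrier_mat a' b'"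
  shows "adj (four_block_mat A B C D) = four_block_mat (adj A) (adj C) (adj B) (adj D)"
  using assms by (intro eq_matI) auto

context
  fixes m n :: nat and A :: "nat \<Rightarrow> complex mat"
  assumes A: "\<And>k. k \<le> n \<Longrightarrow> A k \<in> carrier_mat m m"
begin

lemma Smat_0: "Smat m A 0 = A 0"
proof (rule eq_matI)
  have A0: "A 0 \<in> carrier_mat m m" using A by simp
  then show "dim_row (Smat m A 0) = dim_row (A 0)" "dim_col (Smat m A 0) = dim_col (A 0)" by auto
  fix i j assume "i < dim_row (A 0)" "j < dim_col (A 0)"
  then show "Smat m A 0 $$ (i,j) = A 0 $$ (i,j)" using A0 by (subst Smat_index) auto
qed

text \<open>Two borderings are used. Splitting off the first block row and column matches the column
  (I; V) of the right polynomials; \<open>Smat_bot\<close> splits off the last ones and matches the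
  adjoint of (W, I).\<close>

lemma Smat_top: "n = Suc k \<Longrightarrow> Smat m A n = four_block_mat (A 0) (0\<^sub>m m (n*m)) (yvec m A n) (Smat m A k)"
  (is "_ \<Longrightarrow> _ = ?B")
proof (rule eq_matI)
  assume n: "n = Suc k"
  show "dim_row (Smat m A n) = dim_row ?B" "dim_col (Smat m A n) = dim_col ?B" using n A[of 0] by auto
  fix i j assume "i < dim_row ?B" "j < dim_col ?B"
  then have ij: "i < (n+1)*m" "j < (n+1)*m" using A[of 0] n by auto
  obtain q r where i: "i = q * m + r" "r < m" "q \<le> n" using ij(1) by (rule block_index)
  obtain q' r' where j: "j = q' * m + r'" "r' < m" "q' \<le> n" using ij(2) by (rule block_index)
  have A': "\<And>i. i \<le> k \<Longrightarrow> A i \<in> carrier_mat m m" using A n by auto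
  have less: "q * m + r < m \<longleftrightarrow> q = 0" if "r < m" for q r using that by (cases q) auto
  have minus: "q * m + r - m = (q - 1) * m + r" if "q \<noteq> 0" for q r using that by (cases q) auto
  have S_ix: "Smat m A n $$ (i,j) = (if q' \<le> q then A (q - q') $$ (r,r') else 0)"
    using i j ij by (simp add: Smat_index A)
  have S'_ix: "Smat m A k $$ ((q - 1) * m + r, (q' - 1) * m + r') = (if q' \<le> q then A (q - q') $$ (r,r') else 0)"
    if "q \<noteq> 0" "q' \<noteq> 0"
  proof -
    have "q - 1 \<le> k" "q' - 1 \<le> k" using i j n by auto
    then show ?thesis using i(2) j(2) that block_less[of r m "q - 1" k] block_less[of r' m "q' - 1" k]
      by (subst Smat_index) (auto intro: A')
  qed
  have y_ix: "yvec m A n $$ ((q - 1) * m + r, r') = A q $$ (r,r')" if "q \<noteq> 0"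
  proof -
    have "(q - 1) * m + r < n * m" using block_less[of r m "q - 1" k] i n that by simp
    then show ?thesis using i(2) j(2) that by (simp add: yvec_def blockmat_def)
  qed
  have "?B $$ (i,j) = (if i < m then if j < m then A 0 $$ (i,j) else 0
      else if j < m then yvec m A n $$ (i - m, j) else Smat m A k $$ (i - m, j - m))"
    using ij A[of 0] n by auto
  also have "\<dots> = Smat m A n $$ (i,j)"
    unfolding S_ix unfolding i(1) j(1) using i j S'_ix y_ix by (auto simp: less minus)
  finally show "Smat m A n $$ (i,j) = ?B $$ (i,j)" by simp
qed

lemma Smat_bot: "n = Suc k \<Longrightarrow> Smat m A n = four_block_mat (Smat m A k) (0\<^sub>m (n*m) m) (zvec m A n) (A 0)"
  (is "_ \<Longrightarrow> _ = ?B")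
proof (rule eq_matI)
  assume n: "n = Suc k"
  show "dim_row (Smat m A n) = dim_row ?B" "dim_col (Smat m A n) = dim_col ?B" using n A[of 0] by auto
  fix i j assume "i < dim_row ?B" "j < dim_col ?B"
  then have ij: "i < (n+1)*m" "j < (n+1)*m" using A[of 0] n by auto
  obtain q r where i: "i = q * m + r" "r < m" "q \<le> n" using ij(1) by (rule block_index)
  obtain q' r' where j: "j = q' * m + r'" "r' < m" "q' \<le> n" using ij(2) by (rule block_index)
  have A': "\<And>i. i \<le> k \<Longrightarrow> A i \<in> carrier_mat m m" using A n by auto
  have less: "q * m + r < n * m \<longleftrightarrow> q \<noteq> n" if "r < m" "q \<le> n" for q r
    using that n block_less[of r m q k] by (cases "q = n") auto
  have S_ix: "Smat m A n $$ (i,j) = (if q' \<le> q then A (q - q') $$ (r,r') else 0)"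
    using i j ij by (simp add: Smat_index A)
  have S'_ix: "Smat m A k $$ (q * m + r, q' * m + r') = (if q' \<le> q then A (q - q') $$ (r,r') else 0)"
    if "q \<noteq> n" "q' \<noteq> n"
  proof -
    have "q \<le> k" "q' \<le> k" using i j n that by auto
    then show ?thesis using i(2) j(2) block_less[of r m q k] block_less[of r' m q' k]
      by (subst Smat_index) (auto intro: A')
  qed
  have z_ix: "zvec m A n $$ (r, q' * m + r') = A (n - q') $$ (r,r')" if "q' \<noteq> n"
  proof -
    have "q' * m + r' < n * m" using less j that by auto
    then show ?thesis using i(2) j(2) that by (simp add: zvec_def blockmat_def)
  qed
  have "?B $$ (i,j) = (if i < n*m then if j < n*m then Smat m A k $$ (i,j) else 0
      else if j < n*m then zvec m A n $$ (i - n*m, j) else A 0 $$ (i - n*m, j - n*m))"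
    using ij A[of 0] n by auto
  also have "\<dots> = Smat m A n $$ (i,j)"
    unfolding S_ix unfolding i(1) j(1) using i j S'_ix z_ix by (auto simp: less)
  finally show "Smat m A n $$ (i,j) = ?B $$ (i,j)" by simp
qed

end

text \<open>Viewing the block-diagonal J as the Toeplitz matrix of J, 0, 0, ... lets it inherit both
  borderings.\<close>

lemma Jblk_Smat: "Jblk m J n = Smat m (\<lambda>k. if k = 0 then J else 0\<^sub>m m m) n"
  unfolding Jblk_def Smat_def
  by (rule arg_cong[of _ _ "blockmat m (n+1) (n+1)"]) (auto intro!: ext)

lemma Jblk_four_block:
  assumes J: "J \<in> carrier_mat m m" and n: "n = Suc k"
  shows "Jblk m J n = four_block_mat J (0\<^sub>m m (n*m)) (0\<^sub>m (n*m) m) (Jblk m J k)"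
    "Jblk m J n = four_block_mat (Jblk m J k) (0\<^sub>m (n*m) m) (0\<^sub>m m (n*m)) J"
proof -
  let ?B = "\<lambda>k. if k = 0 then J else 0\<^sub>m m m"
  have B: "\<And>k. k \<le> n \<Longrightarrow> ?B k \<in> carrier_mat m m" using J by auto
  have y: "yvec m ?B n = 0\<^sub>m (n*m) m"
    by (rule eq_matI) (auto simp: yvec_def blockmat_def)
  have z: "zvec m ?B n = 0\<^sub>m m (n*m)"
  proof (rule eq_matI)
    fix i j assume "i < dim_row (0\<^sub>m m (n*m) :: complex mat)" "j < dim_col (0\<^sub>m m (n*m) :: complex mat)"
    then have ij: "i < m" "j < n * m" by auto
    have "j div m < n" using ij by (simp add: less_mult_imp_div_less)
    then show "zvec m ?B n $$ (i,j) = 0\<^sub>m m (n*m) $$ (i,j)"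
      using ij by (auto simp: zvec_def blockmat_def)
  qed auto
  show "Jblk m J n = four_block_mat J (0\<^sub>m m (n*m)) (0\<^sub>m (n*m) m) (Jblk m J k)"
    using Smat_top[OF B n] by (simp add: y Jblk_Smat)
  show "Jblk m J n = four_block_mat (Jblk m J k) (0\<^sub>m (n*m) m) (0\<^sub>m m (n*m)) J"
    using Smat_bot[OF B n] by (simp add: z Jblk_Smat)
qed

lemma evec_mult:
  assumes X: "dim_row X = (k+1)*m" "dim_col X = m" and ij: "i < m" "j < m"
  shows "(evec k m w * X) $$ (i,j) = (\<Sum>p\<le>k. w ^ p * X $$ (p * m + i, j))"
proof -
  have E: "evec k m w $$ (i, q * m + r) = (if r = i then w ^ q else 0)" if "q \<le> k" "r < m" for q r
    using that ij block_less[OF that(2,1)] by (simp add: evec_def blockmat_def)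
  have "(evec k m w * X) $$ (i,j) = (\<Sum>c<(k+1)*m. evec k m w $$ (i,c) * X $$ (c,j))"
    using assms by (subst mult_index_sum) (auto simp: evec_def)
  also have "\<dots> = (\<Sum>q<k+1. \<Sum>r<m. evec k m w $$ (i, q * m + r) * X $$ (q * m + r,j))"
    by (rule sum_blocks)
  also have "\<dots> = (\<Sum>q<k+1. w ^ q * X $$ (q * m + i, j))"
    using ij by (intro sum.cong refl, subst single_sum[of i]) (auto simp: E)
  also have "{..<k+1} = {..k}" by auto
  finally show ?thesis .
qed

lemma mult_epsvec:
  assumes X: "dim_col X = (k+1)*m" "dim_row X = m" and ij: "i < m" "j < m"
  shows "(X * epsvec k m w) $$ (i,j) = (\<Sum>p\<le>k. w ^ (k - p) * X $$ (i, p * m + j))"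
proof -
  have E: "epsvec k m w $$ (q * m + r, j) = (if r = j then w ^ (k - q) else 0)" if "q \<le> k" "r < m" for q r
    using that ij block_less[OF that(2,1)] by (simp add: epsvec_def blockmat_def)
  have "(X * epsvec k m w) $$ (i,j) = (\<Sum>c<(k+1)*m. X $$ (i,c) * epsvec k m w $$ (c,j))"
    using assms by (subst mult_index_sum) (auto simp: epsvec_def)
  also have "\<dots> = (\<Sum>q<k+1. \<Sum>r<m. X $$ (i, q * m + r) * epsvec k m w $$ (q * m + r,j))"
    by (rule sum_blocks)
  also have "\<dots> = (\<Sum>q<k+1. w ^ (k - q) * X $$ (i, q * m + j))"
    using ij by (intro sum.cong refl, subst single_sum[of j]) (auto simp: E)
  also have "{..<k+1} = {..k}" by auto
  finally show ?thesis .
qed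

section \<open>The associated polynomials as stacked coefficient columns\<close>

context
  fixes m n :: nat and J :: "complex mat" and A :: "nat \<Rightarrow> complex mat"
  assumes m: "0 < m" and J: "signature m J" and A: "\<And>k. k \<le> n \<Longrightarrow> A k \<in> carrier_mat m m"
begin

lemma Jc: "J \<in> carrier_mat m m" "dim_row J = m" "dim_col J = m" "adj J = J" "J * J = 1\<^sub>m m"
  using J by (auto simp: signature_def)

text \<open>The coefficient sequence of the instance is a mere placeholder; the clause extracted
  from it concerns J alone.\<close>

lemma Jblk_signature: "signature ((k+1)*m) (Jblk m J k)"
  using toeplitz_instance[OF J m, of k "\<lambda>_. 1\<^sub>m m"] by (simp add: toeplitz_kernel_def)

lemma sum_atMost_top: "(\<Sum>p\<le>Suc k. w ^ p * f p) = f 0 + w * (\<Sum>p\<le>k. w ^ p * f (Suc p))" for f :: "nat \<Rightarrow> complex"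
  by (subst sum.atMost_Suc_shift) (simp add: sum_distrib_left mult_ac)

text \<open>With \<open>U\<close> = (I; V) and T = Jb (y + S V), the equation for V reads Jb V = S^*
  T, which says that all blocks of Q_n U but the first vanish. The first block is J - A_0^* J A_0 -
  y^* T, and this is R_{n+1} once the pseudoinverse term is evaluated.\<close>

lemma right_polynomials:
  assumes V: "n \<ge> 1 \<Longrightarrow> V \<in> Yset m J A n"
  obtains U where "U \<in> carrier_mat ((n+1)*m) m" "first_block m n * U = 1\<^sub>m m"
    "Qmat m J A n * U = adj (first_block m n) * Rmat m J A n"
    "\<And>w. rhoJ m V n w = first_block m n * shift_inv m n w * U"
    "\<And>w. piJ m A V n w = first_block m n * shift_inv m n w * (Smat m A n * U)"
proof (cases n)
  case 0
  have S0: "Smat m A 0 = A 0" by (rule Smat_0[OF A])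
  have J0: "Jblk m J 0 = J" using Jc m by (intro eq_matI) (auto simp: Jblk_index)
  have E: "shift_inv m n w = 1\<^sub>m m" for w
    by (intro eq_matI) (auto simp: 0 shift_inv_def)
  have F: "first_block m n = 1\<^sub>m m" by (intro eq_matI) (auto simp: first_block_def 0)
  have d: "dim_row (A 0) = m" "dim_col (A 0) = m" using A[of 0] by auto
  show thesis
    by (rule that[of "1\<^sub>m m"])
      (simp_all add: E 0 F[unfolded 0] E[unfolded 0] rhoJ_def piJ_def S0 Qmat_def Rmat_def J0 one_mult_dim d Jc)
next
  case (Suc k)
  define Jb where "Jb = Jblk m J k"
  define S where "S = Smat m A k"
  define y where "y = yvec m A n"
  have VY: "V \<in> carrier_mat (n * m) m" "Qmat m J A k * V = adj S * Jb * y"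
    using V Suc by (auto simp: Yset_def S_def Jb_def y_def)
  have d [simp]: "dim_row S = n*m" "dim_col S = n*m" "dim_row Jb = n*m" "dim_col Jb = n*m" "dim_row y = n*m" "dim_col y = m"
    "dim_row V = n*m" "dim_col V = m" "dim_row J = m" "dim_col J = m" "dim_row (A 0) = m" "dim_col (A 0) = m"
    using VY A[of 0] Jc Suc by (auto simp: S_def Jb_def y_def)
  have c [simp]: "S \<in> carrier_mat (n*m) (n*m)" "Jb \<in> carrier_mat (n*m) (n*m)" "y \<in> carrier_mat (n*m) m"
    "J \<in> carrier_mat m m" "A 0 \<in> carrier_mat m m" "V \<in> carrier_mat (n*m) m"
    by (auto intro!: carrier_matI)
  have Jb: "adj Jb = Jb" "Jb * Jb = 1\<^sub>m (n*m)" using Jblk_signature[of k] Suc by (auto simp: signature_def Jb_def)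
  have JJX: "Jb * (Jb * X) = X" if "dim_row X = n*m" for X
    using that by (simp add: mult_assoc_dim[symmetric] Jb one_mult_dim)
  have Q: "Jb * V = adj S * (Jb * (y + S * V))"
  proof -
    have "Jb * V - adj S * (Jb * (S * V)) = adj S * (Jb * y)"
      using VY(2) by (simp add: Qmat_def S_def[symmetric] Jb_def[symmetric] mat_alg)
    then have e: "(Jb * V - adj S * (Jb * (S * V))) $$ (i,j) = (adj S * (Jb * y)) $$ (i,j)" for i j by simp
    show ?thesis
    proof (rule eq_matI)
      fix i j assume "i < dim_row (adj S * (Jb * (y + S * V)))" "j < dim_col (adj S * (Jb * (y + S * V)))"
      then show "(Jb * V) $$ (i,j) = (adj S * (Jb * (y + S * V))) $$ (i,j)"
        using e[of i j] by (simp add: mat_alg del: index_mult_mat(1)) (simp add: algebra_simps)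
    qed auto
  qed
  define T where "T = Jb * (y + S * V)"
  have Td [simp]: "dim_row T = n*m" "dim_col T = m" "T \<in> carrier_mat (n*m) m" by (auto simp: T_def intro!: carrier_matI)
  define P where "P = Pmat m J A k"
  have P: "P = Jb - S * (Jb * adj S)" by (simp add: P_def Pmat_def Jb_def S_def mat_alg)
  \<comment> \<open>\<open>T\<close> is a preimage of \<open>y\<close> under \<open>P\<close>,
    whichever solution V was chosen, so the pseudoinverse can be replaced by \<open>T\<close> in the
    quadratic term of \<open>Rmat\<close>.\<close>
  have PT: "P * T = y"
  proof -
    have "S * (Jb * (adj S * T)) = S * (Jb * (Jb * V))" by (simp only: Q T_def)
    then have "P * T = Jb * T - S * V" by (simp add: P mat_alg JJX)
    also have "\<dots> = y" by (rule eq_matI; simp add: T_def JJX del: index_mult_mat(1))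
    finally show ?thesis .
  qed
  have R: "Rmat m J A n = J - adj (A 0) * J * A 0 - adj y * T"
  proof -
    have "adj y * pinv P * y = adj y * T"
    proof -
      have "adj (P * T) * pinv P * (P * T) = adj T * (P * T)"
        by (rule pinv_range_form) (auto simp: P mat_alg Jb intro!: carrier_matI)
      also have "\<dots> = adj (P * T) * T" by (simp add: P mat_alg Jb)
      finally show ?thesis by (simp only: PT)
    qed
    then show ?thesis using Suc by (simp add: Rmat_def P_def y_def)
  qed
  define U where "U = 1\<^sub>m m @\<^sub>r V"
  have Uc: "U \<in> carrier_mat ((n+1)*m) m" by (auto simp: U_def intro!: carrier_matI)
  have S4: "Smat m A n = four_block_mat (A 0) (0\<^sub>m m (n*m)) y S" using Smat_top[OF A Suc] by (simp add: y_def S_def)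
  have J4: "Jblk m J n = four_block_mat J (0\<^sub>m m (n*m)) (0\<^sub>m (n*m) m) Jb" using Jblk_four_block(1)[OF Jc(1) Suc] by (simp add: Jb_def)
  have S4a: "adj (Smat m A n) = four_block_mat (adj (A 0)) (adj y) (0\<^sub>m (n*m) m) (adj S)"
    unfolding S4 by (subst adj_four_block[of _ m m _ "n*m" _ "n*m"]) auto
  have SU: "Smat m A n * U = A 0 @\<^sub>r (y + S * V)"
    unfolding S4 U_def by (subst col_stack_mult[of _ m m _ "n*m" _ "n*m"]) (auto simp: one_mult_dim zero_mult_dim intro!: arg_cong2[of _ _ _ _ append_rows] eq_matI)
  have JSU: "Jblk m J n * (Smat m A n * U) = (J * A 0) @\<^sub>r T"
    unfolding SU unfolding J4 by (subst col_stack_mult[of _ m m _ "n*m" _ "n*m" _ _ m])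
      (auto simp: one_mult_dim zero_mult_dim T_def intro!: arg_cong2[of _ _ _ _ append_rows] left_add_zero_mat right_add_zero_mat carrier_matI)
  have SJSU: "adj (Smat m A n) * (Jblk m J n * (Smat m A n * U)) = (adj (A 0) * (J * A 0) + adj y * T) @\<^sub>r (adj S * T)"
    unfolding JSU unfolding S4a by (subst col_stack_mult[of _ m m _ "n*m" _ "n*m" _ _ m])
      (auto simp: one_mult_dim zero_mult_dim intro!: arg_cong2[of _ _ _ _ append_rows] left_add_zero_mat right_add_zero_mat carrier_matI)
  have JU: "Jblk m J n * U = J @\<^sub>r (Jb * V)"
    unfolding J4 U_def by (subst col_stack_mult[of _ m m _ "n*m" _ "n*m" _ _ m])
      (auto simp: one_mult_dim zero_mult_dim intro!: arg_cong2[of _ _ _ _ append_rows] left_add_zero_mat right_add_zero_mat carrier_matI)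
  have "Qmat m J A n * U = Jblk m J n * U - adj (Smat m A n) * (Jblk m J n * (Smat m A n * U))"
    using Uc by (simp add: Qmat_def mat_alg)
  also have "\<dots> = (J - (adj (A 0) * (J * A 0) + adj y * T)) @\<^sub>r (Jb * V - adj S * T)"
    unfolding JU SJSU by (rule append_rows_diff[of _ m m _ "n*m"]) (auto intro!: carrier_matI)
  also have "Jb * V - adj S * T = 0\<^sub>m (n*m) m" unfolding Q T_def[symmetric] by (rule eq_matI; simp del: index_mult_mat(1))
  also have "J - (adj (A 0) * (J * A 0) + adj y * T) = Rmat m J A n"
    unfolding R by (rule eq_matI; simp add: mat_alg del: index_mult_mat(1))
  also have "Rmat m J A n @\<^sub>r 0\<^sub>m (n*m) m = adj (first_block m n) * Rmat m J A n"
  proof (rule eq_matI)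
    have Rc: "Rmat m J A n \<in> carrier_mat m m" unfolding R by (auto intro!: carrier_matI)
    then show "dim_row (Rmat m J A n @\<^sub>r 0\<^sub>m (n*m) m) = dim_row (adj (first_block m n) * Rmat m J A n)"
      "dim_col (Rmat m J A n @\<^sub>r 0\<^sub>m (n*m) m) = dim_col (adj (first_block m n) * Rmat m J A n)" by auto
    fix i j assume "i < dim_row (adj (first_block m n) * Rmat m J A n)" "j < dim_col (adj (first_block m n) * Rmat m J A n)"
    then show "(Rmat m J A n @\<^sub>r 0\<^sub>m (n*m) m) $$ (i,j) = (adj (first_block m n) * Rmat m J A n) $$ (i,j)"
      using Rc by (simp add: append_rows_index[OF Rc zero_carrier_mat] adj_first_mult del: index_mult_mat(1))
  qed
  finally have QU: "Qmat m J A n * U = adj (first_block m n) * Rmat m J A n" .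
  have U_ix: "U $$ (p * m + i, j) = (if p = 0 then 1\<^sub>m m $$ (i,j) else V $$ ((p - 1) * m + i, j))"
    if "p \<le> n" "i < m" "j < m" for p i j
    unfolding U_def using that block_less[of i m p n] by (subst append_rows_index[of _ m m _ "n*m"]) (cases p; auto)+
  define G where "G = Smat m A n * U"
  have Gd: "dim_row G = (n+1)*m" "dim_col G = m" using Uc by (auto simp: G_def)
  have SU_ix: "G $$ (p * m + i, j) = (if p = 0 then A 0 $$ (i,j) else (y + S * V) $$ ((p - 1) * m + i, j))"
    if "p \<le> n" "i < m" "j < m" for p i j
    unfolding G_def SU using that block_less[of i m p n] by (subst append_rows_index[of _ m m _ "n*m"]) (cases p; auto intro!: carrier_matI)+
  have dn: "n * m = (k + 1) * m" using Suc by simp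
  show thesis
  proof (rule that[OF Uc _ QU])
    show "first_block m n * U = 1\<^sub>m m"
      by (rule eq_matI) (use Uc U_ix[of 0] in \<open>auto simp: first_mult simp del: index_mult_mat(1)\<close>)
    show "rhoJ m V n w = first_block m n * shift_inv m n w * U" for w
    proof (rule eq_matI)
      fix i j assume "i < dim_row (first_block m n * shift_inv m n w * U)" "j < dim_col (first_block m n * shift_inv m n w * U)"
      then have ij: "i < m" "j < m" using Uc by auto
      have "rhoJ m V n w $$ (i,j) = 1\<^sub>m m $$ (i,j) + w * (evec k m w * V) $$ (i,j)"
        using ij Suc by (simp add: rhoJ_def evec_def del: index_mult_mat(1))
      also have "\<dots> = (first_block m n * shift_inv m n w * U) $$ (i,j)"
        using ij Uc dn by (simp add: evec_mult eval_mult U_ix Suc sum_atMost_top del: index_mult_mat(1) sum.atMost_Suc)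
      finally show "rhoJ m V n w $$ (i,j) = (first_block m n * shift_inv m n w * U) $$ (i,j)" .
    qed (use Uc Suc in \<open>auto simp: rhoJ_def evec_def\<close>)
    show "piJ m A V n w = first_block m n * shift_inv m n w * (Smat m A n * U)" for w
    proof (rule eq_matI)
      fix i j assume "i < dim_row (first_block m n * shift_inv m n w * (Smat m A n * U))" "j < dim_col (first_block m n * shift_inv m n w * (Smat m A n * U))"
      then have ij: "i < m" "j < m" using Uc by auto
      have "piJ m A V n w $$ (i,j) = A 0 $$ (i,j) + w * (evec k m w * (y + S * V)) $$ (i,j)"
        using ij Suc by (simp add: piJ_def evec_def y_def S_def del: index_mult_mat(1))
      also have "\<dots> = (first_block m n * shift_inv m n w * (Smat m A n * U)) $$ (i,j)"
        unfolding G_def[symmetric] using ij Gd dn by (simp add: evec_mult eval_mult SU_ix Suc sum_atMost_top del: index_mult_mat(1) sum.atMost_Suc)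
      finally show "piJ m A V n w $$ (i,j) = (first_block m n * shift_inv m n w * (Smat m A n * U)) $$ (i,j)" .
    qed (use Uc Suc in \<open>auto simp: piJ_def evec_def\<close>)
  qed
qed

text \<open>The adjoint counterpart, with \<open>X\<close> the adjoint of (W, I). The coefficients
  of tau and sigma multiply from the other side and in reverse order, hence the entrywise form with
  exponents n - p: it makes the reciprocals, rather than the polynomials themselves, evaluations of
  X and S^* X.\<close>

lemma left_polynomials:
  assumes W: "n \<ge> 1 \<Longrightarrow> W \<in> Zset m J A n"
  obtains X where "X \<in> carrier_mat ((n+1)*m) m" "last_block m n * X = 1\<^sub>m m"
    "Pmat m J A n * X = adj (last_block m n) * Lmat m J A n"
    "\<And>w i j. i < m \<Longrightarrow> j < m \<Longrightarrow> tauJ m W n w $$ (i,j) = (\<Sum>p\<le>n. w ^ (n - p) * cnj (X $$ (p * m + j, i)))"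
    "\<And>w i j. i < m \<Longrightarrow> j < m \<Longrightarrow> sigmaJ m A W n w $$ (i,j) = (\<Sum>p\<le>n. w ^ (n - p) * cnj ((adj (Smat m A n) * X) $$ (p * m + j, i)))"
    "\<And>w. tauJ m W n w \<in> carrier_mat m m" "\<And>w. sigmaJ m A W n w \<in> carrier_mat m m"
proof (cases n)
  case 0
  have S0: "Smat m A 0 = A 0" by (rule Smat_0[OF A])
  have J0: "Jblk m J 0 = J" using Jc m by (intro eq_matI) (auto simp: Jblk_index)
  have F: "last_block m n = 1\<^sub>m m" by (intro eq_matI) (auto simp: last_block_def 0)
  have d: "dim_row (A 0) = m" "dim_col (A 0) = m" using A[of 0] by auto
  show thesis
    by (rule that[of "1\<^sub>m m"])
      (auto simp add: 0 F[unfolded 0] tauJ_def sigmaJ_def S0 Pmat_def Lmat_def J0 one_mult_dim d Jc intro!: carrier_matI)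
next
  case (Suc k)
  define Jb where "Jb = Jblk m J k"
  define S where "S = Smat m A k"
  define z where "z = adj (zvec m A n)"
  have WZ: "W \<in> carrier_mat m (n * m)" "W * Pmat m J A k = adj z * Jb * adj S"
    using W Suc by (auto simp: Zset_def S_def Jb_def z_def)
  \<comment> \<open>After adjoining, the equation for W has the form of that for V with S and S^*,
    and P and Q, interchanged.\<close>
  define V where "V = adj W"
  have W_V: "W = adj V" by (simp add: V_def)
  have d [simp]: "dim_row S = n*m" "dim_col S = n*m" "dim_row Jb = n*m" "dim_col Jb = n*m" "dim_row z = n*m" "dim_col z = m"
    "dim_row V = n*m" "dim_col V = m" "dim_row J = m" "dim_col J = m" "dim_row (A 0) = m" "dim_col (A 0) = m"
    using WZ A[of 0] Jc Suc by (auto simp: S_def Jb_def z_def V_def)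
  have c [simp]: "S \<in> carrier_mat (n*m) (n*m)" "Jb \<in> carrier_mat (n*m) (n*m)" "z \<in> carrier_mat (n*m) m"
    "J \<in> carrier_mat m m" "A 0 \<in> carrier_mat m m" "V \<in> carrier_mat (n*m) m"
    by (auto intro!: carrier_matI)
  have Jb: "adj Jb = Jb" "Jb * Jb = 1\<^sub>m (n*m)" using Jblk_signature[of k] Suc by (auto simp: signature_def Jb_def)
  have JJX: "Jb * (Jb * X) = X" if "dim_row X = n*m" for X
    using that by (simp add: mult_assoc_dim[symmetric] Jb one_mult_dim)
  have P: "Jb * V = S * (Jb * (z + adj S * V))"
  proof -
    have "adj (W * Pmat m J A k) = adj (adj z * Jb * adj S)" by (simp only: WZ)
    then have "Jb * V - S * (Jb * (adj S * V)) = S * (Jb * z)"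
      by (simp add: W_V Pmat_def S_def[symmetric] Jb_def[symmetric] mat_alg Jb)
    then have e: "(Jb * V - S * (Jb * (adj S * V))) $$ (i,j) = (S * (Jb * z)) $$ (i,j)" for i j by simp
    show ?thesis
    proof (rule eq_matI)
      fix i j assume "i < dim_row (S * (Jb * (z + adj S * V)))" "j < dim_col (S * (Jb * (z + adj S * V)))"
      then show "(Jb * V) $$ (i,j) = (S * (Jb * (z + adj S * V))) $$ (i,j)"
        using e[of i j] by (simp add: mat_alg del: index_mult_mat(1)) (simp add: algebra_simps)
    qed auto
  qed
  define T where "T = Jb * (z + adj S * V)"
  have Td [simp]: "dim_row T = n*m" "dim_col T = m" "T \<in> carrier_mat (n*m) m" by (auto simp: T_def intro!: carrier_matI)
  define Q where "Q = Qmat m J A k"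
  have Q: "Q = Jb - adj S * (Jb * S)" by (simp add: Q_def Qmat_def Jb_def S_def mat_alg)
  have QT: "Q * T = z"
  proof -
    have "adj S * (Jb * (S * T)) = adj S * (Jb * (Jb * V))" by (simp only: P T_def)
    then have "Q * T = Jb * T - adj S * V" by (simp add: Q mat_alg JJX)
    also have "\<dots> = z" by (rule eq_matI; simp add: T_def JJX del: index_mult_mat(1))
    finally show ?thesis .
  qed
  have L: "Lmat m J A n = J - A 0 * J * adj (A 0) - adj z * T"
  proof -
    have "adj z * pinv Q * z = adj z * T"
    proof -
      have "adj (Q * T) * pinv Q * (Q * T) = adj T * (Q * T)"
        by (rule pinv_range_form) (auto simp: Q mat_alg Jb intro!: carrier_matI)
      also have "\<dots> = adj (Q * T) * T" by (simp add: Q mat_alg Jb)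
      finally show ?thesis by (simp only: QT)
    qed
    then show ?thesis using Suc by (simp add: Lmat_def Q_def z_def)
  qed
  define X where "X = V @\<^sub>r 1\<^sub>m m"
  have Xc: "X \<in> carrier_mat ((n+1)*m) m" by (auto simp: X_def intro!: carrier_matI)
  have S4: "Smat m A n = four_block_mat S (0\<^sub>m (n*m) m) (adj z) (A 0)" using Smat_bot[OF A Suc] by (simp add: z_def S_def)
  have J4: "Jblk m J n = four_block_mat Jb (0\<^sub>m (n*m) m) (0\<^sub>m m (n*m)) J" using Jblk_four_block(2)[OF Jc(1) Suc] by (simp add: Jb_def)
  have S4a: "adj (Smat m A n) = four_block_mat (adj S) z (0\<^sub>m m (n*m)) (adj (A 0))"
    unfolding S4 by (subst adj_four_block[of _ "n*m" "n*m" _ m _ m]) auto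
  have SX: "adj (Smat m A n) * X = (z + adj S * V) @\<^sub>r adj (A 0)"
    unfolding S4a X_def by (subst col_stack_mult[of _ "n*m" "n*m" _ m _ m])
      (auto simp: one_mult_dim zero_mult_dim intro!: arg_cong2[of _ _ _ _ append_rows] comm_add_mat left_add_zero_mat right_add_zero_mat carrier_matI)
  have JSX: "Jblk m J n * (adj (Smat m A n) * X) = T @\<^sub>r (J * adj (A 0))"
    unfolding SX unfolding J4 by (subst col_stack_mult[of _ "n*m" "n*m" _ m _ m _ _ m])
      (auto simp: one_mult_dim zero_mult_dim T_def intro!: arg_cong2[of _ _ _ _ append_rows] left_add_zero_mat right_add_zero_mat carrier_matI)
  have SJSX: "Smat m A n * (Jblk m J n * (adj (Smat m A n) * X)) = (S * T) @\<^sub>r (adj z * T + A 0 * (J * adj (A 0)))"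
    unfolding JSX unfolding S4 by (subst col_stack_mult[of _ "n*m" "n*m" _ m _ m _ _ m])
      (auto simp: one_mult_dim zero_mult_dim intro!: arg_cong2[of _ _ _ _ append_rows] left_add_zero_mat right_add_zero_mat carrier_matI)
  have JX: "Jblk m J n * X = (Jb * V) @\<^sub>r J"
    unfolding J4 X_def by (subst col_stack_mult[of _ "n*m" "n*m" _ m _ m _ _ m])
      (auto simp: one_mult_dim zero_mult_dim intro!: arg_cong2[of _ _ _ _ append_rows] left_add_zero_mat right_add_zero_mat carrier_matI)
  have "Pmat m J A n * X = Jblk m J n * X - Smat m A n * (Jblk m J n * (adj (Smat m A n) * X))"
    using Xc by (simp add: Pmat_def mat_alg)
  also have "\<dots> = (Jb * V - S * T) @\<^sub>r (J - (adj z * T + A 0 * (J * adj (A 0))))"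
    unfolding JX SJSX by (rule append_rows_diff[of _ "n*m" m _ m]) (auto intro!: carrier_matI)
  also have "Jb * V - S * T = 0\<^sub>m (n*m) m" unfolding P T_def[symmetric] by (rule eq_matI; simp del: index_mult_mat(1))
  also have "J - (adj z * T + A 0 * (J * adj (A 0))) = Lmat m J A n"
    unfolding L by (rule eq_matI; simp add: mat_alg del: index_mult_mat(1))
  also have "0\<^sub>m (n*m) m @\<^sub>r Lmat m J A n = adj (last_block m n) * Lmat m J A n"
  proof (rule eq_matI)
    have Lc: "Lmat m J A n \<in> carrier_mat m m" unfolding L by (auto intro!: carrier_matI)
    then show "dim_row (0\<^sub>m (n*m) m @\<^sub>r Lmat m J A n) = dim_row (adj (last_block m n) * Lmat m J A n)"
      "dim_col (0\<^sub>m (n*m) m @\<^sub>r Lmat m J A n) = dim_col (adj (last_block m n) * Lmat m J A n)" by auto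
    fix i j assume "i < dim_row (adj (last_block m n) * Lmat m J A n)" "j < dim_col (adj (last_block m n) * Lmat m J A n)"
    then show "(0\<^sub>m (n*m) m @\<^sub>r Lmat m J A n) $$ (i,j) = (adj (last_block m n) * Lmat m J A n) $$ (i,j)"
      using Lc by (subst append_rows_index[OF zero_carrier_mat Lc]) (auto simp add: adj_last_mult simp del: index_mult_mat(1))
  qed
  finally have PX: "Pmat m J A n * X = adj (last_block m n) * Lmat m J A n" .
  have p_less: "p * m + i < n * m \<longleftrightarrow> p \<noteq> n" if "p \<le> n" "i < m" for p i
    using that Suc block_less[of i m p k] by (cases "p = n") auto
  have X_ix: "X $$ (p * m + i, j) = (if p = n then 1\<^sub>m m $$ (i,j) else V $$ (p * m + i, j))"
    if "p \<le> n" "i < m" "j < m" for p i j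
    unfolding X_def using that block_less[of i m p n] p_less[of p i] by (subst append_rows_index[of _ "n*m" m _ m]) auto
  have SX_ix: "(adj (Smat m A n) * X) $$ (p * m + i, j) = (if p = n then adj (A 0) $$ (i,j) else (z + adj S * V) $$ (p * m + i, j))"
    if "p \<le> n" "i < m" "j < m" for p i j
    unfolding SX using that block_less[of i m p n] p_less[of p i] by (subst append_rows_index[of _ "n*m" m _ m]) (auto intro!: carrier_matI)
  have dn: "n * m = (k + 1) * m" using Suc by simp
  \<comment> \<open>For p \<le> k the exponent n - p is one more than k - p, which supplies the
    explicit factor w; the term p = n is the constant coefficient.\<close>
  have sum_n: "(\<Sum>p\<le>n. w ^ (n - p) * f p) = w * (\<Sum>p\<le>k. w ^ (k - p) * f p) + f n" for w and f :: "nat \<Rightarrow> complex"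
  proof -
    have "(\<Sum>p\<le>k. w ^ (n - p) * f p) = w * (\<Sum>p\<le>k. w ^ (k - p) * f p)"
      unfolding sum_distrib_left using Suc by (intro sum.cong) (auto simp: Suc_diff_le)
    then show ?thesis using Suc by simp
  qed
  show thesis
  proof (rule that[OF Xc _ PX])
    show "last_block m n * X = 1\<^sub>m m"
      by (rule eq_matI) (use Xc X_ix[of n] in \<open>auto simp: last_mult simp del: index_mult_mat(1)\<close>)
    show "tauJ m W n w \<in> carrier_mat m m" "sigmaJ m A W n w \<in> carrier_mat m m" for w
      using Suc by (auto simp: tauJ_def sigmaJ_def epsvec_def W_V z_def[symmetric] intro!: carrier_matI)
    fix w i j assume ij: "i < m" "j < m"
    have eps: "dim_row (epsvec k m w) = n * m" "dim_col (epsvec k m w) = m" using Suc by (auto simp: epsvec_def)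
    have z_V: "\<And>p. p \<le> k \<Longrightarrow> p * m + j < n * m" using ij p_less Suc by auto
    have "tauJ m W n w $$ (i,j) = w * (W * epsvec k m w) $$ (i,j) + 1\<^sub>m m $$ (i,j)"
      using ij Suc eps WZ(1) by (simp add: tauJ_def mult_smult_dim del: index_mult_mat(1))
    also have "(W * epsvec k m w) $$ (i,j) = (\<Sum>p\<le>k. w ^ (k - p) * W $$ (i, p * m + j))"
      using WZ dn ij by (intro mult_epsvec) auto
    also have "\<dots> = (\<Sum>p\<le>k. w ^ (k - p) * cnj (X $$ (p * m + j, i)))"
      using ij z_V Suc by (intro sum.cong refl arg_cong2[of _ _ _ _ "(*)"]) (auto simp: X_ix W_V)
    also have "1\<^sub>m m $$ (i,j) = cnj (X $$ (n * m + j, i))"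
      using ij by (simp add: X_ix)
    finally show "tauJ m W n w $$ (i,j) = (\<Sum>p\<le>n. w ^ (n - p) * cnj (X $$ (p * m + j, i)))"
      by (simp only: sum_n)
    have "sigmaJ m A W n w $$ (i,j) = w * ((W * S + adj z) * epsvec k m w) $$ (i,j) + A 0 $$ (i,j)"
      using ij Suc eps WZ(1) d by (simp add: sigmaJ_def mult_smult_dim S_def[symmetric] z_def[symmetric] z_def[THEN arg_cong, of adj, simplified] del: index_mult_mat(1))
    also have "((W * S + adj z) * epsvec k m w) $$ (i,j) = (\<Sum>p\<le>k. w ^ (k - p) * (W * S + adj z) $$ (i, p * m + j))"
      using WZ dn ij by (intro mult_epsvec) auto
    also have "\<dots> = (\<Sum>p\<le>k. w ^ (k - p) * cnj ((adj (Smat m A n) * X) $$ (p * m + j, i)))"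
    proof (intro sum.cong refl arg_cong2[of _ _ _ _ "(*)"])
      fix p assume "p \<in> {..k}"
      then have p: "p \<le> n" "p \<noteq> n" "p * m + j < n * m" using Suc z_V by auto
      have "W * S + adj z = adj (z + adj S * V)" by (simp add: W_V mat_alg, rule comm_add_mat) (auto intro!: carrier_matI)
      then show "(W * S + adj z) $$ (i, p * m + j) = cnj ((adj (Smat m A n) * X) $$ (p * m + j, i))"
        using p ij by (simp add: SX_ix del: index_mult_mat(1))
    qed
    also have "A 0 $$ (i,j) = cnj ((adj (Smat m A n) * X) $$ (n * m + j, i))"
      using ij by (simp add: SX_ix del: index_mult_mat(1))
    finally show "sigmaJ m A W n w $$ (i,j) = (\<Sum>p\<le>n. w ^ (n - p) * cnj ((adj (Smat m A n) * X) $$ (p * m + j, i)))"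
      by (simp only: sum_n)
  qed
qed

end

subsection \<open>Quotients of holomorphic matrix functions\<close>

lemma mat_holo_on_const: "A \<in> carrier_mat m m \<Longrightarrow> mat_holo_on m (\<lambda>_. A) U"
  by (auto simp: mat_holo_on_def)

lemma mat_holo_on_mult:
  assumes "mat_holo_on m F U" "mat_holo_on m G U"
  shows "mat_holo_on m (\<lambda>z. F z * G z) U"
  unfolding mat_holo_on_def
proof (intro conjI ballI allI impI)
  show "F z * G z \<in> carrier_mat m m" if "z \<in> U" for z
    using assms that by (auto simp: mat_holo_on_def)
  fix i j assume ij: "i < m" "j < m"
  have "(\<lambda>z. \<Sum>k<m. F z $$ (i,k) * G z $$ (k,j)) holomorphic_on U"
    using assms ij by (intro holomorphic_intros) (auto simp: mat_holo_on_def)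
  moreover have "(F z * G z) $$ (i,j) = (\<Sum>k<m. F z $$ (i,k) * G z $$ (k,j))" if "z \<in> U" for z
  proof -
    have "F z \<in> carrier_mat m m" "G z \<in> carrier_mat m m" using assms that by (auto simp: mat_holo_on_def)
    then have "dim_row (F z) = m" "dim_col (F z) = m" "dim_row (G z) = m" "dim_col (G z) = m" by auto
    then show ?thesis using ij by (subst mult_index_sum) auto
  qed
  ultimately show "(\<lambda>z. (F z * G z) $$ (i,j)) holomorphic_on U"
    by (simp cong: holomorphic_cong del: index_mult_mat(1))
qed

lemma mat_holo_on_add:
  assumes "mat_holo_on m F U" "mat_holo_on m G U"
  shows "mat_holo_on m (\<lambda>z. F z + G z) U"
  unfolding mat_holo_on_def
proof (intro conjI ballI allI impI)
  show "F z + G z \<in> carrier_mat m m" if "z \<in> U" for z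
    using assms that by (auto simp: mat_holo_on_def)
  fix i j assume ij: "i < m" "j < m"
  have "(\<lambda>z. F z $$ (i,j) + G z $$ (i,j)) holomorphic_on U"
    using assms ij by (intro holomorphic_intros) (auto simp: mat_holo_on_def)
  moreover have "(F z + G z) $$ (i,j) = F z $$ (i,j) + G z $$ (i,j)" if "z \<in> U" for z
    using assms that ij by (subst index_add_mat(1)) (auto simp: mat_holo_on_def)
  ultimately show "(\<lambda>z. (F z + G z) $$ (i,j)) holomorphic_on U"
    by (simp cong: holomorphic_cong)
qed

lemma mat_holo_on_smult:
  assumes "mat_holo_on m F U" "c holomorphic_on U"
  shows "mat_holo_on m (\<lambda>z. c z \<cdot>\<^sub>m F z) U"
  unfolding mat_holo_on_def
proof (intro conjI ballI allI impI)
  show "c z \<cdot>\<^sub>m F z \<in> carrier_mat m m" if "z \<in> U" for z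
    using assms that by (auto simp: mat_holo_on_def)
  fix i j assume ij: "i < m" "j < m"
  have "(\<lambda>z. c z * F z $$ (i,j)) holomorphic_on U"
    using assms ij by (intro holomorphic_intros) (auto simp: mat_holo_on_def)
  moreover have "(c z \<cdot>\<^sub>m F z) $$ (i,j) = c z * F z $$ (i,j)" if "z \<in> U" for z
    using assms that ij by (subst index_smult_mat(1)) (auto simp: mat_holo_on_def)
  ultimately show "(\<lambda>z. (c z \<cdot>\<^sub>m F z) $$ (i,j)) holomorphic_on U"
    by (simp cong: holomorphic_cong)
qed

lemma mat_holo_on_subset: "mat_holo_on m F U \<Longrightarrow> T \<subseteq> U \<Longrightarrow> mat_holo_on m F T"
  unfolding mat_holo_on_def by (blast intro: holomorphic_on_subset)

lemma mat_holo_on_det: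
  assumes "mat_holo_on m F U" shows "(\<lambda>z. det (F z)) holomorphic_on U"
proof -
  have "(\<lambda>z. \<Sum>p | p permutes {0..<m}. signof p * (\<Prod>i = 0..<m. F z $$ (i, p i))) holomorphic_on U"
  proof (intro holomorphic_intros)
    fix p i assume "p \<in> {p. p permutes {0..<m}}" "i \<in> {0..<m}"
    then have "i < m" "p i < m" using permutes_in_image[of p "{0..<m}" i] by auto
    then show "(\<lambda>z. F z $$ (i, p i)) holomorphic_on U" using assms by (auto simp: mat_holo_on_def)
  qed
  moreover have "det (F z) = (\<Sum>p | p permutes {0..<m}. signof p * (\<Prod>i = 0..<m. F z $$ (i, p i)))" if "z \<in> U" for z
    using assms that by (intro det_def') (auto simp: mat_holo_on_def)
  ultimately show ?thesis by (simp cong: holomorphic_cong)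
qed

lemma mat_holo_on_adj_mat:
  assumes F: "mat_holo_on m F U" shows "mat_holo_on m (\<lambda>z. adj_mat (F z)) U"
  unfolding mat_holo_on_def
proof (intro conjI ballI allI impI)
  have c: "F z \<in> carrier_mat m m" if "z \<in> U" for z using F that by (auto simp: mat_holo_on_def)
  then show "adj_mat (F z) \<in> carrier_mat m m" if "z \<in> U" for z
    using that adj_mat(1) by blast
  fix i j assume ij: "i < m" "j < m"
  have "mat_holo_on (m - 1) (\<lambda>z. mat_delete (F z) j i) U"
    unfolding mat_holo_on_def
  proof (intro conjI ballI allI impI)
    show "mat_delete (F z) j i \<in> carrier_mat (m - 1) (m - 1)" if "z \<in> U" for z
      using c[OF that] by (rule mat_delete_carrier)
    fix i' j' assume ij': "i' < m - 1" "j' < m - 1"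
    let ?i = "if i' < j then i' else Suc i'" and ?j = "if j' < i then j' else Suc j'"
    have "(\<lambda>z. F z $$ (?i, ?j)) holomorphic_on U"
      using F ij' ij by (auto simp: mat_holo_on_def)
    moreover have "mat_delete (F z) j i $$ (i',j') = F z $$ (?i, ?j)" if "z \<in> U" for z
      using c[OF that] ij' by (simp add: mat_delete_def)
    ultimately show "(\<lambda>z. mat_delete (F z) j i $$ (i',j')) holomorphic_on U"
      by (simp cong: holomorphic_cong)
  qed
  from mat_holo_on_det[OF this]
  have "(\<lambda>z. (-1) ^ (j + i) * det (mat_delete (F z) j i)) holomorphic_on U"
    by (intro holomorphic_intros)
  moreover have "adj_mat (F z) $$ (i,j) = (-1) ^ (j + i) * det (mat_delete (F z) j i)" if "z \<in> U" for z
    using c[OF that] ij by (auto simp: adj_mat_def cofactor_def)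
  ultimately show "(\<lambda>z. adj_mat (F z) $$ (i,j)) holomorphic_on U"
    by (simp cong: holomorphic_cong)
qed

text \<open>Zeros and nonzeros are treated uniformly, with exponent 0 at a nonzero. The point
  \<open>b\<close> excludes that g vanishes identically on the connected set, so zeros have finite
  order.\<close>

lemma holomorphic_local_factor:
  assumes g: "g holomorphic_on S" and S: "open S" "connected S" and w: "w \<in> S" and b: "b \<in> S" "g b \<noteq> 0"
  obtains r h k where "0 < r" "ball w r \<subseteq> S" "h holomorphic_on ball w r" "g w \<noteq> 0 \<longrightarrow> k = 0"
    "\<forall>z \<in> ball w r. g z = (z - w) ^ k * h z" "\<forall>z \<in> ball w r. h z \<noteq> (0 :: complex)"
proof (cases "g w = 0")
  case True
  have "\<not> g constant_on S" using True b w by (metis constant_on_def)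
  then obtain r h k where "0 < k" "0 < r" "ball w r \<subseteq> S" "h holomorphic_on ball w r"
    "\<And>z. z \<in> ball w r \<Longrightarrow> g z = (z - w) ^ k * h z" "\<And>z. z \<in> ball w r \<Longrightarrow> h z \<noteq> 0"
    using holomorphic_factor_zero_nonconstant[OF g S w True] by metis
  with True show ?thesis by (intro that[of r h k]) auto
next
  case False
  have "isCont g w"
    using holomorphic_on_imp_continuous_on[OF g] S w by (simp add: continuous_on_eq_continuous_at)
  then obtain e where e: "0 < e" "\<And>z. dist w z < e \<Longrightarrow> g z \<noteq> 0"
    using continuous_at_avoid[of w g 0] False by auto
  obtain e' where e': "0 < e'" "ball w e' \<subseteq> S" using S w by (auto simp: open_contains_ball)
  show ?thesis
    by (rule that[of "min e e'" g 0])
      (use e e' False in \<open>auto intro: holomorphic_on_subset[OF g] simp: subset_iff\<close>)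
qed

lemma mat_holo_on_tendsto:
  assumes "mat_holo_on m g (ball w r)" "0 < r" "i < m" "j < m"
  shows "((\<lambda>z. g z $$ (i,j)) \<longlongrightarrow> g w $$ (i,j)) (at w)"
proof -
  have "(\<lambda>z. g z $$ (i,j)) holomorphic_on ball w r" using assms by (auto simp: mat_holo_on_def)
  then have "isCont (\<lambda>z. g z $$ (i,j)) w"
    using assms(2) holomorphic_on_imp_continuous_on continuous_on_eq_continuous_at[OF open_ball]
    by (metis centre_in_ball)
  then show ?thesis by (simp add: isCont_def)
qed

lemma eventually_punctured_ball: "0 < r \<Longrightarrow> (\<And>z. z \<in> ball w r - {w} \<Longrightarrow> P z) \<Longrightarrow> eventually P (at w)"
  for w :: complex
  unfolding eventually_at by (rule exI[of _ r]) (auto simp: dist_commute)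

text \<open>Two holomorphic continuations agree on a punctured ball and are continuous at w, so
  comparing limits entrywise determines the value that \<open>mval\<close> selects.\<close>

lemma mval_eq:
  assumes r: "0 < r" and g: "mat_holo_on m g (ball w r)" and Fg: "\<forall>z \<in> ball w r - {w}. F z = g z"
  shows "mval m F w = g w"
  unfolding mval_def
proof (rule the_equality)
  show "\<exists>g' r. 0 < r \<and> mat_holo_on m g' (ball w r) \<and> (\<forall>z \<in> ball w r - {w}. F z = g' z) \<and> g' w = g w"
    using assms by blast
  fix M assume "\<exists>g r. 0 < r \<and> mat_holo_on m g (ball w r) \<and> (\<forall>z \<in> ball w r - {w}. F z = g z) \<and> g w = M"
  then obtain h s where h: "0 < s" "mat_holo_on m h (ball w s)" "\<forall>z \<in> ball w s - {w}. F z = h z" "h w = M" by blast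
  show "M = g w"
  proof (rule eq_matI)
    have c: "M \<in> carrier_mat m m" "g w \<in> carrier_mat m m"
      using h(1,2,4) r g by (auto simp: mat_holo_on_def)
    then show "dim_row M = dim_row (g w)" "dim_col M = dim_col (g w)" by auto
    fix i j assume "i < dim_row (g w)" "j < dim_col (g w)"
    then have ij: "i < m" "j < m" using c by auto
    have "eventually (\<lambda>z. g z = h z) (at w)"
    proof (rule eventually_punctured_ball[of "min r s"])
      fix z assume "z \<in> ball w (min r s) - {w}"
      then have z: "z \<in> ball w s - {w}" "z \<in> ball w r - {w}" by auto
      show "g z = h z" using bspec[OF h(3) z(1)] bspec[OF Fg z(2)] by simp
    qed (use r h in auto)
    then have "eventually (\<lambda>z. g z $$ (i,j) = h z $$ (i,j)) (at w)" by eventually_elim simp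
    with mat_holo_on_tendsto[OF g r ij] have "((\<lambda>z. h z $$ (i,j)) \<longlongrightarrow> g w $$ (i,j)) (at w)"
      using tendsto_cong by force
    with mat_holo_on_tendsto[OF h(2,1) ij] show "M $$ (i,j) = g w $$ (i,j)"
      using tendsto_unique[OF trivial_limit_at] h(4) by blast
  qed
qed

text \<open>Each quadratic form of the defect depends continuously on the entries, and a nonstrict
  inequality survives the limit. This covers removable singularities at which the denominator is
  singular.\<close>

lemma J_contractive_limit:
  assumes J: "signature m J" and r: "0 < r" and g: "mat_holo_on m g (ball w r)"
    and ev: "eventually (\<lambda>z. J_contractive J (g z)) (at w)"
  shows "J_contractive J (g w)"
  unfolding J_contractive_def
proof (rule psdI[of _ m])
  have Jd [simp]: "dim_row J = m" "dim_col J = m" and Ja [simp]: "adj J = J"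
    using J by (auto simp: signature_def)
  have gc: "g z \<in> carrier_mat m m" if "z \<in> ball w r" for z using g that by (auto simp: mat_holo_on_def)
  from gc[of w] r have gw: "dim_row (g w) = m" "dim_col (g w) = m" by auto
  show "J - adj (g w) * J * g w \<in> carrier_mat m m" by (rule carrier_matI) (auto simp: gw)
  show "adj (J - adj (g w) * J * g w) = J - adj (g w) * J * g w" by (simp add: mat_alg gw)
  fix v :: "complex vec" assume v: "v \<in> carrier_vec m"
  \<comment> \<open>The quadratic form is spelled out in scalar entries, since convergence is
    available for these.\<close>
  define q where "q z = ip v (J *\<^sub>v v) - (\<Sum>i<m. cnj (\<Sum>j<m. g z $$ (i,j) * v $ j) * (\<Sum>k<m. J $$ (i,k) * (\<Sum>j<m. g z $$ (k,j) * v $ j)))" for z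
  have q: "ip v ((J - adj G * J * G) *\<^sub>v v) = ip v (J *\<^sub>v v) -
     (\<Sum>i<m. cnj (\<Sum>j<m. G $$ (i,j) * v $ j) * (\<Sum>k<m. J $$ (i,k) * (\<Sum>j<m. G $$ (k,j) * v $ j)))"
    if G: "G \<in> carrier_mat m m" for G
  proof -
    have Gd: "dim_row G = m" "dim_col G = m" and vd: "dim_vec v = m" using G v by auto
    have "ip v ((J - adj G * J * G) *\<^sub>v v) = ip v (J *\<^sub>v v) - ip v (adj G *\<^sub>v (J *\<^sub>v (G *\<^sub>v v)))"
      using Gd vd by (simp add: mult_vec_dim ip_add mult_assoc_dim)
    also have "ip v (adj G *\<^sub>v (J *\<^sub>v (G *\<^sub>v v))) = ip (G *\<^sub>v v) (J *\<^sub>v (G *\<^sub>v v))"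
      using Gd vd by (subst ip_adj[of G, symmetric]) auto
    also have "\<dots> = (\<Sum>i<m. cnj (\<Sum>j<m. G $$ (i,j) * v $ j) * (\<Sum>k<m. J $$ (i,k) * (\<Sum>j<m. G $$ (k,j) * v $ j)))"
      using Gd vd by (simp add: ip_def mult_mat_vec_sum del: index_mult_mat_vec)
    finally show ?thesis .
  qed
  have "(q \<longlongrightarrow> q w) (at w)"
    unfolding q_def by (intro tendsto_intros mat_holo_on_tendsto[OF g r]) auto
  then have lim: "((\<lambda>z. Re (q z)) \<longlongrightarrow> Re (q w)) (at w)" by (rule tendsto_Re)
  have "eventually (\<lambda>z. z \<in> ball w r) (at w)"
    by (rule eventually_punctured_ball[OF r]) auto
  with ev have "eventually (\<lambda>z. 0 \<le> Re (q z)) (at w)"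
  proof eventually_elim
    case (elim z)
    have "0 \<le> Re (ip v ((J - adj (g z) * J * g z) *\<^sub>v v))"
      using elim gc[of z] v by (intro psdD(3)) (auto simp: J_contractive_def)
    then show ?case unfolding q[OF gc[OF elim(2)]] q_def .
  qed
  then have "0 \<le> Re (q w)" by (intro tendsto_lowerbound[OF lim]) auto
  then show "0 \<le> Re (ip v ((J - adj (g w) * J * g w) *\<^sub>v v))"
    using q[OF gc[of w]] r unfolding q_def by simp
qed

lemma tcoef_expansion:
  assumes f: "\<And>i j. i < m \<Longrightarrow> j < m \<Longrightarrow> (\<lambda>z. f z $$ (i,j)) has_fps_expansion F i j" and ij: "i < m" "j < m"
  shows "tcoef m f k $$ (i,j) = fps_nth (F i j) k"
  using fps_nth_fps_expansion[OF f[OF ij], of k] ij by (simp add: tcoef_def)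

lemma polynomial_expansion:
  "(\<lambda>z. \<Sum>p\<le>n. z ^ p * c p) has_fps_expansion (\<Sum>p\<le>n. fps_X ^ p * fps_const (c p))" for c :: "nat \<Rightarrow> complex"
  by (intro fps_expansion_intros)

lemma polynomial_coeff: "k \<le> n \<Longrightarrow> fps_nth (\<Sum>p\<le>n. fps_X ^ p * fps_const (c p)) k = (c k :: complex)"
  by (simp add: fps_sum_nth fps_X_power_mult_nth if_distrib cong: if_cong)
     (subst sum.remove[of _ k]; auto intro!: sum.neutral)

text \<open>\<open>recip\<close> is defined through derivatives at 0. For a polynomial of degree at
  most n these are read off from its formal power series.\<close>

lemma recip_polynomial:
  assumes b: "\<And>z i j. i < m \<Longrightarrow> j < m \<Longrightarrow> b z $$ (i,j) = (\<Sum>p\<le>n. z ^ p * B p i j)"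
  shows "recip m n b w = mat m m (\<lambda>(i,j). \<Sum>p\<le>n. w ^ (n - p) * cnj (B p j i))"
proof (rule eq_matI)
  fix i j assume "i < dim_row (mat m m (\<lambda>(i,j). \<Sum>p\<le>n. w ^ (n - p) * cnj (B p j i)))"
    "j < dim_col (mat m m (\<lambda>(i,j). \<Sum>p\<le>n. w ^ (n - p) * cnj (B p j i)))"
  then have ij: "i < m" "j < m" by auto
  have "tcoef m b k $$ (j,i) = B k j i" if "k \<le> n" for k
    using tcoef_expansion[of m b "\<lambda>i j. \<Sum>p\<le>n. fps_X ^ p * fps_const (B p i j)" j i k] ij that
      polynomial_expansion[of "\<lambda>p. B p i j" n for i j]
    by (simp add: b polynomial_coeff)
  then show "recip m n b w $$ (i,j) = mat m m (\<lambda>(i,j). \<Sum>p\<le>n. w ^ (n - p) * cnj (B p j i)) $$ (i,j)"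
    using ij by (auto simp: recip_def)
qed (auto simp: recip_def)

lemma zero_in_disc: "(0::complex) \<in> ball 0 1" by simp

section \<open>Regular points, contractivity and Taylor coefficients of a fraction\<close>

context
  fixes m :: nat and N D :: "complex \<Rightarrow> complex mat"
  assumes N: "mat_holo_on m N (ball 0 1)" and D: "mat_holo_on m D (ball 0 1)" and D0: "det (D 0) \<noteq> 0"
begin

text \<open>By the adjugate formula the only singular factor of the quotient is 1 / det, and with k
  the order of the zero of det at w the product with (z - w)^k is holomorphic. The equation is
  claimed only where det is nonzero, as \<open>minv\<close> is unspecified elsewhere.\<close>

lemma fraction_local:
  assumes w: "w \<in> ball 0 1"
  obtains r g k where "0 < r" "ball w r \<subseteq> ball 0 1" "mat_holo_on m g (ball w r)" "det (D w) \<noteq> 0 \<longrightarrow> k = 0"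
    "\<forall>z \<in> ball w r - {w}. det (D z) \<noteq> 0"
    "\<forall>z \<in> ball w r. det (D z) \<noteq> 0 \<longrightarrow> (z - w) ^ k \<cdot>\<^sub>m (N z * minv (D z)) = g z"
proof -
  obtain r h k where h: "0 < r" "ball w r \<subseteq> ball 0 1" "h holomorphic_on ball w r" "det (D w) \<noteq> 0 \<longrightarrow> k = 0"
    "\<forall>z \<in> ball w r. det (D z) = (z - w) ^ k * h z" "\<forall>z \<in> ball w r. h z \<noteq> 0"
    using holomorphic_local_factor[OF mat_holo_on_det[OF D] open_ball connected_ball w zero_in_disc D0] .
  define g where "g z = inverse (h z) \<cdot>\<^sub>m (N z * adj_mat (D z))" for z
  have "mat_holo_on m (\<lambda>z. N z * adj_mat (D z)) (ball w r)"
    by (rule mat_holo_on_subset[OF mat_holo_on_mult[OF N mat_holo_on_adj_mat[OF D]] h(2)])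
  then have g: "mat_holo_on m g (ball w r)"
    unfolding g_def using h by (intro mat_holo_on_smult holomorphic_intros) auto
  have "(z - w) ^ k \<cdot>\<^sub>m (N z * minv (D z)) = g z" if z: "z \<in> ball w r" and d: "det (D z) \<noteq> 0" for z
  proof -
    have c: "N z \<in> carrier_mat m m" "D z \<in> carrier_mat m m"
      using N D h(2) z by (auto simp: mat_holo_on_def)
    have "(z - w) ^ k * inverse (det (D z)) = inverse (h z)"
      using h(5,6) z d by (auto simp: field_simps)
    then show ?thesis
      unfolding minv(4)[OF c(2) d] g_def using c adj_mat(1)[OF c(2)]
      by (simp add: mult_smult_dim smult_smult_dim)
  qed
  with h g show thesis by (intro that[of r g k]) auto
qed

lemma fraction_mero: "mero_on m (\<lambda>z. N z * minv (D z)) (ball 0 1)"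
  unfolding mero_on_def
proof
  fix w :: complex assume w: "w \<in> ball 0 1"
  obtain r g k where g: "0 < r" "ball w r \<subseteq> ball 0 1" "mat_holo_on m g (ball w r)" "det (D w) \<noteq> 0 \<longrightarrow> k = 0"
    "\<forall>z \<in> ball w r - {w}. det (D z) \<noteq> 0"
    "\<forall>z \<in> ball w r. det (D z) \<noteq> 0 \<longrightarrow> (z - w) ^ k \<cdot>\<^sub>m (N z * minv (D z)) = g z"
    using fraction_local[OF w] .
  then show "\<exists>k. holo_pt m (\<lambda>z. (z - w) ^ k \<cdot>\<^sub>m (N z * minv (D z))) w"
    unfolding holo_pt_def by (intro exI[of _ k] exI[of _ g] exI[of _ r]) auto
qed

lemma fraction_regular:
  assumes w: "w \<in> ball 0 1" and d: "det (D w) \<noteq> 0"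
  shows "w \<in> Hset m (\<lambda>z. N z * minv (D z))" "mval m (\<lambda>z. N z * minv (D z)) w = N w * minv (D w)"
proof -
  obtain r g k where g: "0 < r" "ball w r \<subseteq> ball 0 1" "mat_holo_on m g (ball w r)" "det (D w) \<noteq> 0 \<longrightarrow> k = 0"
    "\<forall>z \<in> ball w r - {w}. det (D z) \<noteq> 0"
    "\<forall>z \<in> ball w r. det (D z) \<noteq> 0 \<longrightarrow> (z - w) ^ k \<cdot>\<^sub>m (N z * minv (D z)) = g z"
    using fraction_local[OF w] .
  have eq: "N z * minv (D z) = g z" if "z \<in> ball w r" for z
    using g(4-6) d that by (cases "z = w") auto
  show "w \<in> Hset m (\<lambda>z. N z * minv (D z))"
    using w g(1,3) eq by (auto simp: Hset_def holo_pt_def intro!: exI[of _ g] exI[of _ r])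
  have "mval m (\<lambda>z. N z * minv (D z)) w = g w"
    using g(1,3) eq by (intro mval_eq) auto
  then show "mval m (\<lambda>z. N z * minv (D z)) w = N w * minv (D w)" using eq[of w] g(1) by simp
qed

text \<open>A point of \<open>Hset\<close> may still be a zero of the determinant. Zeros are
  isolated, so contractivity holds on a punctured ball and passes to the value at the
  centre.\<close>

lemma fraction_P_J0:
  assumes J: "signature m J"
    and contr: "\<And>z. z \<in> ball 0 1 \<Longrightarrow> det (D z) \<noteq> 0 \<Longrightarrow> J_contractive J (N z * minv (D z))"
  shows "P_J0 m J (\<lambda>z. N z * minv (D z))"
  unfolding P_J0_def
proof (intro conjI ballI)
  show "0 \<in> Hset m (\<lambda>z. N z * minv (D z))" by (rule fraction_regular) (auto simp: D0)
  fix w assume "w \<in> Hset m (\<lambda>z. N z * minv (D z))"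
  then obtain h s where w: "w \<in> ball 0 1" and h: "0 < s" "mat_holo_on m h (ball w s)" "\<forall>z \<in> ball w s - {w}. N z * minv (D z) = h z"
    by (auto simp: Hset_def holo_pt_def)
  obtain r g k where g: "0 < r" "ball w r \<subseteq> ball 0 1" "mat_holo_on m g (ball w r)" "det (D w) \<noteq> 0 \<longrightarrow> k = 0"
    "\<forall>z \<in> ball w r - {w}. det (D z) \<noteq> 0"
    "\<forall>z \<in> ball w r. det (D z) \<noteq> 0 \<longrightarrow> (z - w) ^ k \<cdot>\<^sub>m (N z * minv (D z)) = g z"
    using fraction_local[OF w] .
  have "eventually (\<lambda>z. J_contractive J (h z)) (at w)"
  proof (rule eventually_punctured_ball[of "min r s"])
    fix z assume z: "z \<in> ball w (min r s) - {w}"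
    then have "J_contractive J (N z * minv (D z))" using g(2,5) by (intro contr) auto
    then show "J_contractive J (h z)" using h(3) z by auto
  qed (use g h in auto)
  from J_contractive_limit[OF J h(1,2) this]
  show "J_contractive J (mval m (\<lambda>z. N z * minv (D z)) w)"
    using mval_eq[OF h] by simp
qed (rule fraction_mero)

text \<open>Near 0 the denominator is invertible, and dividing \<open>eq\<close> by it shows that
  the quotient differs from the prescribed polynomial by z^(n+1) times a holomorphic
  function.\<close>

lemma fraction_tcoef:
  assumes A: "\<And>k. k \<le> n \<Longrightarrow> A k \<in> carrier_mat m m" and H: "mat_holo_on m H (ball 0 1)"
    and eq: "\<And>z. z \<in> ball 0 1 \<Longrightarrow> N z = mat m m (\<lambda>(i,j). \<Sum>p\<le>n. z ^ p * A p $$ (i,j)) * D z + z ^ (n + 1) \<cdot>\<^sub>m H z"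
    and k: "k \<le> n"
  shows "tcoef m (mval m (\<lambda>z. N z * minv (D z))) k = A k"
proof (rule eq_matI)
  define f where "f z = N z * minv (D z)" for z
  show "dim_row (tcoef m (mval m (\<lambda>z. N z * minv (D z))) k) = dim_row (A k)"
    "dim_col (tcoef m (mval m (\<lambda>z. N z * minv (D z))) k) = dim_col (A k)"
    using A[OF k] by (auto simp: tcoef_def)
  fix i j assume "i < dim_row (A k)" "j < dim_col (A k)"
  then have ij: "i < m" "j < m" using A[OF k] by auto
  \<comment> \<open>Used only for a ball around 0 without zeros of the determinant: the exponent is
    0 there because the determinant is nonzero at 0.\<close>
  obtain r h k' where h: "0 < r" "ball (0::complex) r \<subseteq> ball 0 1" "h holomorphic_on ball 0 r" "det (D 0) \<noteq> 0 \<longrightarrow> k' = 0"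
    "\<forall>z \<in> ball 0 r. det (D z) = (z - 0) ^ k' * h z" "\<forall>z \<in> ball 0 r. h z \<noteq> 0"
    using holomorphic_local_factor[OF mat_holo_on_det[OF D] open_ball connected_ball zero_in_disc zero_in_disc D0] .
  then have det_nz: "det (D z) \<noteq> 0" if "z \<in> ball 0 r" for z using that D0 by auto
  have r1: "ball 0 r \<subseteq> ball (0::complex) 1" by fact
  define G where "G z = H z * (inverse (det (D z)) \<cdot>\<^sub>m adj_mat (D z))" for z
  have "mat_holo_on m G (ball 0 r)"
    unfolding G_def
    by (intro mat_holo_on_mult mat_holo_on_smult mat_holo_on_adj_mat mat_holo_on_subset[OF D r1] mat_holo_on_subset[OF H r1] holomorphic_intros mat_holo_on_det[OF mat_holo_on_subset[OF D r1]])
       (use det_nz in auto)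
  then have "(\<lambda>z. G z $$ (i,j)) holomorphic_on ball 0 r" using ij by (auto simp: mat_holo_on_def)
  then have G: "(\<lambda>z. G z $$ (i,j)) has_fps_expansion fps_expansion (\<lambda>z. G z $$ (i,j)) 0"
    using h(1) by (intro has_fps_expansion_fps_expansion[of "ball 0 r"]) auto
  have feq: "mval m f z $$ (i,j) = (\<Sum>p\<le>n. z ^ p * A p $$ (i,j)) + z ^ (n + 1) * G z $$ (i,j)" if z: "z \<in> ball 0 r" for z
  proof -
    have z1: "z \<in> ball 0 1" using z h(2) by auto
    have c: "D z \<in> carrier_mat m m" "H z \<in> carrier_mat m m" using D H z1 by (auto simp: mat_holo_on_def)
    define P where "P = mat m m (\<lambda>(i,j). \<Sum>p\<le>n. z ^ p * A p $$ (i,j))"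
    have P: "dim_row P = m" "dim_col P = m" by (auto simp: P_def)
    note mi = minv[OF c(1) det_nz[OF z]]
    have "mval m f z = (P * D z + z ^ (n + 1) \<cdot>\<^sub>m H z) * minv (D z)"
      unfolding f_def using fraction_regular(2)[OF z1 det_nz[OF z]] eq[OF z1] by (simp add: P_def)
    also have "\<dots> = P * (D z * minv (D z)) + z ^ (n + 1) \<cdot>\<^sub>m (H z * minv (D z))"
      using c P mi(1) by (simp add: mat_alg)
    also have "\<dots> = P + z ^ (n + 1) \<cdot>\<^sub>m G z"
      unfolding mi(2) unfolding G_def mi(4) using P by (simp add: one_mult_dim)
    finally show ?thesis
      using ij c adj_mat(1)[OF c(1)] by (simp add: P_def G_def del: index_mult_mat(1))
  qed
  let ?E = "(\<Sum>p\<le>n. fps_X ^ p * fps_const (A p $$ (i,j))) + fps_X ^ (n + 1) * fps_expansion (\<lambda>z. G z $$ (i,j)) 0"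
  have "(\<lambda>z. (\<Sum>p\<le>n. z ^ p * A p $$ (i,j)) + z ^ (n + 1) * G z $$ (i,j)) has_fps_expansion ?E"
    by (intro fps_expansion_intros polynomial_expansion G)
  moreover have "eventually (\<lambda>z. mval m f z $$ (i,j) = (\<Sum>p\<le>n. z ^ p * A p $$ (i,j)) + z ^ (n + 1) * G z $$ (i,j)) (nhds 0)"
    using eventually_nhds_in_open[of "ball 0 r" "0::complex"] h(1) feq
    by (auto elim!: eventually_mono)
  ultimately have "(\<lambda>z. mval m f z $$ (i,j)) has_fps_expansion ?E"
    by (subst has_fps_expansion_cong) auto
  from fps_nth_fps_expansion[OF this, of k]
  have "(deriv ^^ k) (\<lambda>z. mval m f z $$ (i,j)) 0 / fact k = fps_nth ?E k" by simp
  also have "\<dots> = A k $$ (i,j)"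
    using k by (simp only: fps_add_nth polynomial_coeff fps_X_power_mult_nth) simp
  finally show "tcoef m (mval m (\<lambda>z. N z * minv (D z))) k $$ (i,j) = A k $$ (i,j)"
    using ij by (simp add: tcoef_def f_def[symmetric] f_def[abs_def, symmetric])
qed

end

subsection \<open>The linear fractional parametrization\<close>

text \<open>The row \<open>E_w\<close> of the overview.\<close>

definition block_eval :: "nat \<Rightarrow> nat \<Rightarrow> complex \<Rightarrow> complex mat" where
  "block_eval m n w = first_block m n * shift_inv m n w"

lemma block_eval_dims [simp]: "dim_row (block_eval m n w) = m" "dim_col (block_eval m n w) = (n+1)*m"
  by (auto simp: block_eval_def)

lemma block_eval_mult:
  assumes "dim_row X = (n+1)*m" "i < m" "j < dim_col X"
  shows "(block_eval m n w * X) $$ (i,j) = (\<Sum>p\<le>n. w ^ p * X $$ (p * m + i, j))"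
  unfolding block_eval_def by (rule eval_mult[OF assms])

lemma mat_holo_on_block_eval:
  assumes X: "dim_row X = (n+1)*m" "dim_col X = m"
  shows "mat_holo_on m (\<lambda>w. block_eval m n w * X) U"
  unfolding mat_holo_on_def
  by (auto simp: block_eval_mult X intro!: carrier_matI holomorphic_intros simp del: index_mult_mat(1))

lemma sum_reverse: "(\<Sum>p\<le>n. f (n - p) p) = (\<Sum>p\<le>n. f p (n - p))" for f :: "nat \<Rightarrow> nat \<Rightarrow> complex" and n :: nat
  by (rule sum.reindex_bij_witness[of _ "\<lambda>p. n - p" "\<lambda>p. n - p"]) auto

lemma recip_dims [simp]: "dim_row (recip m n b w) = m" "dim_col (recip m n b w) = m"
  by (auto simp: recip_def)

lemma mat_holo_on_cong: "mat_holo_on m F U \<Longrightarrow> (\<And>z. z \<in> U \<Longrightarrow> G z = F z) \<Longrightarrow> mat_holo_on m G U"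
  unfolding mat_holo_on_def by (simp cong: holomorphic_cong)

lemma recip_left_polynomial:
  assumes X: "dim_row X = (n+1)*m" "dim_col X = m"
    and b: "\<And>z i j. i < m \<Longrightarrow> j < m \<Longrightarrow> b z $$ (i,j) = (\<Sum>p\<le>n. z ^ (n - p) * cnj (X $$ (p * m + j, i)))"
  shows "recip m n b w = block_eval m n w * X"
proof -
  have "recip m n b w = mat m m (\<lambda>(i,j). \<Sum>p\<le>n. w ^ (n - p) * cnj (cnj (X $$ ((n - p) * m + i, j))))"
    by (rule recip_polynomial[where B = "\<lambda>p i j. cnj (X $$ ((n - p) * m + j, i))"])
       (simp add: b sum_reverse[of "\<lambda>p q. _ ^ p * cnj (X $$ (q * m + _, _))" n])
  also have "\<dots> = block_eval m n w * X"
    using X sum_reverse[of "\<lambda>p q. w ^ p * X $$ (p * m + i, j)" n for i j]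
    by (intro eq_matI) (auto simp: block_eval_mult simp del: index_mult_mat(1))
  finally show ?thesis .
qed

text \<open>Conjugating powers of 1 / conj w gives powers of 1 / w, and the prefactor w^n restores
  the exponents n - p. This brings the reflected point into the comparison of the two
  quotients.\<close>

lemma left_polynomial_adj:
  assumes X: "dim_row X = (n+1)*m" "dim_col X = m" and w: "w \<noteq> 0"
    and b: "b \<in> carrier_mat m m" "\<And>i j. i < m \<Longrightarrow> j < m \<Longrightarrow> b $$ (i,j) = (\<Sum>p\<le>n. w ^ (n - p) * cnj (X $$ (p * m + j, i)))"
  shows "b = w ^ n \<cdot>\<^sub>m adj (block_eval m n (1 / cnj w) * X)"
proof (rule eq_matI)
  fix i j assume "i < dim_row (w ^ n \<cdot>\<^sub>m adj (block_eval m n (1 / cnj w) * X))" "j < dim_col (w ^ n \<cdot>\<^sub>m adj (block_eval m n (1 / cnj w) * X))"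
  then have ij: "i < m" "j < m" using X by auto
  have "(w ^ n \<cdot>\<^sub>m adj (block_eval m n (1 / cnj w) * X)) $$ (i,j) = w ^ n * (\<Sum>p\<le>n. (1 / w) ^ p * cnj (X $$ (p * m + j, i)))"
    using ij X by (simp add: block_eval_mult del: index_mult_mat(1))
  also have "\<dots> = (\<Sum>p\<le>n. w ^ (n - p) * cnj (X $$ (p * m + j, i)))"
    unfolding sum_distrib_left using w
    by (intro sum.cong) (auto simp: power_diff power_divide)
  finally show "b $$ (i,j) = (w ^ n \<cdot>\<^sub>m adj (block_eval m n (1 / cnj w) * X)) $$ (i,j)" using b(2)[OF ij] by simp
qed (use b X in auto)

lemma recip_right_polynomial:
  assumes X: "dim_row X = (n+1)*m" "dim_col X = m"
  shows "recip m n (\<lambda>w. block_eval m n w * X) w \<in> carrier_mat m m"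
    "w \<noteq> 0 \<Longrightarrow> recip m n (\<lambda>w. block_eval m n w * X) w = w ^ n \<cdot>\<^sub>m adj (block_eval m n (1 / cnj w) * X)"
proof -
  show c: "recip m n (\<lambda>w. block_eval m n w * X) w \<in> carrier_mat m m" by (auto simp: recip_def)
  have "recip m n (\<lambda>w. block_eval m n w * X) w = mat m m (\<lambda>(i,j). \<Sum>p\<le>n. w ^ (n - p) * cnj (X $$ (p * m + j, i)))"
    by (rule recip_polynomial[where B = "\<lambda>p i j. X $$ (p * m + i, j)"]) (simp add: block_eval_mult X del: index_mult_mat(1))
  then show "w \<noteq> 0 \<Longrightarrow> recip m n (\<lambda>w. block_eval m n w * X) w = w ^ n \<cdot>\<^sub>m adj (block_eval m n (1 / cnj w) * X)"
    by (intro left_polynomial_adj[OF X _ c]) auto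
qed

text \<open>\<^term>\<open>Smat m A n\<close> acts on coefficient columns as multiplication by the polynomial with
  coefficients \<open>A\<close>, truncated after degree \<open>n\<close>; \<open>B\<close> collects the discarded terms.\<close>

lemma toeplitz_truncation:
  assumes A: "\<And>k. k \<le> n \<Longrightarrow> A k \<in> carrier_mat m m"
  obtains B where "\<And>w. B w \<in> carrier_mat m ((n+1)*m)"
    "\<And>i j U. i < m \<Longrightarrow> j < (n+1)*m \<Longrightarrow> (\<lambda>w. B w $$ (i,j)) holomorphic_on U"
    "\<And>w. mat m m (\<lambda>(i,j). \<Sum>p\<le>n. w ^ p * A p $$ (i,j)) * block_eval m n w = block_eval m n w * Smat m A n + w ^ (n + 1) \<cdot>\<^sub>m B w"
proof
  \<comment> \<open>In block column q the terms with p > n - q exceed degree n. For exactly these, q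
    + p \<ge> n + 1, so the subtraction in the exponent is not truncated.\<close>
  define B where "B w = mat m ((n+1)*m) (\<lambda>(i,c). \<Sum>p\<in>{n - c div m<..n}. w ^ (c div m + p - (n + 1)) * A p $$ (i, c mod m))" for w
  show "B w \<in> carrier_mat m ((n+1)*m)" for w by (simp add: B_def)
  show "(\<lambda>w. B w $$ (i,j)) holomorphic_on U" if "i < m" "j < (n+1)*m" for i j U
    using that by (auto simp: B_def intro!: holomorphic_intros)
  fix w
  define P where "P = mat m m (\<lambda>(i,j). \<Sum>p\<le>n. w ^ p * A p $$ (i,j))"
  have Pd [simp]: "dim_row P = m" "dim_col P = m" by (auto simp: P_def)
  show "P * block_eval m n w = block_eval m n w * Smat m A n + w ^ (n + 1) \<cdot>\<^sub>m B w"
  proof (rule eq_matI)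
    fix i c assume "i < dim_row (block_eval m n w * Smat m A n + w ^ (n + 1) \<cdot>\<^sub>m B w)" "c < dim_col (block_eval m n w * Smat m A n + w ^ (n + 1) \<cdot>\<^sub>m B w)"
    then have ic: "i < m" "c < (n+1)*m" by (auto simp: B_def)
    obtain q r where c: "c = q * m + r" "r < m" "q \<le> n" using ic(2) by (rule block_index)
    have E: "block_eval m n w $$ (k, c) = (if k = r then w ^ q else 0)" if "k < m" for k
      unfolding block_eval_def using that ic c by (subst first_mult) (auto simp: shift_inv_def)
    have "(P * block_eval m n w) $$ (i,c) = P $$ (i,r) * block_eval m n w $$ (r,c)"
      using ic c(2,3) by (intro mult_index_single) (auto simp: E simp del: index_mult_mat(1))
    also have "\<dots> = (\<Sum>p\<le>n. w ^ (q + p) * A p $$ (i,r))"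
      using ic c(2,3) by (simp add: E P_def sum_distrib_right sum_distrib_left power_add mult_ac)
    also have "{..n} = {..n - q} \<union> {n - q<..n}" by auto
    also have "(\<Sum>p\<in>{..n - q} \<union> {n - q<..n}. w ^ (q + p) * A p $$ (i,r)) =
       (\<Sum>p\<le>n - q. w ^ (q + p) * A p $$ (i,r)) + (\<Sum>p\<in>{n - q<..n}. w ^ (q + p) * A p $$ (i,r))"
      by (rule sum.union_disjoint) auto
    also have "(\<Sum>p\<in>{n - q<..n}. w ^ (q + p) * A p $$ (i,r)) = (w ^ (n + 1) \<cdot>\<^sub>m B w) $$ (i,c)"
    proof -
      have "w ^ (q + p) = w ^ (n + 1) * w ^ (q + p - (n + 1))" if "p \<in> {n - q<..n}" for p
      proof -
        have "q + p = (n + 1) + (q + p - (n + 1))" using that c(3) by auto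
        then show ?thesis by (metis power_add)
      qed
      then show ?thesis
        using ic c by (simp add: B_def sum_distrib_left mult_ac)
    qed
    also have "(\<Sum>p\<le>n - q. w ^ (q + p) * A p $$ (i,r)) = (block_eval m n w * Smat m A n) $$ (i,c)"
    proof -
      have "(block_eval m n w * Smat m A n) $$ (i,c) = (\<Sum>p\<le>n. w ^ p * Smat m A n $$ (p * m + i, c))"
        using ic by (subst block_eval_mult) auto
      also have "\<dots> = (\<Sum>p\<le>n. if q \<le> p then w ^ p * A (p - q) $$ (i,r) else 0)"
        using ic c block_less[OF ic(1)] by (intro sum.cong) (auto simp: Smat_index A)
      also have "\<dots> = (\<Sum>p\<in>{q..n}. w ^ p * A (p - q) $$ (i,r))"
        by (rule sum.mono_neutral_cong_right) auto
      also have "\<dots> = (\<Sum>p\<le>n - q. w ^ (q + p) * A p $$ (i,r))"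
        by (rule sum.reindex_bij_witness[of _ "\<lambda>p. p + q" "\<lambda>p. p - q"]) (use c in auto)
      finally show ?thesis by simp
    qed
    finally show "(P * block_eval m n w) $$ (i,c) = (block_eval m n w * Smat m A n + w ^ (n + 1) \<cdot>\<^sub>m B w) $$ (i,c)"
      using ic by (simp add: B_def del: index_mult_mat(1))
  qed (auto simp: B_def)
qed

text \<open>The last block holds the coefficient of w^n. Since P X lives in that block, the
  contribution of the Schur function to the interpolation error starts with w^n, before the extra
  factor w.\<close>

lemma block_eval_last: "block_eval m n w * adj (last_block m n) = w ^ n \<cdot>\<^sub>m 1\<^sub>m m"
proof (rule eq_matI)
  fix i j assume "i < dim_row (w ^ n \<cdot>\<^sub>m 1\<^sub>m m)" "j < dim_col (w ^ n \<cdot>\<^sub>m 1\<^sub>m m)"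
  then have ij: "i < m" "j < m" by auto
  have "(block_eval m n w * adj (last_block m n)) $$ (i,j) = (\<Sum>p\<le>n. w ^ p * adj (last_block m n) $$ (p * m + i, j))"
    using ij by (subst block_eval_mult) auto
  also have "\<dots> = w ^ n * adj (last_block m n) $$ (n * m + i, j)"
  proof (subst sum.remove[of _ n])
    have "p * m + i \<noteq> n * m + j" if "p \<in> {..n} - {n}" for p
    proof
      assume "p * m + i = n * m + j"
      then have "(p * m + i) div m = (n * m + j) div m" by simp
      then show False using ij that by simp
    qed
    then have "(\<Sum>p\<in>{..n} - {n}. w ^ p * adj (last_block m n) $$ (p * m + i, j)) = 0"
      using ij by (intro sum.neutral) (auto simp: last_block_def)
    then show "w ^ n * adj (last_block m n) $$ (n * m + i, j) + (\<Sum>p\<in>{..n} - {n}. w ^ p * adj (last_block m n) $$ (p * m + i, j))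
      = w ^ n * adj (last_block m n) $$ (n * m + i, j)" by simp
  qed auto
  also have "\<dots> = (w ^ n \<cdot>\<^sub>m 1\<^sub>m m) $$ (i,j)"
    using ij by (auto simp: last_block_def)
  finally show "(block_eval m n w * adj (last_block m n)) $$ (i,j) = (w ^ n \<cdot>\<^sub>m 1\<^sub>m m) $$ (i,j)" .
qed auto

text \<open>Equality of the meromorphic quotients is expressed pointwise wherever both determinants
  are nonzero; since neither vanishes identically, only isolated points of the disc are left
  out.\<close>

theorem theorem3p2:
  fixes m n :: nat and J :: "complex mat" and A :: "nat \<Rightarrow> complex mat"
    and V W :: "complex mat" and S :: "complex \<Rightarrow> complex mat"
  assumes "0 < m"
    and "signature m J"
    and "J_Potapov m J A n"
    and "n \<ge> 1 \<Longrightarrow> V \<in> Yset m J A n"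
    and "n \<ge> 1 \<Longrightarrow> W \<in> Zset m J A n"
    and "Schur_class m S"
  shows
   "let L = Lmat m J A n; R = Rmat m J A n;
        pi = piJ m A V n; rho = rhoJ m V n; sigma = sigmaJ m A W n; tau = tauJ m W n;
        D1 = (\<lambda>w. w \<cdot>\<^sub>m (J * recip m n sigma w * pinv (msqrt L) * S w * msqrt R) + rho w);
        N1 = (\<lambda>w. w \<cdot>\<^sub>m (J * recip m n tau w * pinv (msqrt L) * S w * msqrt R) + pi w);
        D2 = (\<lambda>w. w \<cdot>\<^sub>m (msqrt L * S w * pinv (msqrt R) * recip m n pi w * J) + tau w);
        N2 = (\<lambda>w. w \<cdot>\<^sub>m (msqrt L * S w * pinv (msqrt R) * recip m n rho w * J) + sigma w);
        f = (\<lambda>w. N1 w * minv (D1 w))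
    in \<not> (\<forall>w \<in> ball 0 1. det (D1 w) = 0)
     \<and> \<not> (\<forall>w \<in> ball 0 1. det (D2 w) = 0)
     \<and> P_J0_interp m J A n f
     \<and> (\<forall>w \<in> ball 0 1. det (D1 w) \<noteq> 0 \<longrightarrow> det (D2 w) \<noteq> 0 \<longrightarrow>
           f w = minv (D2 w) * N2 w)"
proof -
  note m = assms(1) and J = assms(2)
  have A: "\<And>k. k \<le> n \<Longrightarrow> A k \<in> carrier_mat m m" and psdQ: "psd (Jblk m J n - adj (Smat m A n) * Jblk m J n * Smat m A n)"
    using assms(3) by (auto simp: J_Potapov_def)
  have A0: "A 0 \<in> carrier_mat m m" by (rule A) simp
  have Sh: "mat_holo_on m S (ball 0 1)" and Sc: "\<And>w. w \<in> ball 0 1 \<Longrightarrow> contraction m (S w)"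
    using assms(6) by (auto simp: Schur_class_def)
  define d where "d = (n+1)*m"
  define Jb where "Jb = Jblk m J n"
  define Sn where "Sn = Smat m A n"
  define L where "L = Lmat m J A n"
  define R where "R = Rmat m J A n"
  interpret T: toeplitz_kernel m d J Jb Sn "block_shift m n" "first_block m n" "last_block m n" "shift_inv m n"
    unfolding d_def Jb_def Sn_def by (rule toeplitz_instance[OF J m A])
  have E: "T.E w = block_eval m n w" for w by (simp add: block_eval_def)
  have ed: "dim_col (block_eval m n w) = d" for w by (simp add: d_def)
  note block_dims [simp del] and block_eval_dims(2) [simp del] and ed [simp]
  have Sd: "dim_row (S w) = m" "dim_col (S w) = m" if "w \<in> ball 0 1" for w
    using Sc[OF that] by (auto simp: contraction_def)
  obtain U where "U \<in> carrier_mat ((n+1)*m) m" and EU: "first_block m n * U = 1\<^sub>m m"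
    and QU0: "Qmat m J A n * U = adj (first_block m n) * Rmat m J A n"
    and rho: "\<And>w. rhoJ m V n w = first_block m n * shift_inv m n w * U"
    and pi: "\<And>w. piJ m A V n w = first_block m n * shift_inv m n w * (Smat m A n * U)"
    by (rule right_polynomials[OF m J A assms(4)], assumption+) (rule that; blast)
  then have U [simp]: "dim_row U = d" "dim_col U = m" by (auto simp: d_def)
  obtain X where "X \<in> carrier_mat ((n+1)*m) m" and FX: "last_block m n * X = 1\<^sub>m m"
    and PX0: "Pmat m J A n * X = adj (last_block m n) * Lmat m J A n"
    and tau: "\<And>w i j. i < m \<Longrightarrow> j < m \<Longrightarrow> tauJ m W n w $$ (i,j) = (\<Sum>p\<le>n. w ^ (n - p) * cnj (X $$ (p * m + j, i)))"
    and sigma: "\<And>w i j. i < m \<Longrightarrow> j < m \<Longrightarrow> sigmaJ m A W n w $$ (i,j) = (\<Sum>p\<le>n. w ^ (n - p) * cnj ((adj (Smat m A n) * X) $$ (p * m + j, i)))"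
    and tauc: "\<And>w. tauJ m W n w \<in> carrier_mat m m" and sigmac: "\<And>w. sigmaJ m A W n w \<in> carrier_mat m m"
    by (rule left_polynomials[OF m J A assms(5)], assumption+) (rule that; blast)
  then have X [simp]: "dim_row X = d" "dim_col X = m" by (auto simp: d_def)
  have Xd: "dim_row X = (n+1)*m" "dim_row (adj Sn * X) = (n+1)*m" "dim_row (Sn * U) = (n+1)*m" "dim_row U = (n+1)*m"
    using X U T.dims(1,2) unfolding d_def by auto
  have Rd [simp]: "dim_row R = m" "dim_col R = m" and Ld [simp]: "dim_row L = m" "dim_col L = m"
    using A0 T.Jdims by (auto simp: R_def L_def Rmat_def Lmat_def block_dims)
  have QU: "T.Q * U = adj (first_block m n) * R"
    using QU0 unfolding Qmat_def R_def[symmetric] Jb_def[symmetric] Sn_def[symmetric] by (simp add: mult_assoc_dim)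
  have PX: "T.P * X = adj (last_block m n) * L"
    using PX0 unfolding Pmat_def L_def[symmetric] Jb_def[symmetric] Sn_def[symmetric] by (simp add: mult_assoc_dim)
  have Qpsd: "psd T.Q"
    using psdQ unfolding Jb_def[symmetric] Sn_def[symmetric] by (simp add: mult_assoc_dim)
  \<comment> \<open>The Toeplitz matrix is contractive for the block signature \<open>Jb\<close>;
    duality makes its adjoint contractive as well, which is nonnegativity of P.\<close>
  have Ppsd: "psd T.P"
    using J_contractive_adj[OF T.Jb, of Sn] Qpsd by (simp add: mult_assoc_dim carrier_matI)
  \<comment> \<open>R is the compression of Q by U, because the first block of U is I. Similarly L
    is the compression of P by X, so both square roots are genuine.\<close>
  have Rpsd: "psd R"
  proof -
    have "adj U * (T.Q * U) = adj (first_block m n * U) * R" unfolding QU by (simp add: adj_mult mult_assoc_dim)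
    then show ?thesis using psd_congruence[OF Qpsd, of U] by (simp add: EU one_mult_dim)
  qed
  have Lpsd: "psd L"
  proof -
    have "adj X * (T.P * X) = adj (last_block m n * X) * L" unfolding PX by (simp add: adj_mult mult_assoc_dim)
    then show ?thesis using psd_congruence[OF Ppsd, of X] by (simp add: FX one_mult_dim)
  qed
  note RL = psdD(2)[OF Rpsd] psdD(2)[OF Lpsd]
  define l where "l = msqrt L"
  define r where "r = msqrt R"
  note sL = msqrt_psd[OF Lpsd Ld(1), folded l_def] and sR = msqrt_psd[OF Rpsd Rd(1), folded r_def]
  note pL = pinv_hermitian[OF sL(3) psdD(2)[OF sL(1)]] and pR = pinv_hermitian[OF sR(3) psdD(2)[OF sR(1)]]
  have ld [simp]: "dim_row l = m" "dim_col l = m" "dim_row r = m" "dim_col r = m"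
    "dim_row (pinv l) = m" "dim_col (pinv l) = m" "dim_row (pinv r) = m" "dim_col (pinv r) = m"
    using sL(3) sR(3) pL(1) pR(1) by auto
  have la: "adj l = l" "adj r = r" using psdD(2)[OF sL(1)] psdD(2)[OF sR(1)] by auto
  \<comment> \<open>R = r r, and the projection r^+ r acts as the identity on r from the left:
    adjoin r r^+ r = r and use that r and r^+ r are self-adjoint.\<close>
  have rR: "pinv r * R = r"
  proof -
    have "r * (pinv r * r) = r" using pR(2) by (simp add: mult_assoc_dim)
    then have "adj (r * (pinv r * r)) = adj r" by simp
    then have "adj (pinv r * r) * adj r = adj r" by (simp add: adj_mult)
    then show ?thesis by (simp add: pR(5) la mult_assoc_dim sR(2))
  qed
  have Ll: "L * pinv l = l"
  proof -
    have "adj ((l * pinv l) * l) = adj l" using pL(2) by simp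
    then have "adj l * adj (l * pinv l) = adj l" by (subst (asm) adj_mult) auto
    then have "l * (l * pinv l) = l" by (simp only: pL(4) la)
    then show ?thesis by (simp add: mult_assoc_dim[symmetric] sL(2))
  qed
  define Z where "Z w = pinv l * S w * r" for w
  define Y where "Y w = l * S w * pinv r" for w
  have Zd [simp]: "dim_row (Z w) = m" "dim_col (Z w) = m" and Yd [simp]: "dim_row (Y w) = m" "dim_col (Y w) = m" for w
    by (auto simp: Z_def Y_def)
  \<comment> \<open>The compatibility of the two parameters: both sides equal l S r.\<close>
  have YZ: "Y w * R = L * Z w" if "w \<in> ball 0 1" for w
  proof -
    have "Y w * R = l * (S w * (pinv r * R))" using Sd[OF that] by (simp add: Y_def mult_assoc_dim)
    also have "\<dots> = (L * pinv l) * (S w * r)" by (simp only: rR Ll)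
    also have "\<dots> = L * Z w" using Sd[OF that] by (simp add: Z_def mult_assoc_dim)
    finally show ?thesis .
  qed
  define D1 where "D1 w = w \<cdot>\<^sub>m (J * (block_eval m n w * (adj Sn * X) * Z w)) + block_eval m n w * U" for w
  define N1 where "N1 w = w \<cdot>\<^sub>m (J * (block_eval m n w * X * Z w)) + block_eval m n w * (Sn * U)" for w
  define D2 where "D2 w = w \<cdot>\<^sub>m (Y w * (recip m n (piJ m A V n) w * J)) + tauJ m W n w" for w
  define N2 where "N2 w = w \<cdot>\<^sub>m (Y w * (recip m n (rhoJ m V n) w * J)) + sigmaJ m A W n w" for w
  have rho': "rhoJ m V n = (\<lambda>w. block_eval m n w * U)" and pi': "piJ m A V n = (\<lambda>w. block_eval m n w * (Sn * U))"
    using rho pi by (auto simp: block_eval_def Sn_def)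
  have rtau: "recip m n (tauJ m W n) w = block_eval m n w * X" for w
    by (rule recip_left_polynomial) (use Xd tau in auto)
  have rsigma: "recip m n (sigmaJ m A W n) w = block_eval m n w * (adj Sn * X)" for w
    by (rule recip_left_polynomial) (use Xd sigma in \<open>auto simp: Sn_def simp del: index_mult_mat(1)\<close>)
  \<comment> \<open>The primed functions are the expressions of the statement, the unprimed ones
    their form in terms of \<open>block_eval\<close>. They are identified only in the disc, where
    the size of \<open>S w\<close> is known.\<close>
  define D1' where "D1' w = w \<cdot>\<^sub>m (J * recip m n (sigmaJ m A W n) w * pinv l * S w * r) + rhoJ m V n w" for w
  define N1' where "N1' w = w \<cdot>\<^sub>m (J * recip m n (tauJ m W n) w * pinv l * S w * r) + piJ m A V n w" for w
  define D2' where "D2' w = w \<cdot>\<^sub>m (l * S w * pinv r * recip m n (piJ m A V n) w * J) + tauJ m W n w" for w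
  define N2' where "N2' w = w \<cdot>\<^sub>m (l * S w * pinv r * recip m n (rhoJ m V n) w * J) + sigmaJ m A W n w" for w
  have D1_eq: "D1' w = D1 w" and N1_eq: "N1' w = N1 w" and D2_eq: "D2' w = D2 w" and N2_eq: "N2' w = N2 w"
    if "w \<in> ball 0 1" for w
    using Sd[OF that] unfolding D1_def N1_def D2_def N2_def D1'_def N1'_def D2'_def N2'_def rsigma rtau
    by (simp_all add: Z_def Y_def mult_assoc_dim rho' pi')
  have dims12: "D1 w \<in> carrier_mat m m" "N1 w \<in> carrier_mat m m" "D2 w \<in> carrier_mat m m" "N2 w \<in> carrier_mat m m" for w
    using tauc[of w] sigmac[of w] unfolding D1_def N1_def D2_def N2_def by (auto intro!: carrier_matI)
  have zero: "0 \<cdot>\<^sub>m M + M' = M'" if "dim_row M = m" "dim_col M = m" "dim_row M' = m" "dim_col M' = m" for M M' :: "complex mat"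
    using that by (intro eq_matI) auto
  have E0: "block_eval m n 0 * M = first_block m n * M" if "dim_row M = d" for M
  proof (rule eq_matI)
    fix i j assume ij: "i < dim_row (first_block m n * M)" "j < dim_col (first_block m n * M)"
    have "(block_eval m n 0 * M) $$ (i,j) = (\<Sum>p\<le>n. 0 ^ p * M $$ (p * m + i, j))"
      using that ij by (intro block_eval_mult) (auto simp: d_def)
    also have "\<dots> = M $$ (i,j)"
      by (subst sum.remove[of _ 0]) (auto simp: power_0_left)
    finally show "(block_eval m n 0 * M) $$ (i,j) = (first_block m n * M) $$ (i,j)"
      using that ij by (subst first_mult) (auto simp: d_def)
  qed auto
  \<comment> \<open>The factor w removes the Schur function at 0, and the first block of U is I;
    hence the determinant is 1 at 0 for every S.\<close>
  have D10: "D1 0 = 1\<^sub>m m"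
    unfolding D1_def by (subst zero) (auto simp: E0 EU)
  have tau0: "tauJ m W n 0 = 1\<^sub>m m"
  proof (cases "n = 0")
    case False
    then have "W \<in> carrier_mat m (n * m)" using assms(5) by (auto simp: Zset_def)
    then show ?thesis
      using False by (intro eq_matI) (auto simp: tauJ_def scalar_prod_def epsvec_def block_dims)
  qed (simp add: tauJ_def)
  have D20: "D2 0 = 1\<^sub>m m"
    unfolding D2_def using tauc[of 0] by (subst zero) (auto simp: tau0)
  have Z_hol: "mat_holo_on m Z (ball 0 1)"
    unfolding Z_def by (intro mat_holo_on_mult mat_holo_on_const Sh pL sR(3))
  have N_hol: "mat_holo_on m N1 (ball 0 1)" and D_hol: "mat_holo_on m D1 (ball 0 1)"
  proof -
    have Jc: "J \<in> carrier_mat m m" by (rule carrier_matI) auto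
    show "mat_holo_on m N1 (ball 0 1)" "mat_holo_on m D1 (ball 0 1)"
      unfolding N1_def D1_def
      by (intro mat_holo_on_add mat_holo_on_smult mat_holo_on_mult mat_holo_on_const mat_holo_on_block_eval Jc Z_hol holomorphic_intros; use Xd in simp)+
  qed
  have N_hol': "mat_holo_on m N1' (ball 0 1)" and D_hol': "mat_holo_on m D1' (ball 0 1)"
    by (rule mat_holo_on_cong[OF N_hol] mat_holo_on_cong[OF D_hol]; simp add: N1_eq D1_eq)+
  have D0: "det (D1' 0) \<noteq> 0" by (simp add: D10 D1_eq)
  have contr: "J_contractive J (N1 w * minv (D1 w))" if w: "w \<in> ball 0 1" and det: "det (D1 w) \<noteq> 0" for w
  proof -
    note mi = minv[OF dims12(1) det]
    define B where "B = minv (D1 w)"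
    define y where "y = w \<cdot>\<^sub>m Z w"
    have yd [simp]: "dim_row y = m" "dim_col y = m" by (auto simp: y_def)
    have Bd [simp]: "dim_row B = m" "dim_col B = m" using mi(1) by (auto simp: B_def)
    have dd [simp]: "dim_row (D1 w) = m" "dim_col (D1 w) = m" "dim_row (N1 w) = m" "dim_col (N1 w) = m"
      using dims12[of w] by auto
    have D1y: "D1 w = J * (block_eval m n w * (adj Sn * (X * y))) + block_eval m n w * U"
      and N1y: "N1 w = J * (block_eval m n w * (X * y)) + block_eval m n w * (Sn * U)"
      unfolding D1_def N1_def by (simp_all add: y_def mult_assoc_dim mult_smult_dim)
    define K where "K = T.K w (X * y + Jb * (Sn * U))"
    have Kd [simp]: "dim_row K = d" "dim_col K = m" by (auto simp: K_def)
    have id: "adj (D1 w) * (J * D1 w) - adj (N1 w) * (J * N1 w) = (R - adj y * (L * y)) + (1 - cnj w * w) \<cdot>\<^sub>m (adj K * (T.P * K))"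
      unfolding D1y N1y K_def
      by (rule T.fraction_identity[OF U Rd X Ld EU QU FX PX RL yd, unfolded E])
    have wr: "1 - cnj w * w = complex_of_real (1 - (cmod w)\<^sup>2)"
      unfolding of_real_diff of_real_1 complex_norm_square by (simp only: mult.commute)
    have w1: "cmod w \<le> 1" using w by simp
    have p1: "psd (R - adj y * (L * y))"
      using schur_complement_bound[OF Lpsd Ld(1) Rpsd Rd(1) Sc[OF w] w1] by (simp add: y_def Z_def l_def r_def)
    have p2: "psd ((1 - cnj w * w) \<cdot>\<^sub>m (adj K * (T.P * K)))"
      unfolding wr by (rule psd_smult[OF psd_congruence[OF Ppsd]]) (use w1 in \<open>auto simp: power_le_one\<close>)
    have "psd (adj (D1 w) * (J * D1 w) - adj (N1 w) * (J * N1 w))"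
      unfolding id by (rule psd_add[OF p1 p2]) simp
    \<comment> \<open>Congruence with the inverse of the denominator turns the difference of the two
      forms into J - f^* J f.\<close>
    from psd_congruence[OF this, of B]
    have "psd (adj B * ((adj (D1 w) * (J * D1 w) - adj (N1 w) * (J * N1 w)) * B))" by simp
    also have "adj B * ((adj (D1 w) * (J * D1 w) - adj (N1 w) * (J * N1 w)) * B) = adj (D1 w * B) * (J * (D1 w * B)) - adj (N1 w * B) * (J * (N1 w * B))"
      by (simp add: mat_alg)
    also have "D1 w * B = 1\<^sub>m m" using mi(2) by (simp add: B_def)
    finally show ?thesis by (simp add: J_contractive_def B_def[symmetric] one_mult_dim mult_assoc_dim)
  qed
  have interp: "tcoef m (mval m (\<lambda>w. N1' w * minv (D1' w))) k = A k" if k: "k \<le> n" for k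
  proof -
    obtain B where B: "\<And>w. B w \<in> carrier_mat m ((n+1)*m)"
      "\<And>i j U. i < m \<Longrightarrow> j < (n+1)*m \<Longrightarrow> (\<lambda>w. B w $$ (i,j)) holomorphic_on U"
      "\<And>w. mat m m (\<lambda>(i,j). \<Sum>p\<le>n. w ^ p * A p $$ (i,j)) * block_eval m n w = block_eval m n w * Smat m A n + w ^ (n + 1) \<cdot>\<^sub>m B w"
      by (rule toeplitz_truncation[of n A m], erule A) (rule that; blast)
    have Bd: "dim_row (B w) = m" "dim_col (B w) = d" for w using B(1)[of w] by (auto simp: d_def)
    \<comment> \<open>The remainder of N1 - a D1 after division by w^(n+1), where a is the
      prescribed polynomial. The L term comes from P X, the \<open>B\<close> terms from truncating
      the products of a with the two columns in D1.\<close>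
    define H where "H w = L * Z w + (-1) \<cdot>\<^sub>m (B w * U + w \<cdot>\<^sub>m (B w * (Jb * (adj Sn * X)) * Z w))" for w
    have B_hol: "mat_holo_on m (\<lambda>w. B w * M) UU" if "dim_row M = d" "dim_col M = m" for M UU
      unfolding mat_holo_on_def
      using that Bd B(2) by (auto intro!: carrier_matI holomorphic_intros simp: mult_index_sum d_def simp del: index_mult_mat(1))
    have Lc: "L \<in> carrier_mat m m" by (rule carrier_matI) auto
    have H_hol: "mat_holo_on m H (ball 0 1)"
      unfolding H_def by (intro mat_holo_on_add mat_holo_on_smult mat_holo_on_mult mat_holo_on_const B_hol Lc Z_hol holomorphic_intros; simp)
    show ?thesis
    proof (rule fraction_tcoef[OF N_hol' D_hol' D0 A H_hol _ k])
      fix w :: complex assume w: "w \<in> ball 0 1"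
      define a where "a = mat m m (\<lambda>(i,j). \<Sum>p\<le>n. w ^ p * A p $$ (i,j))"
      have ad [simp]: "dim_row a = m" "dim_col a = m" by (auto simp: a_def)
      define Ew where "Ew = block_eval m n w"
      have Ewd [simp]: "dim_row Ew = m" "dim_col Ew = d" by (auto simp: Ew_def d_def)
      have aE: "a * (Ew * M) = Ew * (Sn * M) + w ^ (n + 1) \<cdot>\<^sub>m (B w * M)" if "dim_row M = d" for M
      proof -
        have "a * (Ew * M) = (a * Ew) * M" using that by (simp add: mult_assoc_dim)
        also have "a * Ew = Ew * Sn + w ^ (n + 1) \<cdot>\<^sub>m B w" using B(3)[of w] by (simp only: a_def Ew_def Sn_def)
        finally show ?thesis using that Bd[of w] by (simp add: mat_alg)
      qed
      have JE: "J * (Ew * M) = Ew * (Jb * M)" if "dim_row M = d" for M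
        using T.EJ[OF that, of w] that by (simp add: Ew_def block_eval_def mult_assoc_dim)
      \<comment> \<open>P X is F^* L, and evaluating the last block gives w^n.\<close>
      have EP: "Ew * (Jb * (X * Z w)) - Ew * (Sn * (Jb * (adj Sn * (X * Z w)))) = w ^ n \<cdot>\<^sub>m (L * Z w)"
      proof -
        have "Ew * (Jb * (X * Z w)) - Ew * (Sn * (Jb * (adj Sn * (X * Z w)))) = Ew * ((T.P * X) * Z w)"
          by (simp add: mat_alg)
        also have "\<dots> = (Ew * adj (last_block m n)) * (L * Z w)" unfolding PX by (simp add: mult_assoc_dim)
        finally show ?thesis unfolding Ew_def block_eval_last by (simp add: mat_alg)
      qed
      have EP': "Ew * (Jb * (X * Z w)) = w ^ n \<cdot>\<^sub>m (L * Z w) + Ew * (Sn * (Jb * (adj Sn * (X * Z w))))"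
        by (rule mat_eq_addI[OF EP]) simp_all
      show "N1' w = a * D1' w + w ^ (n + 1) \<cdot>\<^sub>m H w"
        unfolding N1_eq[OF w] D1_eq[OF w] N1_def D1_def H_def Ew_def[symmetric] using Bd[of w]
        by (simp add: mat_alg JE aE EP', intro eq_matI) (auto simp: algebra_simps simp del: index_mult_mat(1))
    qed auto
  qed
  have quot: "N1 w * minv (D1 w) = minv (D2 w) * N2 w" if w: "w \<in> ball 0 1" and d1: "det (D1 w) \<noteq> 0" and d2: "det (D2 w) \<noteq> 0" for w
  proof -
    have comm: "D2 w * N1 w = N2 w * D1 w"
    \<comment> \<open>At 0 there is no reflected point 1 / conj w. There both denominators are I and
      both numerators are \<open>A 0\<close>.\<close>
    proof (cases "w = 0")
      case True
      have A0d: "dim_row (A 0) = m" "dim_col (A 0) = m" using A0 by auto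
      have "sigmaJ m A W n 0 = A 0"
      proof (cases "n = 0")
        case False
        then have "W \<in> carrier_mat m (n * m)" using assms(5) by (auto simp: Zset_def)
        then show ?thesis
          using A0d False by (intro eq_matI) (auto simp: sigmaJ_def scalar_prod_def epsvec_def block_dims)
      qed (simp add: sigmaJ_def)
      then have N20: "N2 0 = A 0"
        unfolding N2_def by (subst zero) (auto simp: A0d)
      have "piJ m A V n 0 = A 0"
      proof (cases "n = 0")
        case False
        then have "V \<in> carrier_mat (n * m) m" using assms(4) by (auto simp: Yset_def)
        then show ?thesis
          using A0d False by (intro eq_matI) (auto simp: piJ_def evec_def block_dims simp del: index_mult_mat(1))
      qed (simp add: piJ_def)
      then have N10: "N1 0 = A 0"
        unfolding N1_def pi' by (subst zero) (auto simp: A0d)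
      show ?thesis using A0 by (simp add: True D10 D20 N10 N20)
    next
      case False
      have t: "tauJ m W n w = w ^ n \<cdot>\<^sub>m adj (block_eval m n (1 / cnj w) * X)"
        by (rule left_polynomial_adj[OF Xd(1) X(2) False tauc tau])
      have s: "sigmaJ m A W n w = w ^ n \<cdot>\<^sub>m adj (block_eval m n (1 / cnj w) * (adj Sn * X))"
        by (rule left_polynomial_adj[OF Xd(2) _ False sigmac sigma[folded Sn_def]]) simp
      have p: "recip m n (piJ m A V n) w = w ^ n \<cdot>\<^sub>m adj (block_eval m n (1 / cnj w) * (Sn * U))"
        unfolding pi' by (rule recip_right_polynomial(2)[OF Xd(3) _ False]) simp
      have r: "recip m n (rhoJ m V n) w = w ^ n \<cdot>\<^sub>m adj (block_eval m n (1 / cnj w) * U)"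
        unfolding rho' by (rule recip_right_polynomial(2)[OF Xd(4) _ False]) simp
      show ?thesis
        unfolding D2_def N2_def N1_def D1_def t s p r
        by (rule T.left_right_fractions[OF U Rd X Ld EU QU FX PX RL False refl Yd Zd YZ[OF w], unfolded E])
    qed
    note m1 = minv[OF dims12(1) d1] and m2 = minv[OF dims12(3) d2]
    have dd: "dim_row (D1 w) = m" "dim_col (D1 w) = m" "dim_row (N1 w) = m" "dim_col (N1 w) = m"
      "dim_row (D2 w) = m" "dim_col (D2 w) = m" "dim_row (N2 w) = m" "dim_col (N2 w) = m"
      "dim_row (minv (D1 w)) = m" "dim_col (minv (D1 w)) = m" "dim_row (minv (D2 w)) = m" "dim_col (minv (D2 w)) = m"
      using dims12[of w] m1(1) m2(1) by auto
    have "N1 w * minv (D1 w) = (minv (D2 w) * D2 w) * (N1 w * minv (D1 w))" unfolding m2(3) by (simp add: one_mult_dim dd)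
    also have "\<dots> = minv (D2 w) * ((D2 w * N1 w) * minv (D1 w))" by (simp add: mult_assoc_dim dd)
    also have "\<dots> = minv (D2 w) * (N2 w * (D1 w * minv (D1 w)))" unfolding comm by (simp add: mult_assoc_dim dd)
    also have "\<dots> = minv (D2 w) * N2 w" unfolding m1(2) by (simp add: one_mult_dim dd)
    finally show ?thesis .
  qed
  have P: "P_J0_interp m J A n (\<lambda>w. N1' w * minv (D1' w))"
    unfolding P_J0_interp_def
    using fraction_P_J0[OF N_hol' D_hol' D0 J] contr interp by (auto simp: D1_eq N1_eq)
  have 1: "\<not> (\<forall>w \<in> ball 0 1. det (D1' w) = 0)" using D0 zero_in_disc by blast
  have "det (D2' 0) \<noteq> 0" by (simp add: D20 D2_eq)
  then have 2: "\<not> (\<forall>w \<in> ball 0 1. det (D2' w) = 0)" using zero_in_disc by blast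
  have 3: "\<forall>w \<in> ball 0 1. det (D1' w) \<noteq> 0 \<longrightarrow> det (D2' w) \<noteq> 0 \<longrightarrow> N1' w * minv (D1' w) = minv (D2' w) * N2' w"
    using quot by (simp add: D1_eq N1_eq D2_eq N2_eq)
  show ?thesis
    using 1 2 P 3 unfolding Let_def D1'_def N1'_def D2'_def N2'_def l_def r_def L_def R_def by blast
qed

end
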